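(* Consider the following two assertions. (A) For every field $K$, every $n\ge1$, every polymatroidal ideal $I\subset S=K[x_1,\dots,x_n]$ and every $i>0$, the module $\mathrm{HS}_i(\mathcal{R}(I))$ is generated in degrees $\le i$ as an $\mathcal{R}(I)$-module. (B) For every field $K$, every $n\ge1$, every polymatroidal ideal $I\subset S=K[x_1,\dots,x_n]$ and every $i>0$, $$\mathrm{Ass}\,\mathrm{HS}_i(I^{i})\subset\mathrm{Ass}\,\mathrm{HS}_i(I^{i+1})\subset\mathrm{Ass}\,\mathrm{HS}_i(I^{i+2})\subset\cdots.$$ Then (A) implies (B).
   Context: $S=K[x_1,\dots,x_n]$ carries its standard $\mathbb{Z}^n$-grading. For a monomial ideal $J$, $\mathcal{G}(J)$ denotes its minimal set of monomial generators, and $\deg_{x_i}(u)$ is the exponent of $x_i$ in the monomial $u$. For $i\ge0$, $\mathrm{HS}_i(J)=(\mathbf{x}^{\mathbf a}:\ \mathrm{Tor}_i^S(K,J)_{\mathbf a}\neq0)$, where $\mathbf{x}^{\mathbf a}=x_1^{a_1}\cdots x_n^{a_n}$ (the zero ideal if $\mathrm{Tor}_i^S(K,J)=0$). For an ideal $L\subset S$, $\mathrm{Ass}\,L$ denotes the set of associated primes of $S/L$. Inclusions $\subset$ are not necessarily strict. A nonzero monomial ideal $I$ is polymatroidal if all elements of $\mathcal{G}(I)$ have the same degree and: for all $u,v\in\mathcal{G}(I)$ and all $i$ with $\deg_{x_i}(u)>\deg_{x_i}(v)$, there is $j$ with $\deg_{x_j}(u)<\deg_{x_j}(v)$ such that $x_j(u/x_i)\in\mathcal{G}(I)$.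 $\mathcal{R}(I)=\bigoplus_{k\ge0}I^k$ is the Rees algebra. For polymatroidal $I$ one has $I\cdot\mathrm{HS}_i(I^k)\subset\mathrm{HS}_i(I^{k+1})$ for all $k\ge1$, so $\mathrm{HS}_i(\mathcal{R}(I))=\bigoplus_{k\ge1}\mathrm{HS}_i(I^k)$ (with $\mathrm{HS}_i(I^k)$ in degree $k$) is a graded $\mathcal{R}(I)$-module by multiplication. *)

theory Defs
  imports
    "HOL-Algebra.Indexed_Polynomials"
    "HOL-Algebra.UnivPoly"
    "HOL-Algebra.QuotRing"
    "HOL-Algebra.Ideal_Product"
begin

section \<open>The polynomial ring in n variables\<close>

text \<open>
  As in \<^theory>\<open>HOL-Algebra.Indexed_Polynomials\<close>, a monomial is the multiset of its variables
  (the multiplicity of \<open>j\<close> is the exponent of the variable with index \<open>j\<close>) and a polynomial maps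
  monomials to coefficients. The variables are indexed by \<open>1, \<dots>, n\<close>.
\<close>

definition monomials :: "nat \<Rightarrow> nat multiset set" where
  "monomials n = {u. set_mset u \<subseteq> {1..n}}"

definition mpoly_ring :: "('k, 'm) ring_scheme \<Rightarrow> nat \<Rightarrow> (nat multiset \<Rightarrow> 'k) ring" where
  "mpoly_ring K n =
    \<lparr>carrier = ring.indexed_pset K {1..n} (carrier K),
     monoid.mult = (\<lambda>p q m. \<Oplus>\<^bsub>K\<^esub>u\<in>{u. u \<subseteq># m}. p u \<otimes>\<^bsub>K\<^esub> q (m - u)),
     one = ring.indexed_const K \<one>\<^bsub>K\<^esub>,
     zero = ring.indexed_const K \<zero>\<^bsub>K\<^esub>,
     add = ring.indexed_padd K\<rparr>"

definition monom_poly :: "('k, 'm) ring_scheme \<Rightarrow> nat multiset \<Rightarrow> (nat multiset \<Rightarrow> 'k)" where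
  "monom_poly K u = (\<lambda>m. if m = u then \<one>\<^bsub>K\<^esub> else \<zero>\<^bsub>K\<^esub>)"

definition monomial_span :: "('k, 'm) ring_scheme \<Rightarrow> nat \<Rightarrow> nat multiset set \<Rightarrow> (nat multiset \<Rightarrow> 'k) set"
  where "monomial_span K n A = genideal (mpoly_ring K n) (monom_poly K ` A)"

definition monomial_ideal :: "('k, 'm) ring_scheme \<Rightarrow> nat \<Rightarrow> (nat multiset \<Rightarrow> 'k) set \<Rightarrow> bool" where
  "monomial_ideal K n J \<longleftrightarrow> (\<exists>A \<subseteq> monomials n. J = monomial_span K n A)"

text \<open>The minimal monomial generating set of a monomial ideal exists and is unique.\<close>

definition mingens :: "('k, 'm) ring_scheme \<Rightarrow> nat \<Rightarrow> (nat multiset \<Rightarrow> 'k) set \<Rightarrow> nat multiset set"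
  where "mingens K n J =
    (THE A. A \<subseteq> monomials n \<and> monomial_span K n A = J \<and>
       (\<forall>B. B \<subset> A \<longrightarrow> monomial_span K n B \<noteq> J))"

definition polymatroidal :: "('k, 'm) ring_scheme \<Rightarrow> nat \<Rightarrow> (nat multiset \<Rightarrow> 'k) set \<Rightarrow> bool" where
  "polymatroidal K n I \<longleftrightarrow>
    monomial_ideal K n I \<and> I \<noteq> {\<zero>\<^bsub>mpoly_ring K n\<^esub>} \<and>
    (\<forall>u \<in> mingens K n I. \<forall>v \<in> mingens K n I. size u = size v) \<and>
    (\<forall>u \<in> mingens K n I. \<forall>v \<in> mingens K n I. \<forall>i \<in> {1..n}. count u i > count v i \<longrightarrow>
       (\<exists>j \<in> {1..n}. count u j < count v j \<and> add_mset j (u - {#i#}) \<in> mingens K n I))"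

definition ideal_pow :: "('a, 'm) ring_scheme \<Rightarrow> 'a set \<Rightarrow> nat \<Rightarrow> 'a set" where
  "ideal_pow R I k = I [^]\<^bsub>ideals_set R\<^esub> k"


section \<open>Multigraded Tor\<close>

text \<open>A multidegree in \<open>\<int>\<^sup>n\<close> is a function \<open>nat \<Rightarrow> int\<close> vanishing outside \<open>{1..n}\<close>.\<close>

definition multidegrees :: "nat \<Rightarrow> (nat \<Rightarrow> int) set" where
  "multidegrees n = {d. \<forall>j. j \<notin> {1..n} \<longrightarrow> d j = 0}"

definition mdeg :: "nat multiset \<Rightarrow> nat \<Rightarrow> int" where
  "mdeg u = (\<lambda>j. int (count u j))"

definition homogeneous :: "('k, 'm) ring_scheme \<Rightarrow> (nat \<Rightarrow> int) \<Rightarrow> (nat multiset \<Rightarrow> 'k) \<Rightarrow> bool" where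
  "homogeneous K d f \<longleftrightarrow> (\<forall>u. f u \<noteq> \<zero>\<^bsub>K\<^esub> \<longrightarrow> mdeg u = d)"

text \<open>
  A complex of finitely generated graded free modules \<open>\<cdots> \<rightarrow> F\<^sub>1 \<rightarrow> F\<^sub>0\<close> over
  \<open>S = mpoly_ring K n\<close>, together with an augmentation \<open>F\<^sub>0 \<rightarrow> K\<close>:
  \<open>F\<^sub>i\<close> has a homogeneous basis indexed by the numbers below \<open>rnk F i\<close>, the degree of the
  \<open>p\<close>-th basis element is \<open>shift F i p\<close>, and \<open>(diff F i p q)\<close> (row \<open>p\<close>, column \<open>q\<close>) is the
  matrix of \<open>F\<^bsub>i+1\<^esub> \<rightarrow> F\<^sub>i\<close>. The augmentation sends the \<open>p\<close>-th basis element of \<open>F\<^sub>0\<close> to \<open>aug F p\<close>.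
\<close>

record 'k graded_complex =
  rnk :: "nat \<Rightarrow> nat"
  shift :: "nat \<Rightarrow> nat \<Rightarrow> nat \<Rightarrow> int"
  diff :: "nat \<Rightarrow> nat \<Rightarrow> nat \<Rightarrow> (nat multiset \<Rightarrow> 'k)"
  aug :: "nat \<Rightarrow> 'k"

definition bd :: "('k, 'm) ring_scheme \<Rightarrow> nat \<Rightarrow> 'k graded_complex \<Rightarrow> nat \<Rightarrow>
    (nat \<Rightarrow> nat multiset \<Rightarrow> 'k) \<Rightarrow> (nat \<Rightarrow> nat multiset \<Rightarrow> 'k)" where
  "bd K n F i v = (\<lambda>p\<in>{..<rnk F i}.
     \<Oplus>\<^bsub>mpoly_ring K n\<^esub>q\<in>{..<rnk F (Suc i)}. diff F i p q \<otimes>\<^bsub>mpoly_ring K n\<^esub> v q)"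

definition zero_vec :: "('k, 'm) ring_scheme \<Rightarrow> nat \<Rightarrow> 'k graded_complex \<Rightarrow> nat \<Rightarrow>
    (nat \<Rightarrow> nat multiset \<Rightarrow> 'k)" where
  "zero_vec K n F i = (\<lambda>p\<in>{..<rnk F i}. \<zero>\<^bsub>mpoly_ring K n\<^esub>)"

definition free_mod :: "('k, 'm) ring_scheme \<Rightarrow> nat \<Rightarrow> 'k graded_complex \<Rightarrow> nat \<Rightarrow>
    (nat \<Rightarrow> nat multiset \<Rightarrow> 'k) set" where
  "free_mod K n F i = {..<rnk F i} \<rightarrow>\<^sub>E carrier (mpoly_ring K n)"

text \<open>\<open>K\<close> is the \<open>S\<close>-module \<open>S/(x\<^sub>1,\<dots>,x\<^sub>n)\<close>, on which a polynomial acts through its constant term.\<close>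

definition augmentation :: "('k, 'm) ring_scheme \<Rightarrow> 'k graded_complex \<Rightarrow>
    (nat \<Rightarrow> nat multiset \<Rightarrow> 'k) \<Rightarrow> 'k" where
  "augmentation K F v = (\<Oplus>\<^bsub>K\<^esub>p\<in>{..<rnk F 0}. v p {#} \<otimes>\<^bsub>K\<^esub> aug F p)"

definition graded_free_resolution :: "('k, 'm) ring_scheme \<Rightarrow> nat \<Rightarrow> 'k graded_complex \<Rightarrow> bool" where
  "graded_free_resolution K n F \<longleftrightarrow>
    \<comment> \<open>all maps are homogeneous of degree 0\<close>
    (\<forall>i. \<forall>p<rnk F i. shift F i p \<in> multidegrees n) \<and>
    (\<forall>i. \<forall>p<rnk F i. \<forall>q<rnk F (Suc i). diff F i p q \<in> carrier (mpoly_ring K n) \<and>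
       homogeneous K (\<lambda>j. shift F (Suc i) q j - shift F i p j) (diff F i p q)) \<and>
    (\<forall>p<rnk F 0. aug F p \<in> carrier K \<and> (aug F p \<noteq> \<zero>\<^bsub>K\<^esub> \<longrightarrow> shift F 0 p = (\<lambda>j. 0))) \<and>
    \<comment> \<open>exactness of \<open>\<cdots> \<rightarrow> F\<^sub>1 \<rightarrow> F\<^sub>0 \<rightarrow> K \<rightarrow> 0\<close>\<close>
    augmentation K F ` free_mod K n F 0 = carrier K \<and>
    {v \<in> free_mod K n F 0. augmentation K F v = \<zero>\<^bsub>K\<^esub>} = bd K n F 0 ` free_mod K n F 1 \<and>
    (\<forall>i. {v \<in> free_mod K n F (Suc i). bd K n F i v = zero_vec K n F i} =
       bd K n F (Suc i) ` free_mod K n F (Suc (Suc i)))"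

text \<open>
  For an ideal \<open>J\<close>, the module \<open>F\<^sub>i \<otimes>\<^sub>S J\<close> is the direct sum of copies of \<open>J\<close> indexed by the basis of
  \<open>F\<^sub>i\<close>, the \<open>p\<close>-th copy being shifted by \<open>shift F i p\<close>, and the differentials of \<open>F \<otimes>\<^sub>S J\<close>
  are given by the same matrices as those of \<open>F\<close>.
\<close>

definition tensor_piece :: "('k, 'm) ring_scheme \<Rightarrow> 'k graded_complex \<Rightarrow> (nat multiset \<Rightarrow> 'k) set \<Rightarrow>
    nat \<Rightarrow> (nat \<Rightarrow> int) \<Rightarrow> (nat \<Rightarrow> nat multiset \<Rightarrow> 'k) set" where
  "tensor_piece K F J i a =
    {v \<in> {..<rnk F i} \<rightarrow>\<^sub>E J. \<forall>p<rnk F i. homogeneous K (\<lambda>j. a j - shift F i p j) (v p)}"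

definition tensor_cycles :: "('k, 'm) ring_scheme \<Rightarrow> nat \<Rightarrow> 'k graded_complex \<Rightarrow>
    (nat multiset \<Rightarrow> 'k) set \<Rightarrow> nat \<Rightarrow> (nat \<Rightarrow> int) \<Rightarrow> (nat \<Rightarrow> nat multiset \<Rightarrow> 'k) set" where
  "tensor_cycles K n F J i a =
    (case i of 0 \<Rightarrow> tensor_piece K F J 0 a
     | Suc l \<Rightarrow> {v \<in> tensor_piece K F J (Suc l) a. bd K n F l v = zero_vec K n F l})"

definition tensor_boundaries :: "('k, 'm) ring_scheme \<Rightarrow> nat \<Rightarrow> 'k graded_complex \<Rightarrow>
    (nat multiset \<Rightarrow> 'k) set \<Rightarrow> nat \<Rightarrow> (nat \<Rightarrow> int) \<Rightarrow> (nat \<Rightarrow> nat multiset \<Rightarrow> 'k) set" where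
  "tensor_boundaries K n F J i a = bd K n F i ` tensor_piece K F J (Suc i) a"

text \<open>
  \<open>Tor\<^sub>i\<^sup>S(K, J)\<close> is the \<open>i\<close>-th homology of \<open>F \<otimes>\<^sub>S J\<close> for a graded free resolution \<open>F\<close> of \<open>K\<close>.
  It does not depend on \<open>F\<close>, so that ``some resolution'' could equally be ``every resolution'' below;
  a resolution by finitely generated modules exists.
\<close>

definition Tor_nonzero :: "('k, 'm) ring_scheme \<Rightarrow> nat \<Rightarrow> nat \<Rightarrow> (nat multiset \<Rightarrow> 'k) set \<Rightarrow>
    (nat \<Rightarrow> int) \<Rightarrow> bool" where
  "Tor_nonzero K n i J a \<longleftrightarrow>
    (\<exists>F. graded_free_resolution K n F \<and> tensor_cycles K n F J i a \<noteq> tensor_boundaries K n F J i a)"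

definition HS :: "('k, 'm) ring_scheme \<Rightarrow> nat \<Rightarrow> nat \<Rightarrow> (nat multiset \<Rightarrow> 'k) set \<Rightarrow>
    (nat multiset \<Rightarrow> 'k) set" where
  "HS K n i J = monomial_span K n {u \<in> monomials n. Tor_nonzero K n i J (mdeg u)}"


section \<open>Associated primes, Rees algebra, and the module over it\<close>

text \<open>The associated primes of the \<open>R\<close>-module \<open>R/L\<close>.\<close>

definition Ass :: "('a, 'm) ring_scheme \<Rightarrow> 'a set \<Rightarrow> 'a set set" where
  "Ass R L = {P. primeideal P R \<and>
    (\<exists>x \<in> carrier (R Quot L).
       P = {r \<in> carrier R. (L +>\<^bsub>R\<^esub> r) \<otimes>\<^bsub>R Quot L\<^esub> x = \<zero>\<^bsub>R Quot L\<^esub>})}"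

text \<open>
  The Rees algebra of \<open>I\<close> is realised as the subring \<open>\<Oplus>\<^sub>k I\<^sup>k t\<^sup>k\<close> of \<open>R[t] = UP R\<close>, and the direct sum of
  the \<open>HS\<^sub>i(I\<^sup>k)\<close> as a subset of \<open>S[t]\<close> on which it acts by the multiplication of \<open>S[t]\<close>.
\<close>

definition rees_algebra :: "('a, 'm) ring_scheme \<Rightarrow> 'a set \<Rightarrow> ('a, nat \<Rightarrow> 'a) up_ring" where
  "rees_algebra R I =
    (UP R)\<lparr>carrier := {f \<in> carrier (UP R). \<forall>k. f k \<in> ideal_pow R I k}\<rparr>"

definition HS_rees :: "('k, 'm) ring_scheme \<Rightarrow> nat \<Rightarrow> nat \<Rightarrow> (nat multiset \<Rightarrow> 'k) set \<Rightarrow>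
    (nat \<Rightarrow> nat multiset \<Rightarrow> 'k, nat \<Rightarrow> nat multiset \<Rightarrow> 'k) module" where
  "HS_rees K n i I =
    \<lparr>carrier = {f \<in> carrier (UP (mpoly_ring K n)). f 0 = \<zero>\<^bsub>mpoly_ring K n\<^esub> \<and>
       (\<forall>k\<ge>1. f k \<in> HS K n i (ideal_pow (mpoly_ring K n) I k))},
     monoid.mult = monoid.mult (UP (mpoly_ring K n)), one = one (UP (mpoly_ring K n)),
     zero = zero (UP (mpoly_ring K n)), add = add (UP (mpoly_ring K n)),
     smult = monoid.mult (UP (mpoly_ring K n))\<rparr>"

definition generated_submodule :: "('r, 'm) ring_scheme \<Rightarrow> ('r, 'a, 'l) module_scheme \<Rightarrow> 'a set \<Rightarrow> 'a set"
  where "generated_submodule R M B = \<Inter>{N. submodule N R M \<and> B \<subseteq> N}"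

text \<open>
  For a graded module whose elements are sequences of homogeneous components, with zero components
  \<open>z\<close>: generation by the homogeneous elements of degree at most \<open>d\<close>.
\<close>

definition generated_in_degrees_le :: "('r, 'm) ring_scheme \<Rightarrow> ('r, nat \<Rightarrow> 'a, 'l) module_scheme \<Rightarrow>
    'a \<Rightarrow> nat \<Rightarrow> bool" where
  "generated_in_degrees_le R M z d \<longleftrightarrow>
    carrier M = generated_submodule R M {f \<in> carrier M. \<exists>k\<le>d. \<forall>l. l \<noteq> k \<longrightarrow> f l = z}"

end

(*
  Fix any graded free resolution F of K; if there is none, all HS_i vanish by definition, so its
  existence never has to be proved. In a fixed multidegree, F tensored with a monomial ideal is a
  complex of K-vector spaces, and its homology can be read off from long exact sequences: a power
  I^k is polymatroidal (Minkowski sums of M-convex sets are M-convex), its generators have linear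
  quotients in lexicographic order, and each quotient S/(x_j : j in T) is handled by induction on T.
  Hence HS_i(I^k) is generated by the u + e_W with u in G(I^k), W a subset of set(u), |W| = i.
  These are the lattice points a of degree d + i that dominate an element of G(I^k) and satisfy
  a(T) <= f(T) + |T| - 1 for all nonempty T, where f is the rank function of G(I^k); by uncrossing,
  they form an M-convex set.

  An ideal J generated by an M-convex set satisfies (IJ : I) = J. By assumption (A),
  HS_i(I^(k+1)) = I HS_i(I^k) for k >= i. So if P = (HS_i(I^k) : y) is prime, then P is the
  intersection of the ideals (HS_i(I^(k+1)) : v y), v in G(I), and therefore equal to one of them.
*)
theory Submission
  imports Defs
begin

section \<open>M-convex sets of integer vectors\<close>

text \<open>The cancellation (IJ : I) = J fails for general monomial ideals. For M-convex generators
  it follows from a minimax principle: a monomial c is divisible by a generator exactly when, for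
  each set S of variables, the S-degree of c is at least the least S-degree of a generator. Least
  S-degrees add up in products, so the contribution of I can be subtracted for each S separately.
  This is what M-convexity of the generators of HS_i(I^k) is needed for. The form u + e_W hides it,
  because W ranges over a set that depends on u and on the order of the variables; the inequalities
  are free of both. The bound f(T) + |T| - 1 is imposed for nonempty T only (at the empty set it
  would read 0 <= -1), so upper bounds are uncrossed only for sets that meet.

  On the homological side, the classes in homological degree i have total degree d + i. Connecting
  maps lower i and keep the multidegree, so they vanish between the pieces of the filtration. The
  inclusion of I HS_i(I^k) in HS_i(I^(k+1)) is extracted from (A) itself, not from
  combinatorics.\<close>

definition exch :: "('a \<Rightarrow> int) \<Rightarrow> 'a \<Rightarrow> 'a \<Rightarrow> 'a \<Rightarrow> int" where
  "exch x i j = (\<lambda>k. x k - of_bool (k = i) + of_bool (k = j))"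

lemma exch_same [simp]: "exch x i i = x"
  by (simp add: exch_def)

lemma exch_exch [simp]: "exch (exch x i j) j l = exch x i l"
  by (simp add: exch_def fun_eq_iff)

lemma sum_of_bool_eq: "finite S \<Longrightarrow> (\<Sum>k\<in>S. of_bool (k = i)) = (of_bool (i \<in> S) :: int)"
  by (simp add: of_bool_def)

lemma sum_exch: "finite S \<Longrightarrow> sum (exch x i j) S = sum x S - of_bool (i \<in> S) + of_bool (j \<in> S)"
  unfolding exch_def sum.distrib sum_subtractf by (subst (1 2) sum_of_bool_eq) auto

lemma le_sum_eq_imp_eq:
  fixes x y :: "'a \<Rightarrow> int"
  assumes "finite S" "\<And>k. k \<in> S \<Longrightarrow> x k \<le> y k" "sum y S \<le> sum x S" "k \<in> S"
  shows "x k = y k"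
proof (rule ccontr)
  assume "x k \<noteq> y k"
  then have "sum x S < sum y S"
    using assms by (intro sum_strict_mono_ex1) (auto intro!: bexI[of _ k] simp: order_less_le)
  then show False using assms(3) by simp
qed

text \<open>Finite nonempty sets of this kind are the lattice points of integral base polyhedra.
  Entries may be negative, which makes the notion stable under reflection (\<open>uminus\<close>).
  The empty set is included, so that an ideal \<open>HS\<close> without generators is covered as
  well.\<close>

locale mconvex =
  fixes U :: "'a set" and A :: "('a \<Rightarrow> int) set"
  assumes finite_ground: "finite U"
    and support: "x \<in> A \<Longrightarrow> j \<notin> U \<Longrightarrow> x j = 0"
    and sum_ground: "x \<in> A \<Longrightarrow> y \<in> A \<Longrightarrow> sum x U = sum y U"
    and exchange: "x \<in> A \<Longrightarrow> y \<in> A \<Longrightarrow> y i < x i \<Longrightarrow> \<exists>j. x j < y j \<and> exch x i j \<in> A"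
begin

definition l1dist :: "('a \<Rightarrow> int) \<Rightarrow> ('a \<Rightarrow> int) \<Rightarrow> nat" where
  "l1dist x y = (\<Sum>k\<in>U. nat \<bar>x k - y k\<bar>)"

lemma neq_ground: "x \<in> A \<Longrightarrow> y \<in> A \<Longrightarrow> x k \<noteq> y k \<Longrightarrow> k \<in> U"
  by (metis support)

lemma le_imp_eq:
  assumes "x \<in> A" "y \<in> A" "\<And>k. x k \<le> y k"
  shows "x = y"
proof
  fix k
  show "x k = y k"
  proof (cases "k \<in> U")
    case True
    show ?thesis
      by (rule le_sum_eq_imp_eq[OF finite_ground _ _ True]) (use assms sum_ground[of x y] in auto)
  qed (metis support assms(1,2))
qed

lemma l1dist_exch:
  assumes "x \<in> A" "y \<in> A" "y i < x i" "x j < y j"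
  shows "l1dist (exch x i j) y < l1dist x y"
  unfolding l1dist_def
proof (rule sum_strict_mono_ex1)
  show "\<exists>a\<in>U. nat \<bar>exch x i j a - y a\<bar> < nat \<bar>x a - y a\<bar>"
    using assms neq_ground[of x y i] by (intro bexI[of _ i]) (auto simp: exch_def of_bool_def)
qed (use finite_ground assms in \<open>auto simp: exch_def of_bool_def\<close>)

lemma l1dist_commute: "l1dist x y = l1dist y x"
  by (simp add: l1dist_def abs_minus_commute)

text \<open>The point \<open>y\<close> is walked towards \<open>x\<close> by \<open>exchange\<close>
  while \<open>x i < y i\<close> is kept. When no such step remains, \<open>y\<close> exceeds
  \<open>x\<close> only at \<open>i\<close> and only by one; a single exchange of \<open>y\<close>
  at \<open>i\<close> then lands on \<open>x\<close>, and read backwards it is the required exchange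
  of \<open>x\<close>.\<close>

lemma dual_exchange:
  assumes "x \<in> A" "y \<in> A" "x i < y i"
  shows "\<exists>j. y j < x j \<and> exch x j i \<in> A"
  using assms
proof (induction "l1dist x y" arbitrary: y rule: less_induct)
  case less
  show ?case
  proof (cases "\<exists>l. x l < y l \<and> (l \<noteq> i \<or> x i + 2 \<le> y i)")
    case True
    \<comment> \<open>For \<open>l = i\<close> a surplus of two is required, so that one unit of
      surplus at \<open>i\<close> survives the step.\<close>
    then obtain l where l: "x l < y l" "l \<noteq> i \<or> x i + 2 \<le> y i" by blast
    obtain j where j: "y j < x j" "exch y l j \<in> A"
      using exchange[OF less.prems(2,1) l(1)] by blast
    have "l1dist x (exch y l j) < l1dist x y"
      using l1dist_exch[OF less.prems(2,1) l(1) j(1)] by (simp add: l1dist_commute)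
    moreover have "x i < exch y l j i"
      using l j(1) less.prems(3) by (auto simp: exch_def of_bool_def)
    ultimately obtain j' where j': "exch y l j j' < x j'" "exch x j' i \<in> A"
      using less.hyps less.prems(1) j(2) by blast
    moreover have "y j' < x j'"
      using j'(1) l(1) j(1) by (auto simp: exch_def of_bool_def split: if_splits)
    ultimately show ?thesis by blast
  next
    case False
    obtain j where j: "y j < x j" "exch y i j \<in> A"
      using exchange[OF less.prems(2,1,3)] by blast
    have "exch y i j = x"
    proof (rule le_imp_eq[OF j(2) less.prems(1)])
      fix k
      have "k = i \<or> y k \<le> x k" "\<not> x i + 2 \<le> y i" using False less.prems(3) by (meson not_less)+
      then show "exch y i j k \<le> x k"
        using j(1) less.prems(3) by (cases "k = i"; cases "k = j") (auto simp: exch_def)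
    qed
    then have "exch x j i = y"
      by auto
    then show ?thesis using j(1) less.prems(2) by blast
  qed
qed

text \<open>Exchanges out of \<open>a\<close> compose like arcs of a graph. Exchanging
  \<open>exch a m p\<close> against \<open>exch a j m\<close> at \<open>j\<close> must increase
  coordinate \<open>m\<close>, the only place where the former is smaller.\<close>

lemma exch_trans:
  assumes a: "a \<in> A" and jm: "exch a j m \<in> A" and mp: "exch a m p \<in> A"
  shows "exch a j p \<in> A"
proof (cases "j = m \<or> m = p \<or> j = p")
  case False
  then have "exch a j m j < exch a m p j" by (simp add: exch_def)
  from exchange[OF mp jm this] obtain q
    where q: "exch a m p q < exch a j m q" "exch (exch a m p) j q \<in> A" by blast
  from q(1) have "q = m"
    by (auto simp: exch_def of_bool_def split: if_splits)
  moreover have "exch (exch a m p) j m = exch a j p"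
    by (auto simp: exch_def fun_eq_iff)
  ultimately show ?thesis using q(2) by simp
qed (use assms in auto)

text \<open>Local optimality implies global optimality. An exchange at \<open>a\<close> that moves a
  unit out of this set would, by \<open>exch_trans\<close>, have its target in the set after all. A
  better point closest to \<open>a\<close> turns out to be exactly one such exchange away from
  \<open>a\<close>.\<close>

lemma tight_min:
  assumes a: "a \<in> A" and x: "x \<in> A"
  shows "sum a {m \<in> U. exch a j m \<in> A} \<le> sum x {m \<in> U. exch a j m \<in> A}" (is "sum a ?S \<le> _")
proof (rule ccontr)
  have fin: "finite ?S" using finite_ground by simp
  assume "\<not> ?thesis"
  then have "\<exists>x. x \<in> A \<and> sum x ?S < sum a ?S" using x by force
  then obtain x where x: "x \<in> A" "sum x ?S < sum a ?S"
    and mini: "\<And>y. y \<in> A \<and> sum y ?S < sum a ?S \<Longrightarrow> l1dist x a \<le> l1dist y a"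
    using ex_has_least_nat[of "\<lambda>x. x \<in> A \<and> sum x ?S < sum a ?S" _ "\<lambda>x. l1dist x a"] by blast
  \<comment> \<open>A step from \<open>x\<close> towards \<open>a\<close> must not yield another
    counterexample, since that one would be closer to \<open>a\<close>. Hence it carries a unit from
    outside into \<open>?S\<close>, and the deficit on \<open>?S\<close> is exactly one.\<close>
  have step: "q \<notin> ?S \<and> l \<in> ?S \<and> sum x ?S = sum a ?S - 1"
    if "a q < x q" "x l < a l" "exch x q l \<in> A" for q l
  proof -
    have "\<not> sum (exch x q l) ?S < sum a ?S"
      using mini[of "exch x q l"] l1dist_exch[OF x(1) a that(1,2)] that(3) by auto
    then show ?thesis
      using x(2) unfolding sum_exch[OF fin]
      by (cases "q \<in> ?S"; cases "l \<in> ?S") (simp_all only: of_bool_eq, auto)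
  qed
  have le: "x q \<le> a q" if "q \<in> ?S" for q
    using step exchange[OF x(1) a, of q] that by force
  have ge: "a l \<le> x l" if "l \<notin> ?S" for l
    using step dual_exchange[OF x(1) a, of l] that by force
  have "\<not> (\<forall>k. x k \<le> a k)"
    using le_imp_eq[OF x(1) a] x(2) by blast
  then obtain q where q: "a q < x q" by (auto simp: not_le)
  from exchange[OF x(1) a q] obtain l where l: "x l < a l" "exch x q l \<in> A" by blast
  have qS: "q \<notin> ?S" and lS: "l \<in> ?S" and s: "sum x ?S = sum a ?S - 1"
    using step[OF q l] by auto
  have on_S: "exch x q l k = a k" if "k \<in> ?S" for k
  proof (rule le_sum_eq_imp_eq[OF fin _ _ that])
    show "sum a ?S \<le> sum (exch x q l) ?S"
      using s qS lS unfolding sum_exch[OF fin] by simp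
    show "exch x q l k \<le> a k" if "k \<in> ?S" for k
      using le[OF that] l(1) qS that by (auto simp: exch_def of_bool_def)
  qed
  have "a k \<le> exch x q l k" for k
  proof (cases "k \<in> ?S")
    case False
    then show ?thesis using ge[OF False] q lS by (auto simp: exch_def of_bool_def)
  qed (use on_S in auto)
  then have "a = exch x q l" using le_imp_eq[OF a l(2)] by blast
  then have "exch a l q = x" by simp
  then have "exch a j q \<in> A" using exch_trans[OF a, of j l q] lS x(1) by auto
  moreover have "q \<in> U" using neq_ground[OF x(1) a, of q] q by simp
  ultimately show False using qS by simp
qed

text \<open>Reflection interchanges the two exchange properties, so \<open>exchange\<close> for the
  reflected set is \<open>dual_exchange\<close> for the original one.\<close>

lemma uminus: "mconvex U ((\<lambda>x k. - x k) ` A)"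
proof
  have ex: "exch (\<lambda>k. - x k) i j = (\<lambda>k. - exch x j i k)" for x :: "'a \<Rightarrow> int" and i j
    by (auto simp: exch_def)
  fix x y i assume "x \<in> (\<lambda>x k. - x k) ` A" "y \<in> (\<lambda>x k. - x k) ` A" "y i < x i"
  then obtain x' y' where *: "x' \<in> A" "y' \<in> A" "x = (\<lambda>k. - x' k)" "y = (\<lambda>k. - y' k)" "x' i < y' i"
    by auto
  from dual_exchange[OF *(1,2,5)] obtain j where "y' j < x' j" "exch x' j i \<in> A" by blast
  then show "\<exists>j. x j < y j \<and> exch x i j \<in> (\<lambda>x k. - x k) ` A"
    using * by (auto simp: ex)
next
  fix x y assume "x \<in> (\<lambda>x k. - x k) ` A" "y \<in> (\<lambda>x k. - x k) ` A"
  then obtain x' y' where "x' \<in> A" "y' \<in> A" "x = (\<lambda>k. - x' k)" "y = (\<lambda>k. - y' k)" by auto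
  then show "sum x U = sum y U" using sum_ground[of x' y'] by (simp add: sum_negf)
next
  fix x j assume "x \<in> (\<lambda>x k. - x k) ` A" "j \<notin> U"
  then obtain x' where "x' \<in> A" "x = (\<lambda>k. - x' k)" by auto
  then show "x j = 0" using support \<open>j \<notin> U\<close> by simp
qed (rule finite_ground)

text \<open>This is \<open>tight_min\<close> after reflection: \<open>a\<close> is maximal on the
  set of coordinates that can give a unit to \<open>j\<close>.\<close>

lemma tight_max:
  assumes a: "a \<in> A" and x: "x \<in> A"
  shows "sum x {l \<in> U. exch a l j \<in> A} \<le> sum a {l \<in> U. exch a l j \<in> A}"
proof -
  interpret neg: mconvex U "(\<lambda>x k. - x k) ` A" by (rule uminus)
  have "exch (\<lambda>k. - a k) j l \<in> (\<lambda>x k. - x k) ` A \<longleftrightarrow> exch a l j \<in> A" for l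
  proof -
    have "exch (\<lambda>k. - a k) j l = (\<lambda>k. - exch a l j k)"
      by (auto simp: exch_def)
    moreover have "inj (\<lambda>(x :: 'a \<Rightarrow> int) k. - x k)"
      by (auto simp: inj_def fun_eq_iff)
    ultimately show ?thesis by (metis inj_image_mem_iff)
  qed
  then show ?thesis
    using neg.tight_min[of "\<lambda>k. - a k" "\<lambda>k. - x k" j] a x by (simp add: sum_negf)
qed

text \<open>A Hall-type criterion. Take \<open>a\<close> with the least total excess over
  \<open>c\<close>. If \<open>c j < a j\<close>, every coordinate to which \<open>j\<close> can pass
  a unit is already filled up to \<open>c\<close>, so \<open>c\<close> has a smaller sum than
  \<open>a\<close> on the set of these coordinates. By \<open>tight_min\<close> no point of
  \<open>A\<close> does better there than \<open>a\<close>, contrary to the premise for this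
  set.\<close>

lemma dominates:
  assumes "\<And>S. S \<subseteq> U \<Longrightarrow> \<exists>x\<in>A. sum x S \<le> sum c S"
  shows "\<exists>a\<in>A. \<forall>j\<in>U. a j \<le> c j"
proof -
  define def where "def a = (\<Sum>j\<in>U. nat (a j - c j))" for a
  have "\<exists>a. a \<in> A" using assms[of "{}"] by auto
  then obtain a where a: "a \<in> A" and mini: "\<And>b. b \<in> A \<Longrightarrow> def a \<le> def b"
    using ex_has_least_nat[of "\<lambda>a. a \<in> A" _ def] by blast
  have False if j: "j \<in> U" "c j < a j" for j
  proof -
    let ?S = "{m \<in> U. exch a j m \<in> A}"
    have jS: "j \<in> ?S" using a j by simp
    have ge: "c m \<le> a m" if "m \<in> ?S" for m
    proof (rule ccontr)
      assume m: "\<not> c m \<le> a m"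
      have "def (exch a j m) < def a"
        unfolding def_def
      proof (rule sum_strict_mono_ex1)
        show "\<exists>k\<in>U. nat (exch a j m k - c k) < nat (a k - c k)"
          using j m by (intro bexI[of _ j]) (auto simp: exch_def of_bool_def)
      qed (use finite_ground m in \<open>auto simp: exch_def of_bool_def\<close>)
      then show False using mini[of "exch a j m"] that by simp
    qed
    have "sum c ?S < sum a ?S"
      using finite_ground ge j jS by (intro sum_strict_mono_ex1) auto
    moreover obtain x where "x \<in> A" "sum x ?S \<le> sum c ?S" using assms[of ?S] by auto
    ultimately show False using tight_min[OF a, of x j] by simp
  qed
  then show ?thesis using a by (meson not_less)
qed

end

text \<open>An exchange in one summand may raise a coordinate \<open>j\<close> at which the other
  summand is already too large. Then \<open>j\<close> takes over the role of \<open>i\<close>, and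
  the chain of exchanges ends because the summands come closer to those of \<open>y\<close>.\<close>

lemma mconvex_minkowski:
  assumes A: "mconvex U A" and B: "mconvex U B"
  shows "mconvex U {\<lambda>k. x k + y k |x y. x \<in> A \<and> y \<in> B}" (is "mconvex U ?C")
proof -
  interpret A: mconvex U A by fact
  interpret B: mconvex U B by fact
  have main: "\<exists>j. x1 j + x2 j < y1 j + y2 j \<and> exch (\<lambda>k. x1 k + x2 k) i j \<in> ?C"
    if "x1 \<in> A" "y1 \<in> A" "x2 \<in> B" "y2 \<in> B" "y1 i + y2 i < x1 i + x2 i" for x1 x2 y1 y2 i
    using that
  proof (induction "A.l1dist x1 y1 + B.l1dist x2 y2" arbitrary: x1 x2 i rule: less_induct)
    case less
    \<comment> \<open>If coordinate \<open>j\<close> of the sum was not below its target, it is now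
      in excess, and the induction hypothesis passes the unit on to some \<open>l\<close>. The moves
      from \<open>i\<close> to \<open>j\<close> and from \<open>j\<close> to \<open>l\<close>
      compose to one from \<open>i\<close> to \<open>l\<close>.\<close>
    have step: ?case
      if j: "exch (\<lambda>k. x1 k + x2 k) i j = (\<lambda>k. x1' k + x2' k)" "x1' \<in> A" "x2' \<in> B"
        "A.l1dist x1' y1 + B.l1dist x2' y2 < A.l1dist x1 y1 + B.l1dist x2 y2"
        "i \<noteq> j" for j x1' x2'
    proof (cases "x1 j + x2 j < y1 j + y2 j")
      case True
      then show ?thesis using j by (intro exI[of _ j]) auto
    next
      case False
      have eq: "x1' k + x2' k = exch (\<lambda>k. x1 k + x2 k) i j k" for k
        using j(1) by metis
      have "y1 j + y2 j < x1' j + x2' j"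
        using False j(5) eq[of j] by (auto simp: exch_def)
      then obtain l where l: "x1' l + x2' l < y1 l + y2 l" "exch (\<lambda>k. x1' k + x2' k) j l \<in> ?C"
        using less.hyps[OF j(4) j(2) less.prems(2) j(3) less.prems(4)] by blast
      have "exch (\<lambda>k. x1' k + x2' k) j l = exch (\<lambda>k. x1 k + x2 k) i l"
        using eq by (auto simp: exch_def fun_eq_iff)
      moreover have "x1 l + x2 l < y1 l + y2 l"
        using l(1) eq[of l] less.prems(5) False by (auto simp: exch_def of_bool_def split: if_splits)
      ultimately show ?thesis using l(2) by auto
    qed
    consider "y1 i < x1 i" | "y2 i < x2 i" using less.prems(5) by linarith
    then show ?case
    proof cases
      case 1
      then obtain j where j: "x1 j < y1 j" "exch x1 i j \<in> A"
        using A.exchange less.prems by blast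
      show ?thesis
        using A.l1dist_exch[OF less.prems(1,2) 1 j(1)] j 1 less.prems
        by (intro step[of j "exch x1 i j" x2]) (auto simp: exch_def)
    next
      case 2
      then obtain j where j: "x2 j < y2 j" "exch x2 i j \<in> B"
        using B.exchange less.prems by blast
      show ?thesis
        using B.l1dist_exch[OF less.prems(3,4) 2 j(1)] j 2 less.prems
        by (intro step[of j x1 "exch x2 i j"]) (auto simp: exch_def)
    qed
  qed
  show ?thesis
  proof
    fix x y i assume "x \<in> ?C" "y \<in> ?C" "y i < x i"
    then show "\<exists>j. x j < y j \<and> exch x i j \<in> ?C" using main by auto
  next
    fix x y assume "x \<in> ?C" "y \<in> ?C"
    then obtain x1 x2 y1 y2 where "x1 \<in> A" "x2 \<in> B" "y1 \<in> A" "y2 \<in> B"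
      "x = (\<lambda>k. x1 k + x2 k)" "y = (\<lambda>k. y1 k + y2 k)" by blast
    then show "sum x U = sum y U"
      using A.sum_ground[of x1 y1] B.sum_ground[of x2 y2] by (simp add: sum.distrib)
  next
    fix x j assume "x \<in> ?C" "j \<notin> U"
    then obtain x1 x2 where "x1 \<in> A" "x2 \<in> B" "x = (\<lambda>k. x1 k + x2 k)" by blast
    then show "x j = 0" using A.support[of x1] B.support[of x2] \<open>j \<notin> U\<close> by simp
  qed (rule A.finite_ground)
qed

text \<open>The maximal members are pairwise disjoint, because members that meet can be joined, so
  the sum over the union splits into nonnegative sums. It is used for tight upper sets, which can be
  merged only if they meet.\<close>

lemma sum_Union_nonneg:
  fixes g :: "'a \<Rightarrow> int"
  assumes fin: "finite \<T>" "\<And>T. T \<in> \<T> \<Longrightarrow> finite T"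
    and nonneg: "\<And>T. T \<in> \<T> \<Longrightarrow> 0 \<le> sum g T"
    and join: "\<And>S T. S \<in> \<T> \<Longrightarrow> T \<in> \<T> \<Longrightarrow> S \<inter> T \<noteq> {} \<Longrightarrow> S \<union> T \<in> \<T>"
  shows "0 \<le> sum g (\<Union>\<T>)"
proof -
  define M where "M = {T \<in> \<T>. \<forall>S\<in>\<T>. T \<subseteq> S \<longrightarrow> S = T}"
  have "\<exists>S\<in>M. T \<subseteq> S" if T: "T \<in> \<T>" for T
  proof -
    obtain S where "S \<in> \<T>" "T \<subseteq> S" "\<forall>b\<in>\<T>. S \<subseteq> b \<longrightarrow> S = b"
      using finite_has_maximal2[OF fin(1) T] by metis
    then show ?thesis unfolding M_def by (intro bexI[of _ S]) auto
  qed
  moreover have sub: "M \<subseteq> \<T>" unfolding M_def by simp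
  ultimately have "\<Union>\<T> = \<Union>M" by (metis (no_types) Union_mono Union_least Union_upper order_trans subset_antisym)
  moreover have "sum g (\<Union>M) = sum (sum g) M"
  proof (rule sum.Union_disjoint[THEN trans])
    show "\<forall>A\<in>M. finite A" using fin sub by blast
    show "\<forall>A\<in>M. \<forall>B\<in>M. A \<noteq> B \<longrightarrow> A \<inter> B = {}"
    proof (intro ballI impI, rule ccontr)
      fix A B assume AB: "A \<in> M" "B \<in> M" "A \<noteq> B" "A \<inter> B \<noteq> {}"
      then have "A \<union> B \<in> \<T>" using join sub by blast
      then have "A \<union> B = A" "A \<union> B = B" using AB(1,2) unfolding M_def by auto
      then show False using AB(3) by simp
    qed
  qed simp
  moreover have "0 \<le> sum (sum g) M"
    by (rule sum_nonneg) (use nonneg sub in blast)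
  ultimately show ?thesis by simp
qed

text \<open>The usual uncrossing argument: an obstruction to exchanging \<open>i\<close> is a tight lower set
  containing \<open>i\<close> or tight upper sets avoiding \<open>i\<close>.\<close>

lemma mconvex_paramodular:
  fixes p h :: "'a set \<Rightarrow> int" and N :: int
  assumes A_def: "A = {a. (\<forall>j. j \<notin> U \<longrightarrow> a j = 0) \<and> sum a U = N \<and> (\<forall>S\<subseteq>U. p S \<le> sum a S) \<and>
    (\<forall>T\<subseteq>U. T \<noteq> {} \<longrightarrow> sum a T \<le> h T)}"
    and U: "finite U"
    and p: "\<And>S S'. S \<subseteq> U \<Longrightarrow> S' \<subseteq> U \<Longrightarrow> p S + p S' \<le> p (S \<inter> S') + p (S \<union> S')"
    and h: "\<And>T T'. T \<subseteq> U \<Longrightarrow> T' \<subseteq> U \<Longrightarrow> T \<inter> T' \<noteq> {} \<Longrightarrow> h (T \<inter> T') + h (T \<union> T') \<le> h T + h T'"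
    and cross: "\<And>S T. S \<subseteq> U \<Longrightarrow> T \<subseteq> U \<Longrightarrow> T - S \<noteq> {} \<Longrightarrow> h (T - S) + p S \<le> h T + p (S - T)"
    and cross': "\<And>S T. S \<subseteq> U \<Longrightarrow> T \<subseteq> S \<Longrightarrow> T \<noteq> {} \<Longrightarrow> p S \<le> h T + p (S - T)"
  shows "mconvex U A"
proof
  fix a b i assume a: "a \<in> A" and b: "b \<in> A" and i: "b i < a i"
  have iU: "i \<in> U" using a b i unfolding A_def by force
  have fin: "finite S" if "S \<subseteq> U" for S using that U finite_subset by blast
  have pa: "p S \<le> sum a S" and pb: "p S \<le> sum b S" if "S \<subseteq> U" for S
    using that a b unfolding A_def by auto
  have ha: "sum a T \<le> h T" and hb: "sum b T \<le> h T" if "T \<subseteq> U" "T \<noteq> {}" for T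
    using that a b unfolding A_def by auto
  have int_un: "sum a S + sum a T = sum a (S \<inter> T) + sum a (S \<union> T)" if "S \<subseteq> U" "T \<subseteq> U" for S T
    using sum.union_inter[of S T a] that fin by simp
  define lower where "lower S \<longleftrightarrow> S \<subseteq> U \<and> i \<in> S \<and> sum a S = p S" for S
  define upper where "upper T \<longleftrightarrow> T \<subseteq> U \<and> T \<noteq> {} \<and> i \<notin> T \<and> sum a T = h T" for T
  have lower_int: "lower (S \<inter> T)" if "lower S" "lower T" for S T
    using that p[of S T] pa[of "S \<inter> T"] pa[of "S \<union> T"] int_un[of S T]
    unfolding lower_def by force
  have upper_un: "upper (S \<union> T)" if "upper S" "upper T" "S \<inter> T \<noteq> {}" for S T
    using that h[of S T] ha[of "S \<inter> T"] ha[of "S \<union> T"] int_un[of S T]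
    unfolding upper_def by force
  \<comment> \<open>A tight upper set is cut out of a tight lower one. If
    \<open>T \<subseteq> S\<close>, then \<open>T - S\<close> is empty and has no upper bound; this
    is where \<open>cross'\<close> replaces \<open>cross\<close>.\<close>
  have lower_diff: "lower (S - T)" if S: "lower S" and T: "upper T" for S T
  proof -
    have sub: "S \<subseteq> U" "T \<subseteq> U" using S T unfolding lower_def upper_def by auto
    have "sum a S - sum a T = sum a (S - T) - sum a (T - S)"
      using sub fin sum.Int_Diff[of S a T] sum.Int_Diff[of T a S] by (simp add: Int_commute)
    then have "sum a (S - T) = p (S - T)"
      using S T sub cross[of S T] cross'[of S T] pa[of "S - T"] ha[of "T - S"]
      unfolding lower_def upper_def by (cases "T - S = {}") force+
    then show ?thesis using S T unfolding lower_def upper_def by auto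
  qed
  show "\<exists>j. a j < b j \<and> exch a i j \<in> A"
  proof (rule ccontr)
    assume none: "\<nexists>j. a j < b j \<and> exch a i j \<in> A"
    \<comment> \<open>One exchange changes a sum by at most one, so by integrality a bound violated
      afterwards was attained by \<open>a\<close>: a lower bound on a set that loses
      \<open>i\<close> without gaining \<open>j\<close>, or an upper bound on a set that gains
      \<open>j\<close> without losing \<open>i\<close>.\<close>
    have obstruct: "(\<exists>S. lower S \<and> j \<notin> S) \<or> (\<exists>T. upper T \<and> j \<in> T)" if j: "a j < b j" for j
    proof -
      have jU: "j \<in> U" using a b j unfolding A_def by force
      have "exch a i j \<notin> A" using none j by blast
      moreover have "sum (exch a i j) U = N"
        using a iU jU sum_exch[OF U, of a i j] unfolding A_def by simp
      moreover have "exch a i j k = 0" if "k \<notin> U" for k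
        using a iU jU that unfolding A_def by (auto simp: exch_def)
      ultimately consider S where "S \<subseteq> U" "sum (exch a i j) S < p S"
        | T where "T \<subseteq> U" "T \<noteq> {}" "h T < sum (exch a i j) T"
        unfolding A_def mem_Collect_eq by (meson not_le)
      then show ?thesis
      proof cases
        case 1
        then have "lower S \<and> j \<notin> S"
          using pa[OF 1(1)] unfolding sum_exch[OF fin[OF 1(1)]] lower_def
          by (cases "i \<in> S"; cases "j \<in> S") auto
        then show ?thesis by blast
      next
        case 2
        then have "upper T \<and> j \<in> T"
          using ha[OF 2(1,2)] unfolding sum_exch[OF fin[OF 2(1)]] upper_def
          by (cases "i \<in> T"; cases "j \<in> T") auto
        then show ?thesis by blast
      qed
    qed
    have strict: "sum b S < sum a S" if "S \<subseteq> U" "i \<in> S" "\<And>k. k \<in> S \<Longrightarrow> b k \<le> a k" for S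
      using that i fin by (intro sum_strict_mono_ex1) auto
    show False
    proof (cases "\<exists>S. lower S")
      case True
      \<comment> \<open>An index \<open>k\<close> of a smallest tight lower set with
        \<open>a k < b k\<close> would be obstructed, and the obstruction would cut out a smaller
        tight lower set. So \<open>b \<le> a\<close> on \<open>S\<close>, strictly at
        \<open>i\<close>, which pushes \<open>b\<close> below the bound \<open>p S\<close>.\<close>
      then obtain S where S: "lower S" and mini: "\<And>T. lower T \<Longrightarrow> card S \<le> card T"
        using ex_has_least_nat[of lower _ card] by blast
      have SU: "S \<subseteq> U" using S unfolding lower_def by simp
      have "b k \<le> a k" if k: "k \<in> S" for k
      proof (rule ccontr)
        have small: "\<not> lower S'" if "S' \<subset> S" for S'
          using mini[of S'] psubset_card_mono[OF fin[OF SU] that] by auto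
        assume "\<not> b k \<le> a k"
        then consider S' where "lower S'" "k \<notin> S'" | T where "upper T" "k \<in> T"
          using obstruct[of k] by auto
        then show False
        proof cases
          case 1
          then show False using small[of "S \<inter> S'"] lower_int[OF S] k by blast
        next
          case 2
          then show False using small[of "S - T"] lower_diff[OF S] k by blast
        qed
      qed
      then have "sum b S < sum a S" using strict SU S unfolding lower_def by blast
      then show False using pb[OF SU] S unfolding lower_def by simp
    next
      case False
      \<comment> \<open>Now every coordinate where \<open>a\<close> is below \<open>b\<close> lies
        in a tight upper set, hence in \<open>V\<close>. The sum of \<open>a\<close> over
        \<open>V\<close> is at least that of \<open>b\<close>, and outside \<open>V\<close> it is
        larger because of \<open>i\<close>; this contradicts the equality of the totals.\<close>
      define V where "V = \<Union>{T. upper T}"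
      have VU: "V \<subseteq> U" and iV: "i \<notin> V" unfolding V_def upper_def by auto
      have "0 \<le> sum (\<lambda>k. a k - b k) V"
        unfolding V_def
      proof (rule sum_Union_nonneg)
        show "finite {T. upper T}"
          using U by (rule_tac finite_subset[of _ "Pow U"]) (auto simp: upper_def)
        fix T assume "T \<in> {T. upper T}"
        then show "finite T" "0 \<le> sum (\<lambda>k. a k - b k) T"
          using fin[of T] hb[of T] by (auto simp: upper_def sum_subtractf)
      qed (use upper_un in auto)
      then have "sum b V \<le> sum a V" by (simp add: sum_subtractf)
      moreover have "sum b (U - V) < sum a (U - V)"
      proof (rule strict)
        fix k assume "k \<in> U - V"
        then show "b k \<le> a k" using obstruct[of k] False unfolding V_def by force
      qed (use iU iV in auto)
      moreover have "sum a U = sum b U" using a b unfolding A_def by simp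
      ultimately show False
        using sum.subset_diff[OF VU U, of a] sum.subset_diff[OF VU U, of b] by simp
    qed
  qed
qed (use U in \<open>auto simp: A_def\<close>)

section \<open>The rank function\<close>

definition rank_fun :: "('a \<Rightarrow> int) set \<Rightarrow> 'a set \<Rightarrow> int" where
  "rank_fun A T = Max ((\<lambda>x. sum x T) ` A)"

locale finite_mconvex = mconvex +
  assumes finite: "finite A" and nonempty: "A \<noteq> {}"
begin

lemma rank_ge: "x \<in> A \<Longrightarrow> sum x T \<le> rank_fun A T"
  unfolding rank_fun_def using finite by (intro Max_ge) auto

lemma rank_attained: "\<exists>x\<in>A. sum x T = rank_fun A T"
proof -
  have "rank_fun A T \<in> (\<lambda>x. sum x T) ` A"
    unfolding rank_fun_def using finite nonempty by (intro Max_in) auto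
  then show ?thesis by force
qed

lemma rank_ground: "x \<in> A \<Longrightarrow> sum x U = rank_fun A U"
  using rank_attained sum_ground by metis

text \<open>Among the points attaining the rank on \<open>Q\<close>, take the one closest to a point
  \<open>y\<close> attaining it on \<open>P\<close>. If it were below \<open>y\<close> somewhere in
  \<open>P\<close>, a dual exchange would bring a unit into \<open>P\<close> without lowering the
  sum over \<open>Q\<close>. A common maximiser for a chain is what makes the rank
  submodular.\<close>

lemma rank_chain_attained:
  assumes "P \<subseteq> Q" "Q \<subseteq> U"
  shows "\<exists>x\<in>A. sum x P = rank_fun A P \<and> sum x Q = rank_fun A Q"
proof -
  have fin: "finite Q" using assms finite_ground by (simp add: finite_subset)
  obtain y where y: "y \<in> A" "sum y P = rank_fun A P" using rank_attained by blast
  have "\<exists>x. x \<in> A \<and> sum x Q = rank_fun A Q" using rank_attained by blast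
  then obtain x where x: "x \<in> A" "sum x Q = rank_fun A Q"
    and mini: "\<And>z. z \<in> A \<and> sum z Q = rank_fun A Q \<Longrightarrow> l1dist x y \<le> l1dist z y"
    using ex_has_least_nat[of "\<lambda>x. x \<in> A \<and> sum x Q = rank_fun A Q" _ "\<lambda>x. l1dist x y"] by blast
  have "y i \<le> x i" if i: "i \<in> P" for i
  proof (rule ccontr)
    assume "\<not> y i \<le> x i"
    then obtain j where j: "y j < x j" "exch x j i \<in> A"
      using dual_exchange[OF x(1) y(1), of i] by auto
    have "sum x Q \<le> sum (exch x j i) Q"
      unfolding sum_exch[OF fin] using i assms by auto
    then have "sum (exch x j i) Q = rank_fun A Q"
      using rank_ge[OF j(2), of Q] x(2) by simp
    then have "l1dist x y \<le> l1dist (exch x j i) y"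
      using mini j(2) by blast
    then show False
      using l1dist_exch[OF x(1) y(1) j(1), of i] \<open>\<not> y i \<le> x i\<close> by simp
  qed
  then have "sum y P \<le> sum x P" by (intro sum_mono)
  then show ?thesis using x y rank_ge[OF x(1), of P] by auto
qed

lemma rank_submodular:
  assumes "S \<subseteq> U" "T \<subseteq> U"
  shows "rank_fun A (S \<inter> T) + rank_fun A (S \<union> T) \<le> rank_fun A S + rank_fun A T"
proof -
  have fin: "finite S" "finite T" using assms finite_ground finite_subset by blast+
  obtain x where x: "x \<in> A" "sum x (S \<inter> T) = rank_fun A (S \<inter> T)"
    "sum x (S \<union> T) = rank_fun A (S \<union> T)"
    using rank_chain_attained[of "S \<inter> T" "S \<union> T"] assms by blast
  then show ?thesis
    using sum.union_inter[OF fin, of x] rank_ge[OF x(1), of S] rank_ge[OF x(1), of T] by simp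
qed

text \<open>All points of \<open>A\<close> have the same total, so
  \<open>rank_fun A U - rank_fun A (U - S)\<close> is the least sum over \<open>S\<close> attained
  on \<open>A\<close>; the inequalities are the premise of \<open>dominates\<close>.\<close>

lemma ex_le_iff_rank:
  assumes "sum c U = rank_fun A U + s" "s \<ge> 0"
  shows "(\<exists>u\<in>A. \<forall>j\<in>U. u j \<le> c j) \<longleftrightarrow> (\<forall>S\<subseteq>U. rank_fun A U - rank_fun A (U - S) \<le> sum c S)"
proof
  assume "\<exists>u\<in>A. \<forall>j\<in>U. u j \<le> c j"
  then obtain u where u: "u \<in> A" "\<And>j. j \<in> U \<Longrightarrow> u j \<le> c j" by blast
  show "\<forall>S\<subseteq>U. rank_fun A U - rank_fun A (U - S) \<le> sum c S"
  proof (intro allI impI)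
    fix S assume S: "S \<subseteq> U"
    have "sum u S \<le> sum c S" using u(2) S by (intro sum_mono) auto
    then show "rank_fun A U - rank_fun A (U - S) \<le> sum c S"
      using rank_ge[OF u(1), of "U - S"] rank_ground[OF u(1)]
        sum.subset_diff[OF S finite_ground, of u] by simp
  qed
next
  assume *: "\<forall>S\<subseteq>U. rank_fun A U - rank_fun A (U - S) \<le> sum c S"
  show "\<exists>u\<in>A. \<forall>j\<in>U. u j \<le> c j"
  proof (rule dominates)
    fix S assume S: "S \<subseteq> U"
    obtain x where x: "x \<in> A" "sum x (U - S) = rank_fun A (U - S)" using rank_attained by blast
    have "rank_fun A U - rank_fun A (U - S) \<le> sum c S" using * S by blast
    then show "\<exists>x\<in>A. sum x S \<le> sum c S"
      using x rank_ground[OF x(1)] sum.subset_diff[OF S finite_ground, of x]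
      by (intro bexI[of _ x]) auto
  qed
qed

end

section \<open>Lexicographic order and homological shifts\<close>

definition lex_less :: "(nat \<Rightarrow> int) \<Rightarrow> (nat \<Rightarrow> int) \<Rightarrow> bool" where
  "lex_less x y \<longleftrightarrow> (\<exists>i. x i < y i \<and> (\<forall>k<i. x k = y k))"

lemma lex_less_irrefl: "\<not> lex_less x x"
  by (simp add: lex_less_def)

lemma lex_less_trans: "lex_less x y \<Longrightarrow> lex_less y z \<Longrightarrow> lex_less x z"
  unfolding lex_less_def
proof (elim exE conjE)
  fix i j assume "x i < y i" "\<forall>k<i. x k = y k" "y j < z j" "\<forall>k<j. y k = z k"
  then show "\<exists>i. x i < z i \<and> (\<forall>k<i. x k = z k)"
    by (intro exI[of _ "min i j"]) (cases i j rule: linorder_cases; force simp: min_def)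
qed

lemma lex_less_linear: "x \<noteq> y \<Longrightarrow> lex_less x y \<or> lex_less y x"
proof -
  assume "x \<noteq> y"
  then have "\<exists>i. x i \<noteq> y i" by auto
  then obtain i where "x i \<noteq> y i" "\<forall>k<i. x k = y k"
    using exists_least_iff[of "\<lambda>i. x i \<noteq> y i"] by auto
  then show ?thesis unfolding lex_less_def by (metis linorder_neqE)
qed

lemma ex_lex_min:
  assumes "finite C" "C \<noteq> {}"
  shows "\<exists>u\<in>C. \<forall>v\<in>C. v \<noteq> u \<longrightarrow> lex_less u v"
  using assms
proof (induction rule: finite_ne_induct)
  case (insert x F)
  then obtain u where u: "u \<in> F" "\<forall>v\<in>F. v \<noteq> u \<longrightarrow> lex_less u v" by blast
  then have "u \<noteq> x" using insert by blast
  then consider "lex_less x u" | "lex_less u x" using lex_less_linear by blast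
  then show ?case
  proof cases
    case 1
    then have "\<forall>v\<in>insert x F. v \<noteq> x \<longrightarrow> lex_less x v" using u by (metis insert_iff lex_less_trans)
    then show ?thesis by blast
  next
    case 2
    then show ?thesis using u by blast
  qed
qed simp

text \<open>This is \<open>set(u)\<close> of the theory of linear quotients: the \<open>j\<close>
  such that the product of the variable \<open>j\<close> and the monomial \<open>u\<close> is
  divisible by a lexicographically larger generator obtained from \<open>u\<close> by one
  exchange.\<close>

definition lex_set :: "(nat \<Rightarrow> int) set \<Rightarrow> (nat \<Rightarrow> int) \<Rightarrow> nat set" where
  "lex_set A u = {j. \<exists>l>j. exch u l j \<in> A}"

definition hom_shift :: "(nat \<Rightarrow> int) set \<Rightarrow> nat \<Rightarrow> (nat \<Rightarrow> int) set" where
  "hom_shift A i = {\<lambda>k. u k + of_bool (k \<in> W) |u W. u \<in> A \<and> W \<subseteq> lex_set A u \<and> card W = i}"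

lemma lex_less_exch: "j < l \<Longrightarrow> lex_less u (exch u l j)"
  unfolding lex_less_def by (intro exI[of _ j]) (auto simp: exch_def)

lemma exch_lex_less: "l < j \<Longrightarrow> lex_less (exch u l j) u"
  unfolding lex_less_def by (intro exI[of _ l]) (auto simp: exch_def)

lemma sum_add_indicator:
  "finite T \<Longrightarrow> (\<Sum>k\<in>T. u k + of_bool (k \<in> W)) = sum u T + (int (card (T \<inter> W)) :: int)"
  by (simp add: sum.distrib of_bool_def sum.If_cases)

locale nat_mconvex = finite_mconvex U A for U :: "nat set" and A
begin

lemma lex_set_subset: "u \<in> A \<Longrightarrow> lex_set A u \<subseteq> U"
proof
  fix j assume "u \<in> A" "j \<in> lex_set A u"
  then obtain l where "j < l" "exch u l j \<in> A" unfolding lex_set_def by blast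
  then show "j \<in> U"
    using neq_ground[OF \<open>u \<in> A\<close>, of "exch u l j" j] by (auto simp: exch_def)
qed

text \<open>Each \<open>j \<in> W\<close> must be exchangeable for some \<open>l > j\<close>; choosing \<open>j\<close> maximal
  in a subset \<open>T\<close> of \<open>W\<close>, the exchange leaves \<open>T\<close> and shows that \<open>u\<close> does not attain the rank on \<open>T\<close>.\<close>

lemma hom_shift_upper:
  assumes "u \<in> A" "W \<subseteq> lex_set A u" "T \<subseteq> U" "T \<noteq> {}"
  shows "sum u T + int (card (T \<inter> W)) \<le> rank_fun A T + int (card T) - 1"
proof -
  have fin: "finite T" using assms finite_ground finite_subset by blast
  show ?thesis
  proof (cases "T \<subseteq> W")
    case True
    define j where "j = Max T"
    have j: "j \<in> T" "\<And>l. l > j \<Longrightarrow> l \<notin> T" using fin assms(4) by (auto simp: j_def)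
    then obtain l where l: "l > j" "exch u l j \<in> A" using True assms(2) unfolding lex_set_def by blast
    then show ?thesis
      using rank_ge[OF l(2), of T] True j unfolding sum_exch[OF fin] by (simp add: Int_absorb2)
  next
    case False
    then have "card (T \<inter> W) < card T" using fin by (intro psubset_card_mono) auto
    then show ?thesis using rank_ge[OF assms(1), of T] by simp
  qed
qed

text \<open>For the inclusion from right to left, the lower bounds provide a point of
  \<open>A\<close> below \<open>a\<close>. The upper bounds provide exchanges that bring this point
  within one unit of \<open>a\<close> in every coordinate, and the choice of a lexicographically
  least such point places \<open>W\<close> inside \<open>lex_set A u\<close>.\<close>

lemma hom_shift_eq:
  "hom_shift A i = {a. (\<forall>j. j \<notin> U \<longrightarrow> a j = 0) \<and> sum a U = rank_fun A U + int i \<and>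
     (\<forall>S\<subseteq>U. rank_fun A U - rank_fun A (U - S) \<le> sum a S) \<and>
     (\<forall>T\<subseteq>U. T \<noteq> {} \<longrightarrow> sum a T \<le> rank_fun A T + int (card T) - 1)}" (is "_ = ?R")
proof
  show "hom_shift A i \<subseteq> ?R"
  proof
    fix a assume "a \<in> hom_shift A i"
    then obtain u W where a: "a = (\<lambda>k. u k + of_bool (k \<in> W))" and u: "u \<in> A"
      and W: "W \<subseteq> lex_set A u" "card W = i" unfolding hom_shift_def by blast
    have WU: "W \<subseteq> U" using W lex_set_subset[OF u] by blast
    have s: "sum a U = rank_fun A U + int i"
      unfolding a sum_add_indicator[OF finite_ground] using rank_ground[OF u] WU W
      by (simp add: Int_absorb1)
    have "\<forall>S\<subseteq>U. rank_fun A U - rank_fun A (U - S) \<le> sum a S"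
    proof -
      have "\<exists>u\<in>A. \<forall>j\<in>U. u j \<le> a j" using u by (intro bexI[of _ u]) (auto simp: a)
      then show ?thesis using ex_le_iff_rank[OF s] by simp
    qed
    moreover have "sum a T \<le> rank_fun A T + int (card T) - 1" if "T \<subseteq> U" "T \<noteq> {}" for T
      using hom_shift_upper[OF u W(1) that] finite_subset[OF that(1) finite_ground]
      unfolding a by (subst sum_add_indicator) auto
    moreover have "a j = 0" if "j \<notin> U" for j using support[OF u that] that WU by (auto simp: a)
    ultimately show "a \<in> ?R" using s by blast
  qed
next
  show "?R \<subseteq> hom_shift A i"
  proof
    fix a assume a: "a \<in> ?R"
    then have upper: "sum a T \<le> rank_fun A T + int (card T) - 1" if "T \<subseteq> U" "T \<noteq> {}" for T
      using that by blast
    have supp: "a k = 0" if "k \<notin> U" for k using a that by blast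
    \<comment> \<open>Suppose every giver of a unit to \<open>j\<close> were strictly below
      \<open>a\<close>. On the set \<open>?T\<close> of givers \<open>u\<close> attains the rank by
      \<open>tight_max\<close>, so \<open>a\<close> would sum to at least the rank plus
      \<open>card ?T\<close>, one more than the upper bound permits.\<close>
    have below: "\<exists>l. l \<in> U \<and> exch u l j \<in> A \<and> l \<noteq> j \<and> a l \<le> u l"
      if u: "u \<in> A" and j: "j \<in> U" "u j < a j" and le: "\<forall>k\<in>U. u k \<le> a k" for u j
    proof (rule ccontr)
      let ?T = "{l \<in> U. exch u l j \<in> A}"
      assume "\<not> ?thesis"
      then have "u l + 1 \<le> a l" if "l \<in> ?T" for l
        using that j by (cases "l = j") force+
      then have "(\<Sum>l\<in>?T. u l + 1) \<le> sum a ?T" by (intro sum_mono)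
      then have "sum u ?T + int (card ?T) \<le> sum a ?T" by (simp add: sum.distrib)
      moreover obtain x where "x \<in> A" "sum x ?T = rank_fun A ?T" using rank_attained by blast
      moreover have "sum x ?T \<le> sum u ?T" using tight_max[OF u \<open>x \<in> A\<close>] .
      moreover have "?T \<noteq> {}" using u j by force
      ultimately show False using upper[of ?T] by force
    qed
    define C where "C = {u \<in> A. \<forall>k\<in>U. u k \<le> a k}"
    \<comment> \<open>The total shortage of \<open>u\<close> below \<open>a - 1\<close>. Once it
      vanishes, \<open>a\<close> and \<open>u\<close> differ only by zeros and ones.\<close>
    define def where "def u = (\<Sum>j\<in>U. nat (a j - 1 - u j))" for u
    have "sum a U = rank_fun A U + int i" using a by blast
    then have "\<exists>u. u \<in> C" using ex_le_iff_rank[of a "int i"] a unfolding C_def by auto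
    then obtain u where u: "u \<in> C" and mini: "\<And>v. v \<in> C \<Longrightarrow> def u \<le> def v"
      using ex_has_least_nat[of "\<lambda>a. a \<in> C" _ def] by blast
    have "a k - 1 \<le> u k" if k: "k \<in> U" for k
    proof (rule ccontr)
      assume less: "\<not> a k - 1 \<le> u k"
      obtain l where l: "l \<in> U" "exch u l k \<in> A" "l \<noteq> k" "a l \<le> u l"
        using below[of u k] u k less unfolding C_def by force
      have "exch u l k \<in> C" using u l less unfolding C_def by (auto simp: exch_def of_bool_def)
      moreover have "def (exch u l k) < def u"
        unfolding def_def
      proof (rule sum_strict_mono_ex1)
        show "\<exists>m\<in>U. nat (a m - 1 - exch u l k m) < nat (a m - 1 - u m)"
          using k less l by (intro bexI[of _ k]) (auto simp: exch_def of_bool_def)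
      qed (use finite_ground l in \<open>auto simp: exch_def of_bool_def\<close>)
      ultimately show False using mini by fastforce
    qed
    then have "{u \<in> C. \<forall>k\<in>U. a k - 1 \<le> u k} \<noteq> {}" using u by blast
    \<comment> \<open>Since \<open>a l \<le> u l\<close> for the giver \<open>l\<close> found by
      \<open>below\<close>, the exchanged point is again within one unit of \<open>a\<close>. It
      cannot be lexicographically smaller than \<open>u\<close>, so \<open>l\<close> comes after
      \<open>j\<close>.\<close>
    then obtain u where u: "u \<in> A" "\<forall>k\<in>U. u k \<le> a k" "\<forall>k\<in>U. a k - 1 \<le> u k"
      and maxi: "\<And>v. v \<in> C \<Longrightarrow> \<forall>k\<in>U. a k - 1 \<le> v k \<Longrightarrow> v \<noteq> u \<Longrightarrow> lex_less u v"
      using ex_lex_min[of "{u \<in> C. \<forall>k\<in>U. a k - 1 \<le> u k}"] finite unfolding C_def by auto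
    define W where "W = {k \<in> U. u k < a k}"
    have "a = (\<lambda>k. u k + of_bool (k \<in> W))"
    proof
      fix k show "a k = u k + of_bool (k \<in> W)"
        using u supp[of k] support[OF u(1), of k] by (cases "k \<in> U") (force simp: W_def)+
    qed
    moreover have "W \<subseteq> lex_set A u"
    proof
      fix j assume j: "j \<in> W"
      then obtain l where l: "l \<in> U" "exch u l j \<in> A" "l \<noteq> j" "a l \<le> u l"
        using below[OF u(1), of j] u(2) unfolding W_def by blast
      have "exch u l j \<in> C" "\<forall>k\<in>U. a k - 1 \<le> exch u l j k" "exch u l j \<noteq> u"
        using l u j by (auto simp: C_def exch_def of_bool_def W_def fun_eq_iff)
      then have "\<not> lex_less (exch u l j) u"
        using maxi lex_less_trans lex_less_irrefl by blast
      then have "j < l" using exch_lex_less[of l j u] l(3) by (meson linorder_neqE)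
      then show "j \<in> lex_set A u" using l(2) unfolding lex_set_def by blast
    qed
    moreover have "card W = i"
    proof -
      have "sum a U = sum u U + int (card (U \<inter> W))"
        unfolding \<open>a = (\<lambda>k. u k + of_bool (k \<in> W))\<close> by (rule sum_add_indicator[OF finite_ground])
      moreover have "U \<inter> W = W" by (auto simp: W_def)
      ultimately show ?thesis
        using a rank_ground[OF u(1)] by simp
    qed
    ultimately show "a \<in> hom_shift A i" using u(1) unfolding hom_shift_def by blast
  qed
qed

text \<open>All uncrossing conditions reduce to submodularity of the rank. The lower bound is the
  rank seen through complements, so the mixed condition for \<open>S\<close> and \<open>T\<close> is
  submodularity for \<open>T\<close> and \<open>U - S\<close>.\<close>

lemma mconvex_hom_shift: "mconvex U (hom_shift A i)"
proof (rule mconvex_paramodular[OF hom_shift_eq finite_ground])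
  have sub: "rank_fun A (S \<inter> T) + rank_fun A (S \<union> T) \<le> rank_fun A S + rank_fun A T"
    if "S \<subseteq> U" "T \<subseteq> U" for S T using rank_submodular[OF that] .
  have fin: "finite S" if "S \<subseteq> U" for S using that finite_ground finite_subset by blast
  have cross: "rank_fun A (T - S) + rank_fun A (U - (S - T)) \<le> rank_fun A T + rank_fun A (U - S)"
    if "S \<subseteq> U" "T \<subseteq> U" for S T
  proof -
    have "T \<inter> (U - S) = T - S" "T \<union> (U - S) = U - (S - T)" using that by auto
    then show ?thesis using sub[of T "U - S"] that by simp
  qed
  fix S T assume S: "S \<subseteq> U"
  show "rank_fun A U - rank_fun A (U - S) \<le> rank_fun A T + int (card T) - 1
      + (rank_fun A U - rank_fun A (U - (S - T)))" if T: "T \<subseteq> S" "T \<noteq> {}"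
  proof -
    have zero: "rank_fun A {} = 0" using rank_attained[of "{}"] by auto
    have "T \<subseteq> U" using S T by auto
    moreover have "T - S = {}" using T by auto
    ultimately have "rank_fun A {} + rank_fun A (U - (S - T)) \<le> rank_fun A T + rank_fun A (U - S)"
      using cross[OF S, of T] by metis
    \<comment> \<open>A nonempty \<open>T\<close> pays for the \<open>- 1\<close> in the upper
      bound.\<close>
    moreover have "1 \<le> card T" using T fin[of T] S by (simp add: Suc_leI card_gt_0_iff)
    ultimately show ?thesis using zero by simp
  qed
  assume T: "T \<subseteq> U"
  note ST = S T
  show "rank_fun A U - rank_fun A (U - S) + (rank_fun A U - rank_fun A (U - T))
    \<le> rank_fun A U - rank_fun A (U - S \<inter> T) + (rank_fun A U - rank_fun A (U - (S \<union> T)))"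
    using sub[of "U - S" "U - T"] by (simp add: Diff_Int Diff_Un)
  show "rank_fun A (S \<inter> T) + int (card (S \<inter> T)) - 1 + (rank_fun A (S \<union> T) + int (card (S \<union> T)) - 1)
    \<le> rank_fun A S + int (card S) - 1 + (rank_fun A T + int (card T) - 1)"
    using sub[OF ST] card_Un_Int[OF fin[OF ST(1)] fin[OF ST(2)]] by simp
  have "card (T - S) \<le> card T" using fin[OF ST(2)] by (simp add: card_mono)
  then show "rank_fun A (T - S) + int (card (T - S)) - 1 + (rank_fun A U - rank_fun A (U - S))
    \<le> rank_fun A T + int (card T) - 1 + (rank_fun A U - rank_fun A (U - (S - T)))"
    using cross[OF ST] by simp
qed

end

section \<open>The polynomial ring as a commutative ring\<close>

lemma finite_submultisets: "finite {u. u \<subseteq># m}"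
proof (induction m)
  case (add x m)
  have "u \<in> {u. u \<subseteq># m} \<union> add_mset x ` {u. u \<subseteq># m}" if "u \<subseteq># add_mset x m" for u
  proof (cases "x \<in># u")
    case True
    then obtain v where "u = add_mset x v" by (meson mset_add)
    then show ?thesis using that by simp
  next
    case False
    then have "u \<subseteq># m"
      using that by (metis Diff_eq_empty_iff_mset add_mset_add_single diff_single_trivial
          diff_diff_add_mset add.commute)
    then show ?thesis by simp
  qed
  then show ?case using add by (blast intro: finite_subset)
qed simp

context abelian_monoid
begin

lemma finsum_swap:
  assumes "finite A" "finite B" "\<And>x y. x \<in> A \<Longrightarrow> y \<in> B \<Longrightarrow> f x y \<in> carrier G"
  shows "(\<Oplus>x\<in>A. \<Oplus>y\<in>B. f x y) = (\<Oplus>y\<in>B. \<Oplus>x\<in>A. f x y)"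
  using assms(1,3)
proof (induction A)
  case (insert x A)
  have "(\<Oplus>x\<in>insert x A. \<Oplus>y\<in>B. f x y) = (\<Oplus>y\<in>B. f x y) \<oplus> (\<Oplus>x\<in>A. \<Oplus>y\<in>B. f x y)"
    using insert by (subst finsum_insert) (auto simp: Pi_def)
  also have "\<dots> = (\<Oplus>y\<in>B. f x y \<oplus> (\<Oplus>x\<in>A. f x y))"
    using insert by (subst finsum_addf) (auto simp: Pi_def)
  also have "\<dots> = (\<Oplus>y\<in>B. \<Oplus>x\<in>insert x A. f x y)"
    using insert by (intro finsum_cong') (auto simp: Pi_def)
  finally show ?case .
qed (simp add: finsum_zero)

lemma finsum_single:
  assumes "i \<in> A" "finite A" "f i \<in> carrier G" "\<And>j. j \<in> A \<Longrightarrow> j \<noteq> i \<Longrightarrow> f j = \<zero>"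
  shows "finsum G f A = f i"
proof -
  have zero: "f j = \<zero>" if "j \<in> A - {i}" for j using assms(4) that by simp
  have "finsum G f (insert i (A - {i})) = f i \<oplus> finsum G f (A - {i})"
    using assms(2,3) zero by (intro finsum_insert) (auto simp: Pi_def)
  also have "finsum G f (A - {i}) = \<zero>" using zero by (rule add.finprod_one_eqI)
  also have "insert i (A - {i}) = A" using assms(1) by blast
  finally show ?thesis using assms(3) by simp
qed

end

lemma Collect_subseteq_mset_reindex: "(\<lambda>u. m - u) ` {u. u \<subseteq># m} = {u. u \<subseteq># m}"
proof -
  have "u \<in> (\<lambda>u. m - u) ` {u. u \<subseteq># m}" if "u \<subseteq># m" for u
    using that by (intro image_eqI[of _ _ "m - u"]) (auto simp: multiset_eq_iff subseteq_mset_def)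
  then show ?thesis by auto
qed

locale mpoly = field K for K (structure) +
  fixes n :: nat
begin

abbreviation "R \<equiv> mpoly_ring K n"

definition mterm :: "'a \<Rightarrow> nat multiset \<Rightarrow> nat multiset \<Rightarrow> 'a" where
  "mterm c u = (\<lambda>m. if m = u then c else \<zero>)"

lemma monom_poly_eq: "monom_poly K u = mterm \<one> u"
  by (simp add: monom_poly_def mterm_def)

lemma mterm_in_pset:
  assumes "c \<in> carrier K" "u \<in> monomials n"
  shows "mterm c u \<in> indexed_pset {1..n} (carrier K)"
  using assms(2)
proof (induction u)
  case empty
  have "mterm c {#} = indexed_const c" by (auto simp: mterm_def indexed_const_def)
  then show ?case using indexed_pset.indexed_const assms(1) by metis
next
  case (add i u)
  have "mterm c (add_mset i u) = indexed_pmult (mterm c u) i"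
    by (auto simp: mterm_def indexed_pmult_def fun_eq_iff)
  moreover have "u \<in> monomials n" "i \<in> {1..n}" using add.prems by (auto simp: monomials_def)
  ultimately show ?case using indexed_pset.indexed_pmult[OF add.IH] by metis
qed

text \<open>Replaces the inductive carrier by finitely supported coefficient functions. For the
  converse inclusion the terms are split off one at a time.\<close>

lemma carrier_R: "carrier R = {f. (\<forall>m. f m \<in> carrier K) \<and> finite {m. f m \<noteq> \<zero>} \<and>
    (\<forall>m. f m \<noteq> \<zero> \<longrightarrow> m \<in> monomials n)}" (is "_ = ?C")
proof
  show "carrier R \<subseteq> ?C"
  proof
    fix f assume "f \<in> carrier R"
    then have "f \<in> indexed_pset {1..n} (carrier K)" by (simp add: mpoly_ring_def)
    then show "f \<in> ?C"
    proof induction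
      case (indexed_const k)
      then show ?case by (auto simp: indexed_const_def monomials_def)
    next
      case (indexed_padd P Q)
      have "{m. P m \<oplus> Q m \<noteq> \<zero>} \<subseteq> {m. P m \<noteq> \<zero>} \<union> {m. Q m \<noteq> \<zero>}" by auto
      moreover have "finite ({m. P m \<noteq> \<zero>} \<union> {m. Q m \<noteq> \<zero>})" using indexed_padd by auto
      ultimately have "finite {m. P m \<oplus> Q m \<noteq> \<zero>}" by (rule finite_subset)
      moreover have "m \<in> monomials n" if "P m \<oplus> Q m \<noteq> \<zero>" for m
        using indexed_padd that by (cases "P m = \<zero>") auto
      ultimately show ?case
        using indexed_padd by (simp add: indexed_padd_def)
    next
      case (indexed_pmult P i)
      have "{m. indexed_pmult P i m \<noteq> \<zero>} \<subseteq> add_mset i ` {m. P m \<noteq> \<zero>}"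
        by (auto simp: indexed_pmult_def split: if_splits) (metis (mono_tags, lifting) image_eqI insert_DiffM mem_Collect_eq)
      moreover have "m \<in> monomials n" if "m - {#i#} \<in> monomials n" for m
      proof (cases "i \<in># m")
        case True
        then obtain m' where "m = add_mset i m'" by (meson mset_add)
        then show ?thesis using that indexed_pmult(2) by (simp add: monomials_def)
      qed (use that in \<open>simp add: diff_single_trivial\<close>)
      moreover have "finite (add_mset i ` {m. P m \<noteq> \<zero>})" using indexed_pmult by auto
      ultimately have "finite {m. indexed_pmult P i m \<noteq> \<zero>}"
        "\<And>m. m - {#i#} \<in> monomials n \<Longrightarrow> m \<in> monomials n" by (blast dest: finite_subset)+
      moreover have "indexed_pmult P i m \<in> carrier K"
        "indexed_pmult P i m \<noteq> \<zero> \<Longrightarrow> m - {#i#} \<in> monomials n" for m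
        using indexed_pmult by (simp_all add: indexed_pmult_def split: if_splits)
      ultimately show ?case by blast
    qed
  qed
next
  have "f \<in> indexed_pset {1..n} (carrier K)"
    if "finite M" "{m. f m \<noteq> \<zero>} = M" "\<forall>m. f m \<in> carrier K" "\<forall>m. f m \<noteq> \<zero> \<longrightarrow> m \<in> monomials n" for f M
    using that
  proof (induction M arbitrary: f)
    case empty
    then have "f = mterm \<zero> {#}" by (auto simp: mterm_def)
    then show ?case using mterm_in_pset[of "\<zero>" "{#}"] by (simp add: monomials_def)
  next
    case (insert u M)
    have "f(u := \<zero>) \<in> indexed_pset {1..n} (carrier K)"
      using insert.prems insert.hyps by (intro insert.IH) auto
    moreover have "mterm (f u) u \<in> indexed_pset {1..n} (carrier K)"
      using insert.prems by (intro mterm_in_pset) auto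
    moreover have "f = indexed_padd (f(u := \<zero>)) (mterm (f u) u)"
      using insert.prems by (auto simp: mterm_def indexed_padd_def)
    ultimately show ?case using indexed_pset.indexed_padd by metis
  qed
  then show "?C \<subseteq> carrier R" by (auto simp: mpoly_ring_def)
qed

lemma R_closed [simp]: "f \<in> carrier R \<Longrightarrow> f m \<in> carrier K"
  and R_finite: "f \<in> carrier R \<Longrightarrow> finite {m. f m \<noteq> \<zero>}"
  and R_monomials: "f \<in> carrier R \<Longrightarrow> f m \<noteq> \<zero> \<Longrightarrow> m \<in> monomials n"
  by (auto simp: carrier_R)

lemma R_I:
  "(\<And>m. f m \<in> carrier K) \<Longrightarrow> finite {m. f m \<noteq> \<zero>} \<Longrightarrow> (\<And>m. f m \<noteq> \<zero> \<Longrightarrow> m \<in> monomials n) \<Longrightarrow> f \<in> carrier R"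
  unfolding carrier_R by blast

lemma R_zero: "\<zero>\<^bsub>R\<^esub> = (\<lambda>_. \<zero>)"
  by (simp add: mpoly_ring_def indexed_const_def)

lemma R_one: "\<one>\<^bsub>R\<^esub> = mterm \<one> {#}"
  by (simp add: mpoly_ring_def indexed_const_def mterm_def)

lemma R_add: "f \<oplus>\<^bsub>R\<^esub> g = (\<lambda>m. f m \<oplus> g m)"
  by (simp add: mpoly_ring_def indexed_padd_def)

lemma R_mult: "f \<otimes>\<^bsub>R\<^esub> g = (\<lambda>m. \<Oplus>u\<in>{u. u \<subseteq># m}. f u \<otimes> g (m - u))"
  by (simp add: mpoly_ring_def)

lemma mterm_closed: "c \<in> carrier K \<Longrightarrow> u \<in> monomials n \<Longrightarrow> mterm c u \<in> carrier R"
  using mterm_in_pset by (simp add: mpoly_ring_def)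

lemma R_mult_nonzero:
  assumes "f \<in> carrier R" "g \<in> carrier R" "(f \<otimes>\<^bsub>R\<^esub> g) m \<noteq> \<zero>"
  obtains u where "u \<subseteq># m" "f u \<noteq> \<zero>" "g (m - u) \<noteq> \<zero>"
proof -
  have "\<exists>u. u \<subseteq># m \<and> f u \<otimes> g (m - u) \<noteq> \<zero>"
    using assms(3) add.finprod_one_eqI[of "{u. u \<subseteq># m}" "\<lambda>u. f u \<otimes> g (m - u)"]
    unfolding R_mult by auto
  then show ?thesis using that assms(1,2) by fastforce
qed

lemma monomials_add [simp]: "u + v \<in> monomials n \<longleftrightarrow> u \<in> monomials n \<and> v \<in> monomials n"
  by (auto simp: monomials_def)

lemma R_mult_closed:
  assumes "f \<in> carrier R" "g \<in> carrier R"
  shows "f \<otimes>\<^bsub>R\<^esub> g \<in> carrier R"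
proof -
  have "\<exists>u v. m = u + v \<and> f u \<noteq> \<zero> \<and> g v \<noteq> \<zero>" if "(f \<otimes>\<^bsub>R\<^esub> g) m \<noteq> \<zero>" for m
    using R_mult_nonzero[OF assms that] by (metis subset_mset.add_diff_inverse)
  then have *: "{m. (f \<otimes>\<^bsub>R\<^esub> g) m \<noteq> \<zero>} \<subseteq> (\<lambda>(u, v). u + v) ` ({u. f u \<noteq> \<zero>} \<times> {v. g v \<noteq> \<zero>})"
    by fastforce
  have "finite ((\<lambda>(u, v). u + v) ` ({u. f u \<noteq> \<zero>} \<times> {v. g v \<noteq> \<zero>}))"
    using R_finite assms by simp
  with * have "finite {m. (f \<otimes>\<^bsub>R\<^esub> g) m \<noteq> \<zero>}" by (rule finite_subset)
  moreover have "(f \<otimes>\<^bsub>R\<^esub> g) m \<in> carrier K" for m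
    unfolding R_mult using assms by (intro finsum_closed) auto
  moreover have "m \<in> monomials n" if "(f \<otimes>\<^bsub>R\<^esub> g) m \<noteq> \<zero>" for m
  proof -
    have "m \<in> (\<lambda>(u, v). u + v) ` ({u. f u \<noteq> \<zero>} \<times> {v. g v \<noteq> \<zero>})" using * that by blast
    then obtain u v where "m = u + v" "f u \<noteq> \<zero>" "g v \<noteq> \<zero>" by auto
    then show ?thesis using R_monomials assms by simp
  qed
  ultimately show ?thesis unfolding carrier_R by blast
qed

lemma R_mult_commute:
  assumes "f \<in> carrier R" "g \<in> carrier R"
  shows "f \<otimes>\<^bsub>R\<^esub> g = g \<otimes>\<^bsub>R\<^esub> f"
proof
  fix m :: "nat multiset"
  have inj: "inj_on (\<lambda>u. m - u) {u. u \<subseteq># m}"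
    by (rule inj_onI) (metis diff_diff_add_mset mem_Collect_eq subset_mset.add_diff_inverse add_diff_cancel_right')
  have "(f \<otimes>\<^bsub>R\<^esub> g) m = (\<Oplus>u\<in>(\<lambda>u. m - u) ` {u. u \<subseteq># m}. f u \<otimes> g (m - u))"
    unfolding R_mult Collect_subseteq_mset_reindex ..
  also have "\<dots> = (\<Oplus>u\<in>{u. u \<subseteq># m}. f (m - u) \<otimes> g (m - (m - u)))"
    by (rule finsum_reindex[OF _ inj]) (use assms in auto)
  also have "\<dots> = (g \<otimes>\<^bsub>R\<^esub> f) m"
    unfolding R_mult
  proof (rule finsum_cong')
    fix u assume "u \<in> {u. u \<subseteq># m}"
    then have "m - (m - u) = u" by (auto simp: multiset_eq_iff subseteq_mset_def)
    then show "f (m - u) \<otimes> g (m - (m - u)) = g u \<otimes> f (m - u)"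
      using assms by (simp add: m_comm)
  qed (use assms in auto)
  finally show "(f \<otimes>\<^bsub>R\<^esub> g) m = (g \<otimes>\<^bsub>R\<^esub> f) m" .
qed

lemma R_mult_assoc:
  assumes f: "f \<in> carrier R" and g: "g \<in> carrier R" and h: "h \<in> carrier R"
  shows "(f \<otimes>\<^bsub>R\<^esub> g) \<otimes>\<^bsub>R\<^esub> h = f \<otimes>\<^bsub>R\<^esub> (g \<otimes>\<^bsub>R\<^esub> h)"
proof
  fix m :: "nat multiset"
  let ?M = "{u. u \<subseteq># m}"
  \<comment> \<open>Extension by zero makes the triangular range of pairs
    \<open>v \<subseteq># u\<close> a square, so that the two sums can be interchanged; afterwards
    \<open>u\<close> is reindexed as \<open>v + w\<close>.\<close>
  let ?t = "\<lambda>u v. if v \<subseteq># u then f v \<otimes> g (u - v) \<otimes> h (m - u) else \<zero>"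
  have "((f \<otimes>\<^bsub>R\<^esub> g) \<otimes>\<^bsub>R\<^esub> h) m = (\<Oplus>u\<in>?M. \<Oplus>v\<in>?M. ?t u v)"
    unfolding R_mult
  proof (rule finsum_cong')
    fix u assume u: "u \<in> ?M"
    have "(\<Oplus>v\<in>{v. v \<subseteq># u}. f v \<otimes> g (u - v)) \<otimes> h (m - u)
        = (\<Oplus>v\<in>{v. v \<subseteq># u}. f v \<otimes> g (u - v) \<otimes> h (m - u))"
      using f g h finite_submultisets by (subst finsum_ldistr) auto
    also have "\<dots> = (\<Oplus>v\<in>?M. ?t u v)"
      using f g h u finite_submultisets
      by (intro add.finprod_mono_neutral_cong_left) (auto intro: subset_mset.order_trans)
    finally show "(\<Oplus>v\<in>{v. v \<subseteq># u}. f v \<otimes> g (u - v)) \<otimes> h (m - u) = (\<Oplus>v\<in>?M. ?t u v)" .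
  qed (use f g h in auto)
  also have "\<dots> = (\<Oplus>v\<in>?M. \<Oplus>u\<in>?M. ?t u v)"
    using f g h finite_submultisets by (intro finsum_swap) auto
  also have "\<dots> = (f \<otimes>\<^bsub>R\<^esub> (g \<otimes>\<^bsub>R\<^esub> h)) m"
    unfolding R_mult
  proof (rule finsum_cong')
    fix v assume v: "v \<in> ?M"
    have "(\<Oplus>u\<in>?M. ?t u v) = (\<Oplus>u\<in>(\<lambda>w. v + w) ` {w. w \<subseteq># m - v}. f v \<otimes> (g (u - v) \<otimes> h (m - u)))"
    proof (rule add.finprod_mono_neutral_cong_right)
      show "(\<lambda>w. v + w) ` {w. w \<subseteq># m - v} \<subseteq> ?M"
        using v by (auto simp: subset_mset.le_diff_conv2 add.commute)
      fix u assume "u \<in> ?M - (\<lambda>w. v + w) ` {w. w \<subseteq># m - v}"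
      then have "\<not> v \<subseteq># u"
        using v by (auto simp: image_iff subset_mset.le_diff_conv2) (metis add.commute subset_mset.add_diff_inverse subset_mset.diff_add)
      then show "?t u v = \<zero>" by simp
    qed (use f g h finite_submultisets in \<open>auto simp: m_assoc\<close>)
    also have "\<dots> = (\<Oplus>w\<in>{w. w \<subseteq># m - v}. f v \<otimes> (g (v + w - v) \<otimes> h (m - (v + w))))"
      using f g h by (intro finsum_reindex) auto
    also have "\<dots> = f v \<otimes> (\<Oplus>w\<in>{w. w \<subseteq># m - v}. g w \<otimes> h (m - v - w))"
      using f g h finite_submultisets by (subst finsum_rdistr) auto
    finally show "(\<Oplus>u\<in>?M. ?t u v) = f v \<otimes> (\<Oplus>w\<in>{w. w \<subseteq># m - v}. g w \<otimes> h (m - v - w))" .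
  qed (use f g h in auto)
  finally show "((f \<otimes>\<^bsub>R\<^esub> g) \<otimes>\<^bsub>R\<^esub> h) m = (f \<otimes>\<^bsub>R\<^esub> (g \<otimes>\<^bsub>R\<^esub> h)) m" .
qed

lemma mterm_mult:
  assumes "c \<in> carrier K" "f \<in> carrier R"
  shows "mterm c u \<otimes>\<^bsub>R\<^esub> f = (\<lambda>m. if u \<subseteq># m then c \<otimes> f (m - u) else \<zero>)"
proof
  fix m
  show "(mterm c u \<otimes>\<^bsub>R\<^esub> f) m = (if u \<subseteq># m then c \<otimes> f (m - u) else \<zero>)"
  proof (cases "u \<subseteq># m")
    case True
    have "(mterm c u \<otimes>\<^bsub>R\<^esub> f) m = mterm c u u \<otimes> f (m - u)"
      unfolding R_mult using True assms finite_submultisets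
      by (intro finsum_single) (auto simp: mterm_def)
    then show ?thesis using True by (simp add: mterm_def)
  next
    case False
    then show ?thesis
      unfolding R_mult using assms by (auto simp: mterm_def intro!: add.finprod_one_eqI)
  qed
qed

lemma cring_R: "cring R"
proof (rule cringI)
  show "abelian_group R"
  proof (rule abelian_groupI)
    fix f g assume fg: "f \<in> carrier R" "g \<in> carrier R"
    have "{m. f m \<oplus> g m \<noteq> \<zero>} \<subseteq> {m. f m \<noteq> \<zero>} \<union> {m. g m \<noteq> \<zero>}" by auto
    moreover have "finite ({m. f m \<noteq> \<zero>} \<union> {m. g m \<noteq> \<zero>})" using fg R_finite by simp
    ultimately have "finite {m. f m \<oplus> g m \<noteq> \<zero>}" by (rule finite_subset)
    moreover have "m \<in> monomials n" if "f m \<oplus> g m \<noteq> \<zero>" for m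
      using fg R_monomials[of f m] R_monomials[of g m] that by (cases "f m = \<zero>") auto
    ultimately show "f \<oplus>\<^bsub>R\<^esub> g \<in> carrier R" using fg unfolding R_add carrier_R by simp
  next
    fix f assume f: "f \<in> carrier R"
    have "{m. \<ominus> f m \<noteq> \<zero>} \<subseteq> {m. f m \<noteq> \<zero>}" using f by auto
    then have "finite {m. \<ominus> f m \<noteq> \<zero>}" using R_finite[OF f] by (rule finite_subset)
    then have "(\<lambda>m. \<ominus> f m) \<in> carrier R"
    proof (rule R_I[rotated])
      fix m assume "\<ominus> f m \<noteq> \<zero>"
      then show "m \<in> monomials n" using R_monomials[OF f, of m] by (cases "f m = \<zero>") auto
    qed (use f in simp)
    moreover have "(\<lambda>m. \<ominus> f m) \<oplus>\<^bsub>R\<^esub> f = \<zero>\<^bsub>R\<^esub>"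
      using f by (simp add: R_add R_zero l_neg)
    ultimately show "\<exists>g\<in>carrier R. g \<oplus>\<^bsub>R\<^esub> f = \<zero>\<^bsub>R\<^esub>" by blast
  next
    show "\<zero>\<^bsub>R\<^esub> \<in> carrier R" unfolding R_zero by (rule R_I) auto
  qed (auto simp: R_add R_zero a_ac)
  show "comm_monoid R"
  proof (rule comm_monoidI)
    fix f assume f: "f \<in> carrier R"
    show "\<one>\<^bsub>R\<^esub> \<otimes>\<^bsub>R\<^esub> f = f" unfolding R_one using f by (subst mterm_mult) auto
  next
    show "\<one>\<^bsub>R\<^esub> \<in> carrier R"
      unfolding R_one using mterm_closed[of "\<one>" "{#}"] by (simp add: monomials_def)
  qed (use R_mult_closed R_mult_assoc R_mult_commute in auto)
  fix f g h assume "f \<in> carrier R" "g \<in> carrier R" "h \<in> carrier R"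
  then show "(f \<oplus>\<^bsub>R\<^esub> g) \<otimes>\<^bsub>R\<^esub> h = f \<otimes>\<^bsub>R\<^esub> h \<oplus>\<^bsub>R\<^esub> g \<otimes>\<^bsub>R\<^esub> h"
    by (auto simp: R_mult R_add l_distr Pi_def)
qed

end

section \<open>Monomial ideals\<close>

definition mset_sum :: "'a multiset set \<Rightarrow> 'a multiset set \<Rightarrow> 'a multiset set" where
  "mset_sum A B = {a + b |a b. a \<in> A \<and> b \<in> B}"

primrec mset_pow :: "'a multiset set \<Rightarrow> nat \<Rightarrow> 'a multiset set" where
  "mset_pow B 0 = {{#}}"
| "mset_pow B (Suc k) = mset_sum (mset_pow B k) B"

context mpoly
begin

sublocale R: cring R by (rule cring_R)

abbreviation span :: "nat multiset set \<Rightarrow> (nat multiset \<Rightarrow> 'a) set" where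
  "span \<equiv> monomial_span K n"

lemma monom_poly_closed: "u \<in> monomials n \<Longrightarrow> monom_poly K u \<in> carrier R"
  by (simp add: monom_poly_eq mterm_closed)

lemma monom_poly_mult:
  "f \<in> carrier R \<Longrightarrow> monom_poly K u \<otimes>\<^bsub>R\<^esub> f = (\<lambda>m. if u \<subseteq># m then f (m - u) else \<zero>)"
  by (auto simp: monom_poly_eq mterm_mult)

lemma monom_poly_add:
  assumes "u \<in> monomials n" "v \<in> monomials n"
  shows "monom_poly K (u + v) = monom_poly K u \<otimes>\<^bsub>R\<^esub> monom_poly K v"
  using monom_poly_mult[OF monom_poly_closed[OF assms(2)], of u]
  by (auto simp: monom_poly_def fun_eq_iff subset_mset.le_iff_add)

lemma R_uminus:
  assumes f: "f \<in> carrier R"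
  shows "\<ominus>\<^bsub>R\<^esub> f = (\<lambda>m. \<ominus> f m)"
proof
  fix m
  have "(f \<oplus>\<^bsub>R\<^esub> \<ominus>\<^bsub>R\<^esub> f) m = \<zero>" using R.r_neg[OF f] by (simp add: R_zero)
  then have "f m \<oplus> (\<ominus>\<^bsub>R\<^esub> f) m = \<zero>" by (simp add: R_add)
  moreover have "(\<ominus>\<^bsub>R\<^esub> f) m \<in> carrier K" using R.a_inv_closed[OF f] by (rule R_closed)
  ultimately show "(\<ominus>\<^bsub>R\<^esub> f) m = \<ominus> f m"
    using f by (metis R_closed a_comm minus_equality)
qed

definition supported_ideal :: "nat multiset set \<Rightarrow> (nat multiset \<Rightarrow> 'a) set" where
  "supported_ideal A = {f \<in> carrier R. \<forall>m. f m \<noteq> \<zero> \<longrightarrow> (\<exists>a\<in>A. a \<subseteq># m)}"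

lemma ideal_supported_ideal: "ideal (supported_ideal A) R"
proof (rule idealI)
  show "ring R" by (rule R.ring_axioms)
  show "subgroup (supported_ideal A) (add_monoid R)"
  proof (rule R.add.subgroupI)
    show "supported_ideal A \<noteq> {}"
      using R.zero_closed unfolding supported_ideal_def R_zero by blast
  next
    fix f assume f: "f \<in> supported_ideal A"
    then have "f m \<noteq> \<zero>" if "\<ominus> f m \<noteq> \<zero>" for m using that by auto
    then show "\<ominus>\<^bsub>R\<^esub> f \<in> supported_ideal A"
      using f R.a_inv_closed[of f] unfolding supported_ideal_def by (simp add: R_uminus)
  next
    fix f g assume fg: "f \<in> supported_ideal A" "g \<in> supported_ideal A"
    then have "f m \<noteq> \<zero> \<or> g m \<noteq> \<zero>" if "f m \<oplus> g m \<noteq> \<zero>" for m using that by auto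
    moreover have "f \<oplus>\<^bsub>R\<^esub> g \<in> carrier R" using fg unfolding supported_ideal_def by simp
    ultimately show "f \<oplus>\<^bsub>R\<^esub> g \<in> supported_ideal A"
      using fg unfolding supported_ideal_def R_add by blast
  qed (auto simp: supported_ideal_def)
  fix f g assume f: "f \<in> supported_ideal A" and g: "g \<in> carrier R"
  have fc: "f \<in> carrier R" using f unfolding supported_ideal_def by simp
  have "\<exists>a\<in>A. a \<subseteq># m" if nz: "(f \<otimes>\<^bsub>R\<^esub> g) m \<noteq> \<zero>" for m
  proof -
    obtain u where "u \<subseteq># m" "f u \<noteq> \<zero>" using R_mult_nonzero[OF fc g nz] .
    then show ?thesis using f unfolding supported_ideal_def by (blast intro: subset_mset.order_trans)
  qed
  then show "f \<otimes>\<^bsub>R\<^esub> g \<in> supported_ideal A"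
    using fc g unfolding supported_ideal_def by simp
  then show "g \<otimes>\<^bsub>R\<^esub> f \<in> supported_ideal A"
    using fc g by (simp add: R.m_comm)
qed

text \<open>Membership in a monomial ideal is decided term by term. Each term of a supported
  polynomial is a multiple of a generator, and induction over the support adds the terms up.\<close>

lemma monomial_span_eq:
  assumes "A \<subseteq> monomials n"
  shows "span A = supported_ideal A"
proof
  have "monom_poly K ` A \<subseteq> supported_ideal A"
  proof
    fix f assume "f \<in> monom_poly K ` A"
    then obtain a where a: "a \<in> A" "f = monom_poly K a" by blast
    then have "\<exists>a\<in>A. a \<subseteq># m" if "f m \<noteq> \<zero>" for m
      using that by (auto simp: monom_poly_def split: if_splits)
    then show "f \<in> supported_ideal A"
      using a assms monom_poly_closed unfolding supported_ideal_def by blast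
  qed
  then show "span A \<subseteq> supported_ideal A"
    unfolding monomial_span_def by (rule R.genideal_minimal[OF ideal_supported_ideal])
next
  have sub: "monom_poly K ` A \<subseteq> carrier R" using assms monom_poly_closed by blast
  interpret I: ideal "span A" R
    unfolding monomial_span_def by (rule R.genideal_ideal[OF sub])
  have gen: "monom_poly K a \<in> span A" if "a \<in> A" for a
    using R.genideal_self[OF sub] that unfolding monomial_span_def by blast
  have "f \<in> span A" if "finite M" "{m. f m \<noteq> \<zero>} = M" "f \<in> supported_ideal A" for f M
    using that
  proof (induction M arbitrary: f)
    case empty
    then have "f = \<zero>\<^bsub>R\<^esub>" by (auto simp: R_zero)
    then show ?case using I.zero_closed by simp
  next
    case (insert u M)
    have f: "f \<in> carrier R" using insert.prems unfolding supported_ideal_def by simp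
    have fu: "f u \<noteq> \<zero>" using insert.prems by blast
    then obtain a where a: "a \<in> A" "a \<subseteq># u"
      using insert.prems unfolding supported_ideal_def by blast
    have u: "u \<in> monomials n" using R_monomials[OF f fu] .
    then have ua: "u - a \<in> monomials n" "a \<in> monomials n" "u = a + (u - a)"
      using a assms monomials_add by (metis subset_mset.add_diff_inverse)+
    have "mterm (f u) u = monom_poly K a \<otimes>\<^bsub>R\<^esub> mterm (f u) (u - a)"
      using monom_poly_mult[OF mterm_closed[OF R_closed[OF f] ua(1)], of a] a(2)
      by (auto simp: mterm_def fun_eq_iff subset_mset.le_iff_add)
    then have t: "mterm (f u) u \<in> span A"
      using I.I_r_closed[OF gen[OF a(1)]] mterm_closed[OF R_closed[OF f] ua(1)] by simp
    have "f(u := \<zero>) \<in> supported_ideal A"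
    proof -
      have "{m. (f(u := \<zero>)) m \<noteq> \<zero>} \<subseteq> {m. f m \<noteq> \<zero>}" by auto
      then have "finite {m. (f(u := \<zero>)) m \<noteq> \<zero>}" using R_finite[OF f] by (rule finite_subset)
      then have "f(u := \<zero>) \<in> carrier R"
      proof (rule R_I[rotated])
        fix m assume "(f(u := \<zero>)) m \<noteq> \<zero>"
        then show "m \<in> monomials n" using R_monomials[OF f, of m] by (cases "m = u") auto
      qed (use R_closed[OF f] in simp)
      moreover have "f m \<noteq> \<zero>" if "(f(u := \<zero>)) m \<noteq> \<zero>" for m
        using that by (cases "m = u") auto
      ultimately show ?thesis using insert.prems(2) unfolding supported_ideal_def by blast
    qed
    moreover have "{m. (f(u := \<zero>)) m \<noteq> \<zero>} = M"
      using insert.prems(1) insert.hyps(2) by auto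
    ultimately have "f(u := \<zero>) \<in> span A" using insert.IH by blast
    moreover have "f = f(u := \<zero>) \<oplus>\<^bsub>R\<^esub> mterm (f u) u"
      using R_closed[OF f] by (auto simp: R_add mterm_def fun_eq_iff)
    ultimately show ?case using t I.a_closed by metis
  qed
  then show "supported_ideal A \<subseteq> span A"
    using R_finite unfolding supported_ideal_def by blast
qed

lemma mem_span:
  "A \<subseteq> monomials n \<Longrightarrow> f \<in> span A \<longleftrightarrow> f \<in> carrier R \<and> (\<forall>m. f m \<noteq> \<zero> \<longrightarrow> (\<exists>a\<in>A. a \<subseteq># m))"
  by (simp add: monomial_span_eq supported_ideal_def)

lemma ideal_span: "A \<subseteq> monomials n \<Longrightarrow> ideal (span A) R"
  using ideal_supported_ideal monomial_span_eq by simp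

lemma monom_poly_in_span:
  assumes "A \<subseteq> monomials n" "u \<in> monomials n"
  shows "monom_poly K u \<in> span A \<longleftrightarrow> (\<exists>a\<in>A. a \<subseteq># u)"
  using assms monom_poly_closed by (auto simp: mem_span monom_poly_def)

lemma span_subset_iff:
  assumes "A \<subseteq> monomials n" "B \<subseteq> monomials n"
  shows "span A \<subseteq> span B \<longleftrightarrow> (\<forall>a\<in>A. \<exists>b\<in>B. b \<subseteq># a)"
proof
  assume "span A \<subseteq> span B"
  then show "\<forall>a\<in>A. \<exists>b\<in>B. b \<subseteq># a"
    using monom_poly_in_span assms by (meson subset_iff subset_mset.order_refl)
next
  assume "\<forall>a\<in>A. \<exists>b\<in>B. b \<subseteq># a"
  then show "span A \<subseteq> span B"
    using assms by (auto simp: mem_span) (meson subset_mset.order_trans)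
qed

lemma mset_sum_monomials:
  "A \<subseteq> monomials n \<Longrightarrow> B \<subseteq> monomials n \<Longrightarrow> mset_sum A B \<subseteq> monomials n"
  by (auto simp: mset_sum_def)

lemma mset_pow_monomials: "B \<subseteq> monomials n \<Longrightarrow> mset_pow B k \<subseteq> monomials n"
  by (induction k) (auto simp: mset_sum_monomials, simp add: monomials_def)

lemma span_mult:
  assumes "A \<subseteq> monomials n" "B \<subseteq> monomials n" "f \<in> span A" "g \<in> span B"
  shows "f \<otimes>\<^bsub>R\<^esub> g \<in> span (mset_sum A B)"
proof -
  have fg: "f \<in> carrier R" "g \<in> carrier R" using assms by (simp_all add: mem_span)
  have "\<exists>c\<in>mset_sum A B. c \<subseteq># m" if nz: "(f \<otimes>\<^bsub>R\<^esub> g) m \<noteq> \<zero>" for m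
  proof -
    obtain u where u: "u \<subseteq># m" "f u \<noteq> \<zero>" "g (m - u) \<noteq> \<zero>" using R_mult_nonzero[OF fg nz] .
    then obtain a b where ab: "a \<in> A" "a \<subseteq># u" "b \<in> B" "b \<subseteq># m - u"
      using assms mem_span by (metis (no_types, lifting))
    then have "a + b \<subseteq># u + (m - u)" by (intro subset_mset.add_mono)
    then show ?thesis using u ab unfolding mset_sum_def by auto
  qed
  then show ?thesis using fg assms mset_sum_monomials by (simp add: mem_span)
qed

lemma ideal_prod_span:
  assumes A: "A \<subseteq> monomials n" and B: "B \<subseteq> monomials n"
  shows "ideal_prod R (span A) (span B) = span (mset_sum A B)"
proof
  interpret I: ideal "span (mset_sum A B)" R
    using ideal_span mset_sum_monomials[OF A B] by simp
  show "ideal_prod R (span A) (span B) \<subseteq> span (mset_sum A B)"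
  proof
    fix f assume "f \<in> ideal_prod R (span A) (span B)"
    then show "f \<in> span (mset_sum A B)"
      by induction (use span_mult[OF A B] I.a_closed in auto)
  qed
next
  have "monom_poly K ` mset_sum A B \<subseteq> ideal_prod R (span A) (span B)"
  proof
    fix f assume "f \<in> monom_poly K ` mset_sum A B"
    then obtain a b where ab: "a \<in> A" "b \<in> B" "f = monom_poly K (a + b)"
      unfolding mset_sum_def by blast
    then have "monom_poly K a \<in> span A" "monom_poly K b \<in> span B"
      using A B by (auto simp: monom_poly_in_span subset_eq)
    then show "f \<in> ideal_prod R (span A) (span B)"
      using ab(3) monom_poly_add[of a b] ab(1,2) A B ideal_prod.prod[of _ "span A" _ "span B" R]
      by (metis subsetD)
  qed
  then show "span (mset_sum A B) \<subseteq> ideal_prod R (span A) (span B)"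
    unfolding monomial_span_def[of K n "mset_sum A B"]
    by (rule R.genideal_minimal[OF R.ideal_prod_is_ideal[OF ideal_span[OF A] ideal_span[OF B]]])
qed

lemma span_one: "span {{#}} = carrier R"
  by (auto simp: mem_span monomials_def)

lemma ideal_pow_span:
  assumes "B \<subseteq> monomials n"
  shows "ideal_pow R (span B) k = span (mset_pow B k)"
proof (induction k)
  case 0
  then show ?case by (simp add: ideal_pow_def nat_pow_def ideals_set_def span_one)
next
  case (Suc k)
  have "ideal_pow R (span B) (Suc k) = ideal_prod R (ideal_pow R (span B) k) (span B)"
    by (simp add: ideal_pow_def nat_pow_def ideals_set_def)
  then show ?case using Suc ideal_prod_span[OF mset_pow_monomials[OF assms] assms] by simp
qed

text \<open>The generators that are minimal for divisibility generate \<open>J\<close> and lie in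
  every monomial generating set of \<open>J\<close>. They are therefore the only irredundant one,
  which makes the definite description in \<open>mingens\<close> meaningful.\<close>

lemma mingens_span:
  assumes "monomial_ideal K n J"
  shows "mingens K n J \<subseteq> monomials n" "span (mingens K n J) = J"
proof -
  obtain A where A: "A \<subseteq> monomials n" "J = span A" using assms unfolding monomial_ideal_def by blast
  define M where "M = {a \<in> A. \<forall>b\<in>A. b \<subseteq># a \<longrightarrow> b = a}"
  have M: "M \<subseteq> A" unfolding M_def by blast
  have below: "\<exists>b\<in>M. b \<subseteq># a" if "a \<in> A" for a
    using that
  proof (induction "size a" arbitrary: a rule: less_induct)
    case less
    show ?case
    proof (cases "a \<in> M")
      case False
      then obtain b where b: "b \<in> A" "b \<subseteq># a" "b \<noteq> a" using less.prems unfolding M_def by blast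
      then have "size b < size a" by (simp add: mset_subset_size subset_mset.le_neq_trans)
      then show ?thesis using less.hyps b by (meson subset_mset.order_trans)
    qed auto
  qed
  have M_span: "span M = J"
    using A M below span_subset_iff[of M A] span_subset_iff[of A M]
    by (metis subset_antisym subset_iff subset_mset.order_refl)
  have mem: "M \<subseteq> C" if C: "C \<subseteq> monomials n" "span C = J" for C
  proof
    fix a assume a: "a \<in> M"
    then obtain c where c: "c \<in> C" "c \<subseteq># a"
      using span_subset_iff[of M C] C M A M_span by blast
    moreover obtain b where b: "b \<in> A" "b \<subseteq># c" using span_subset_iff[of C A] C A c by blast
    moreover have "b \<subseteq># a" using subset_mset.order_trans b(2) c(2) .
    ultimately have "b = a" using a unfolding M_def by blast
    then show "a \<in> C" using b c by (metis subset_mset.order_antisym)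
  qed
  have "mingens K n J = M"
    unfolding mingens_def
  proof (rule the_equality)
    show "M \<subseteq> monomials n \<and> span M = J \<and> (\<forall>B. B \<subset> M \<longrightarrow> span B \<noteq> J)"
      using M A M_span mem by blast
    fix C assume "C \<subseteq> monomials n \<and> span C = J \<and> (\<forall>B. B \<subset> C \<longrightarrow> span B \<noteq> J)"
    then show "C = M" using mem[of C] M_span by blast
  qed
  then show "mingens K n J \<subseteq> monomials n" "span (mingens K n J) = J"
    using M A M_span by auto
qed

end

section \<open>Associated primes and colon ideals\<close>

text \<open>Translates annihilators of cosets into colon ideals (L : y), the form in which they are
  intersected later.\<close>

lemma (in cring) Ass_iff:
  assumes "ideal L R"
  shows "P \<in> Ass R L \<longleftrightarrow> primeideal P R \<and> (\<exists>y\<in>carrier R. P = {r \<in> carrier R. r \<otimes> y \<in> L})"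
proof -
  interpret L: ideal L R by fact
  have car: "carrier (R Quot L) = {L +> y |y. y \<in> carrier R}"
    by (auto simp: FactRing_def A_RCOSETS_def')
  have "((L +> r) \<otimes>\<^bsub>R Quot L\<^esub> (L +> y) = \<zero>\<^bsub>R Quot L\<^esub>) \<longleftrightarrow> r \<otimes> y \<in> L"
    if "r \<in> carrier R" "y \<in> carrier R" for r y
  proof -
    have "L +> (r \<otimes> y) = L \<longleftrightarrow> r \<otimes> y \<in> L"
      using L.a_rcos_const L.a_rcos_self[of "r \<otimes> y"] that by auto
    then show ?thesis using L.rcoset_mult_add[OF that] by (simp add: FactRing_def)
  qed
  then have "{r \<in> carrier R. (L +> r) \<otimes>\<^bsub>R Quot L\<^esub> (L +> y) = \<zero>\<^bsub>R Quot L\<^esub>} = {r \<in> carrier R. r \<otimes> y \<in> L}"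
    if "y \<in> carrier R" for y
    using that by blast
  then show ?thesis unfolding Ass_def car by auto
qed

section \<open>Homology in a fixed multidegree\<close>

definition natdegs :: "nat \<Rightarrow> (nat \<Rightarrow> int) set" where
  "natdegs n = mdeg ` monomials n"

definition mset_of_deg :: "(nat \<Rightarrow> int) \<Rightarrow> nat multiset" where
  "mset_of_deg d = (SOME u. mdeg u = d)"

lemma mdeg_inject [simp]: "mdeg u = mdeg v \<longleftrightarrow> u = v"
  by (auto simp: mdeg_def multiset_eq_iff fun_eq_iff)

lemma mset_of_deg_mdeg [simp]: "mset_of_deg (mdeg u) = u"
  by (simp add: mset_of_deg_def)

lemma mdeg_mset_of_deg [simp]: "d \<in> natdegs n \<Longrightarrow> mdeg (mset_of_deg d) = d"
  by (auto simp: natdegs_def)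

lemma mset_of_deg_monomials [simp]: "d \<in> natdegs n \<Longrightarrow> mset_of_deg d \<in> monomials n"
  by (auto simp: natdegs_def)

lemma monomials_iff: "u \<in> monomials n \<longleftrightarrow> (\<forall>j. j \<notin> {1..n} \<longrightarrow> count u j = 0)"
  unfolding monomials_def by (auto simp: not_in_iff[symmetric])

lemma natdegs_iff: "d \<in> natdegs n \<longleftrightarrow> (\<forall>j. 0 \<le> d j) \<and> (\<forall>j. j \<notin> {1..n} \<longrightarrow> d j = 0)"
proof
  assume d: "(\<forall>j. 0 \<le> d j) \<and> (\<forall>j. j \<notin> {1..n} \<longrightarrow> d j = 0)"
  have "{j. 0 < nat (d j)} \<subseteq> {1..n}" using d by force
  then have fin: "finite {j. 0 < nat (d j)}" using finite_subset by blast
  have "d = mdeg (Abs_multiset (\<lambda>j. nat (d j)))"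
    using d fin by (auto simp: mdeg_def fun_eq_iff)
  moreover have "Abs_multiset (\<lambda>j. nat (d j)) \<in> monomials n"
    using d fin by (auto simp: monomials_iff)
  ultimately show "d \<in> natdegs n" unfolding natdegs_def by blast
qed (auto simp: natdegs_def mdeg_def monomials_iff)

lemma mdeg_diff: "u \<subseteq># m \<Longrightarrow> mdeg (m - u) = (\<lambda>j. mdeg m j - mdeg u j)"
  by (auto simp: mdeg_def subseteq_mset_def of_nat_diff)

lemma mdeg_add: "mdeg (u + v) = (\<lambda>j. mdeg u j + mdeg v j)"
  by (auto simp: mdeg_def)

lemma subseteq_mset_iff_mdeg:
  "u \<subseteq># m \<longleftrightarrow> (\<forall>j. mdeg u j \<le> mdeg m j)"
  by (simp add: mdeg_def subseteq_mset_def)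

lemma natdegs_add: "x \<in> natdegs n \<Longrightarrow> y \<in> natdegs n \<Longrightarrow> (\<lambda>j. x j + y j) \<in> natdegs n"
  by (simp add: natdegs_iff)

text \<open>Order convexity for divisibility, the property of the exponent set of a quotient of two
  monomial ideals. It makes the truncated differential square to zero, since degrees between two
  degrees of \<open>E\<close> stay in \<open>E\<close>.\<close>

definition deg_convex :: "nat \<Rightarrow> (nat \<Rightarrow> int) set \<Rightarrow> bool" where
  "deg_convex n E \<longleftrightarrow> E \<subseteq> natdegs n \<and> (\<forall>x\<in>E. \<forall>y\<in>E. \<forall>z. (\<lambda>j. z j - x j) \<in> natdegs n \<longrightarrow>
     (\<lambda>j. y j - z j) \<in> natdegs n \<longrightarrow> z \<in> E)"

locale resolution = mpoly K n for K (structure) and n +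
  fixes F :: "'a graded_complex"
  assumes resolution: "graded_free_resolution K n F"
begin

text \<open>Outside \<open>natdegs n\<close> the choice in \<open>mset_of_deg\<close> is arbitrary,
  so the case distinction supplies the coefficient zero there.\<close>

definition coef :: "(nat multiset \<Rightarrow> 'a) \<Rightarrow> (nat \<Rightarrow> int) \<Rightarrow> 'a" where
  "coef f d = (if d \<in> natdegs n then f (mset_of_deg d) else \<zero>)"

text \<open>A homogeneous matrix entry is a scalar times one monomial, and only the scalar is kept.
  The resulting matrices are the same in all multidegrees and for all \<open>E\<close>, which enter
  through supports alone.\<close>

definition entry :: "nat \<Rightarrow> nat \<Rightarrow> nat \<Rightarrow> 'a" where
  "entry i p q = coef (diff F i p q) (\<lambda>j. shift F (Suc i) q j - shift F i p j)"

definition deg :: "(nat \<Rightarrow> int) \<Rightarrow> nat \<Rightarrow> nat \<Rightarrow> nat \<Rightarrow> int" where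
  "deg a i p = (\<lambda>j. a j - shift F i p j)"

definition D :: "nat \<Rightarrow> (nat \<Rightarrow> 'a) \<Rightarrow> nat \<Rightarrow> 'a" where
  "D i w = (\<lambda>p. if p < rnk F i then \<Oplus>q\<in>{..<rnk F (Suc i)}. entry i p q \<otimes> w q else \<zero>)"

text \<open>\<open>chains E i a\<close> is the degree \<open>a\<close> part of \<open>F\<^sub>i \<otimes> M\<close>, where \<open>M\<close> is the subquotient of \<open>S\<close>
  spanned by the monomials with exponents in \<open>E\<close>, and \<open>bdry E\<close> is its differential.\<close>

definition chains :: "(nat \<Rightarrow> int) set \<Rightarrow> nat \<Rightarrow> (nat \<Rightarrow> int) \<Rightarrow> (nat \<Rightarrow> 'a) set" where
  "chains E i a = {w. (\<forall>p. w p \<in> carrier K) \<and> (\<forall>p. \<not> (p < rnk F i \<and> deg a i p \<in> E) \<longrightarrow> w p = \<zero>)}"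

definition restr :: "(nat \<Rightarrow> int) set \<Rightarrow> nat \<Rightarrow> (nat \<Rightarrow> int) \<Rightarrow> (nat \<Rightarrow> 'a) \<Rightarrow> nat \<Rightarrow> 'a" where
  "restr E i a w = (\<lambda>p. if deg a i p \<in> E then w p else \<zero>)"

definition bdry :: "(nat \<Rightarrow> int) set \<Rightarrow> nat \<Rightarrow> (nat \<Rightarrow> int) \<Rightarrow> (nat \<Rightarrow> 'a) \<Rightarrow> nat \<Rightarrow> 'a" where
  "bdry E i a w = restr E i a (D i w)"

text \<open>Vanishing of homology: every cycle is a boundary. In homological degree 0 every chain is
  a cycle, because the augmentation does not belong to the tensored complex.\<close>

definition acyclic :: "(nat \<Rightarrow> int) set \<Rightarrow> nat \<Rightarrow> (nat \<Rightarrow> int) \<Rightarrow> bool" where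
  "acyclic E i a \<longleftrightarrow> (\<forall>w\<in>chains E i a. (\<forall>l. i = Suc l \<longrightarrow> bdry E l a w = (\<lambda>_. \<zero>)) \<longrightarrow>
     w \<in> bdry E i a ` chains E (Suc i) a)"

lemma diff_closed: "p < rnk F i \<Longrightarrow> q < rnk F (Suc i) \<Longrightarrow> diff F i p q \<in> carrier R"
  and diff_homogeneous: "p < rnk F i \<Longrightarrow> q < rnk F (Suc i) \<Longrightarrow>
    homogeneous K (\<lambda>j. shift F (Suc i) q j - shift F i p j) (diff F i p q)"
proof -
  have "\<forall>i. \<forall>p<rnk F i. \<forall>q<rnk F (Suc i). diff F i p q \<in> carrier R \<and>
       homogeneous K (\<lambda>j. shift F (Suc i) q j - shift F i p j) (diff F i p q)"
    using resolution unfolding graded_free_resolution_def by (elim conjE)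
  then show "p < rnk F i \<Longrightarrow> q < rnk F (Suc i) \<Longrightarrow> diff F i p q \<in> carrier R"
    "p < rnk F i \<Longrightarrow> q < rnk F (Suc i) \<Longrightarrow>
      homogeneous K (\<lambda>j. shift F (Suc i) q j - shift F i p j) (diff F i p q)" by simp_all
qed

lemma coef_closed [simp]: "f \<in> carrier R \<Longrightarrow> coef f d \<in> carrier K"
  by (simp add: coef_def)

lemma entry_closed [simp]:
  "p < rnk F i \<Longrightarrow> q < rnk F (Suc i) \<Longrightarrow> entry i p q \<in> carrier K"
  unfolding entry_def by (rule coef_closed[OF diff_closed])

lemma entry_nonzero: "entry i p q \<noteq> \<zero> \<Longrightarrow> (\<lambda>j. shift F (Suc i) q j - shift F i p j) \<in> natdegs n"
  by (auto simp: entry_def coef_def split: if_splits)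

lemma entry_nonzero_deg: "entry i p q \<noteq> \<zero> \<Longrightarrow> (\<lambda>j. deg a i p j - deg a (Suc i) q j) \<in> natdegs n"
  using entry_nonzero by (simp add: deg_def)

lemma chains_closed: "w \<in> chains E i a \<Longrightarrow> w p \<in> carrier K"
  by (simp add: chains_def)

lemma chains_zero: "w \<in> chains E i a \<Longrightarrow> deg a i p \<notin> E \<Longrightarrow> w p = \<zero>"
  and chains_zero_rnk: "w \<in> chains E i a \<Longrightarrow> \<not> p < rnk F i \<Longrightarrow> w p = \<zero>"
  unfolding chains_def by blast+

lemma chainsI:
  "(\<And>p. w p \<in> carrier K) \<Longrightarrow> (\<And>p. p < rnk F i \<Longrightarrow> deg a i p \<notin> E \<Longrightarrow> w p = \<zero>) \<Longrightarrow>
    (\<And>p. \<not> p < rnk F i \<Longrightarrow> w p = \<zero>) \<Longrightarrow> w \<in> chains E i a"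
  unfolding chains_def by blast

lemma D_closed [simp]: "(\<And>p. w p \<in> carrier K) \<Longrightarrow> D i w p \<in> carrier K"
  unfolding D_def by (auto intro!: finsum_closed)

lemma D_minus:
  assumes "\<And>p. w p \<in> carrier K" "\<And>p. y p \<in> carrier K"
  shows "D i (\<lambda>p. w p \<ominus> y p) = (\<lambda>p. D i w p \<ominus> D i y p)"
proof
  fix p
  show "D i (\<lambda>p. w p \<ominus> y p) p = D i w p \<ominus> D i y p"
  proof (cases "p < rnk F i")
    case True
    let ?s = "\<lambda>z. \<Oplus>q\<in>{..<rnk F (Suc i)}. entry i p q \<otimes> z q"
    have "?s (\<lambda>p. w p \<ominus> y p) \<oplus> ?s y = (\<Oplus>q\<in>{..<rnk F (Suc i)}. entry i p q \<otimes> (w q \<ominus> y q) \<oplus> entry i p q \<otimes> y q)"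
      using assms True by (intro finsum_addf[symmetric]) auto
    also have "\<dots> = ?s w"
    proof (rule finsum_cong')
      fix q assume "q \<in> {..<rnk F (Suc i)}"
      then have "entry i p q \<in> carrier K" using True by simp
      then show "entry i p q \<otimes> (w q \<ominus> y q) \<oplus> entry i p q \<otimes> y q = entry i p q \<otimes> w q"
        using assms[of q] by algebra
    qed (use assms True in auto)
    finally have "?s (\<lambda>p. w p \<ominus> y p) \<oplus> ?s y = ?s w" .
    moreover have "?s z \<in> carrier K" if "\<And>q. z q \<in> carrier K" for z
      using that True by (intro finsum_closed) auto
    ultimately have "?s (\<lambda>p. w p \<ominus> y p) = ?s w \<ominus> ?s y"
      using assms add.inv_solve_right[of "?s (\<lambda>p. w p \<ominus> y p)" "?s w" "?s y"]
      by (simp add: minus_eq)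
    then show ?thesis using True by (simp add: D_def)
  qed (simp add: D_def minus_eq)
qed

lemma bdry_minus:
  assumes "w \<in> chains E i a" "y \<in> chains Y i a"
  shows "bdry Z l b (\<lambda>p. w p \<ominus> y p) = (\<lambda>p. bdry Z l b w p \<ominus> bdry Z l b y p)"
  using D_minus[of w y] assms[THEN chains_closed] by (auto simp: bdry_def restr_def fun_eq_iff minus_eq)

lemma chains_minus:
  "w \<in> chains E i a \<Longrightarrow> y \<in> chains E i a \<Longrightarrow> (\<lambda>p. w p \<ominus> y p) \<in> chains E i a"
  by (rule chainsI) (simp_all add: chains_zero chains_zero_rnk chains_closed minus_eq)

lemma chains_mono: "E \<subseteq> Y \<Longrightarrow> chains E i a \<subseteq> chains Y i a"
  unfolding chains_def by blast

lemma bdry_closed: "w \<in> chains E (Suc i) a \<Longrightarrow> bdry Y i a w \<in> chains Y i a"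
  by (rule chainsI) (simp_all add: bdry_def restr_def chains_closed, simp add: D_def)

lemma restr_closed: "w \<in> chains E i a \<Longrightarrow> Y \<subseteq> E \<Longrightarrow> restr Y i a w \<in> chains Y i a"
  by (rule chainsI) (simp_all add: restr_def chains_zero_rnk chains_closed)

lemma D_nonzero:
  assumes "w \<in> chains E (Suc i) a" "D i w p \<noteq> \<zero>"
  obtains q where "p < rnk F i" "q < rnk F (Suc i)" "entry i p q \<noteq> \<zero>" "w q \<noteq> \<zero>"
    "deg a (Suc i) q \<in> E" "(\<lambda>j. deg a i p j - deg a (Suc i) q j) \<in> natdegs n"
proof -
  have p: "p < rnk F i" using assms(2) by (auto simp: D_def split: if_splits)
  have "\<exists>q. q < rnk F (Suc i) \<and> entry i p q \<otimes> w q \<noteq> \<zero>"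
  proof (rule ccontr)
    assume "\<not> ?thesis"
    then have "D i w p = \<zero>" using p add.finprod_one_eqI[of "{..<rnk F (Suc i)}" "\<lambda>q. entry i p q \<otimes> w q"]
      unfolding D_def by simp
    then show False using assms(2) by simp
  qed
  then obtain q where q: "q < rnk F (Suc i)" "entry i p q \<otimes> w q \<noteq> \<zero>" by blast
  then have "entry i p q \<noteq> \<zero>" "w q \<noteq> \<zero>" using p chains_closed[OF assms(1)] by auto
  then show ?thesis using that p q(1) chains_zero[OF assms(1)] entry_nonzero_deg by blast
qed

lemma D_cong:
  assumes "\<And>q. q < rnk F (Suc i) \<Longrightarrow> entry i p q \<otimes> w q = entry i p q \<otimes> y q" "\<And>q. y q \<in> carrier K"
  shows "D i w p = D i y p"
proof (cases "p < rnk F i")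
  case True
  have "(\<Oplus>q\<in>{..<rnk F (Suc i)}. entry i p q \<otimes> w q) = (\<Oplus>q\<in>{..<rnk F (Suc i)}. entry i p q \<otimes> y q)"
    by (rule finsum_cong') (use assms True in auto)
  then show ?thesis by (simp add: D_def)
qed (simp add: D_def)

end

context mpoly
begin

lemma finsum_R_apply:
  assumes "finite A" "\<And>q. q \<in> A \<Longrightarrow> f q \<in> carrier R"
  shows "(\<Oplus>\<^bsub>R\<^esub>q\<in>A. f q) m = (\<Oplus>q\<in>A. f q m)"
  using assms
proof (induction A)
  case empty
  then show ?case by (simp add: R_zero)
next
  case (insert x A)
  then have "(\<Oplus>\<^bsub>R\<^esub>q\<in>insert x A. f q) = f x \<oplus>\<^bsub>R\<^esub> (\<Oplus>\<^bsub>R\<^esub>q\<in>A. f q)"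
    by (intro R.finsum_insert) auto
  then show ?case using insert R_closed by (subst finsum_insert) (auto simp: R_add)
qed

end

section \<open>Multigraded pieces of the free resolution\<close>

context resolution
begin

text \<open>\<open>component i a v\<close> extracts the coefficients of the degree \<open>a\<close> part of \<open>v \<in> F\<^sub>i\<close>, and
  \<open>lift i a\<close> is its section.\<close>

definition component :: "nat \<Rightarrow> (nat \<Rightarrow> int) \<Rightarrow> (nat \<Rightarrow> nat multiset \<Rightarrow> 'a) \<Rightarrow> nat \<Rightarrow> 'a" where
  "component i a v = (\<lambda>p. if p < rnk F i then coef (v p) (deg a i p) else \<zero>)"

definition lift :: "nat \<Rightarrow> (nat \<Rightarrow> int) \<Rightarrow> (nat \<Rightarrow> 'a) \<Rightarrow> nat \<Rightarrow> nat multiset \<Rightarrow> 'a" where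
  "lift i a w = (\<lambda>p\<in>{..<rnk F i}. \<lambda>m. if mdeg m = deg a i p then w p else \<zero>)"

lemma coef_zero [simp]: "coef (\<lambda>_. \<zero>) d = \<zero>"
  by (simp add: coef_def)

lemma free_mod_closed: "v \<in> free_mod K n F i \<Longrightarrow> p < rnk F i \<Longrightarrow> v p \<in> carrier R"
  by (auto simp: free_mod_def)

lemma component_chains: "v \<in> free_mod K n F i \<Longrightarrow> component i a v \<in> chains (natdegs n) i a"
  by (rule chainsI) (auto simp: component_def free_mod_closed coef_closed, simp add: coef_def)

lemma bd_closed: "v \<in> free_mod K n F (Suc i) \<Longrightarrow> bd K n F i v \<in> free_mod K n F i"
  unfolding bd_def free_mod_def[of K n F i]
  using R.finsum_closed diff_closed free_mod_closed R.m_closed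
  by (auto simp: PiE_iff extensional_def Pi_def)

text \<open>The only monomial that can occur in the matrix entry has exponent \<open>e\<close>, so
  the convolution collapses to one summand. If \<open>e\<close> is not an exponent or does not fit
  below the target degree, both sides vanish.\<close>

lemma coef_mult_diff:
  assumes p: "p < rnk F i" and q: "q < rnk F (Suc i)" and g: "g \<in> carrier R"
  shows "coef (diff F i p q \<otimes>\<^bsub>R\<^esub> g) (deg a i p) = entry i p q \<otimes> coef g (deg a (Suc i) q)"
proof -
  define e where "e = (\<lambda>j. shift F (Suc i) q j - shift F i p j)"
  have d: "diff F i p q \<in> carrier R" using diff_closed[OF p q] .
  have hom: "mdeg u = e" if "diff F i p q u \<noteq> \<zero>" for u
    using diff_homogeneous[OF p q] that unfolding homogeneous_def e_def by simp
  have deg_sum: "deg a i p = (\<lambda>j. e j + deg a (Suc i) q j)" by (auto simp: deg_def e_def)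
  have entry: "entry i p q = coef (diff F i p q) e" by (simp add: entry_def e_def)
  show ?thesis
  proof (cases "e \<in> natdegs n \<and> deg a i p \<in> natdegs n \<and> mset_of_deg e \<subseteq># mset_of_deg (deg a i p)")
    case True
    define u where "u = mset_of_deg e"
    define m where "m = mset_of_deg (deg a i p)"
    have um: "mdeg u = e" "mdeg m = deg a i p" "u \<subseteq># m" "u \<in> monomials n" "m \<in> monomials n"
      using True by (auto simp: u_def m_def)
    have mu: "mdeg (m - u) = deg a (Suc i) q"
      using mdeg_diff[OF um(3)] um(1,2) by (simp add: deg_sum)
    have "m - u \<in> monomials n" using um(5) by (auto simp: monomials_iff)
    then have "deg a (Suc i) q \<in> natdegs n" using mu unfolding natdegs_def by (metis image_eqI)
    moreover have "mset_of_deg (deg a (Suc i) q) = m - u" using mset_of_deg_mdeg[of "m - u"] mu by simp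
    ultimately have cg: "coef g (deg a (Suc i) q) = g (m - u)" by (simp add: coef_def)
    have "(diff F i p q \<otimes>\<^bsub>R\<^esub> g) m = diff F i p q u \<otimes> g (m - u)"
      unfolding R_mult
    proof (rule finsum_single)
      fix v assume "v \<in> {u. u \<subseteq># m}" "v \<noteq> u"
      then have "diff F i p q v = \<zero>" using hom um(1) mdeg_inject by metis
      then show "diff F i p q v \<otimes> g (m - v) = \<zero>" using R_closed[OF g] by simp
    qed (use um finite_submultisets R_closed[OF g] R_closed[OF d] in auto)
    moreover have "coef (diff F i p q \<otimes>\<^bsub>R\<^esub> g) (deg a i p) = (diff F i p q \<otimes>\<^bsub>R\<^esub> g) m"
      using True by (simp add: coef_def m_def)
    moreover have "entry i p q = diff F i p q u"
      unfolding entry using True by (simp add: coef_def u_def)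
    ultimately show ?thesis using cg by simp
  next
    case False
    have "coef (diff F i p q \<otimes>\<^bsub>R\<^esub> g) (deg a i p) = \<zero>"
    proof (rule ccontr)
      assume nz: "coef (diff F i p q \<otimes>\<^bsub>R\<^esub> g) (deg a i p) \<noteq> \<zero>"
      then have dn: "deg a i p \<in> natdegs n" by (auto simp: coef_def split: if_splits)
      then have "(diff F i p q \<otimes>\<^bsub>R\<^esub> g) (mset_of_deg (deg a i p)) \<noteq> \<zero>"
        using nz by (simp add: coef_def)
      then obtain u where u: "u \<subseteq># mset_of_deg (deg a i p)" "diff F i p q u \<noteq> \<zero>"
        using R_mult_nonzero[OF d g] by metis
      then have "mdeg u = e" "u \<in> monomials n" using hom R_monomials[OF d] by auto
      then have "e \<in> natdegs n" "mset_of_deg e = u" by (auto simp: natdegs_def)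
      then show False using False u dn by simp
    qed
    moreover have "entry i p q \<otimes> coef g (deg a (Suc i) q) = \<zero>"
    proof (rule ccontr)
      assume nz: "entry i p q \<otimes> coef g (deg a (Suc i) q) \<noteq> \<zero>"
      have c: "entry i p q \<in> carrier K" "coef g (deg a (Suc i) q) \<in> carrier K"
        using p q g by simp_all
      have "entry i p q \<noteq> \<zero>" "coef g (deg a (Suc i) q) \<noteq> \<zero>" using nz c by auto
      then have n: "e \<in> natdegs n" "deg a (Suc i) q \<in> natdegs n"
        by (auto simp: entry coef_def split: if_splits)
      then have n': "deg a i p \<in> natdegs n" unfolding deg_sum by (rule natdegs_add)
      have "mset_of_deg e \<subseteq># mset_of_deg (deg a i p)"
        unfolding subseteq_mset_iff_mdeg mdeg_mset_of_deg[OF n(1)] mdeg_mset_of_deg[OF n']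
        using n(2) by (simp add: deg_sum natdegs_iff)
      then show False using False n n' by simp
    qed
    ultimately show ?thesis by simp
  qed
qed

lemma component_bd:
  assumes v: "v \<in> free_mod K n F (Suc i)"
  shows "component i a (bd K n F i v) = D i (component (Suc i) a v)"
proof
  fix p
  show "component i a (bd K n F i v) p = D i (component (Suc i) a v) p"
  proof (cases "p < rnk F i")
    case True
    let ?t = "\<lambda>q. diff F i p q \<otimes>\<^bsub>R\<^esub> v q"
    have t: "?t q \<in> carrier R" if "q \<in> {..<rnk F (Suc i)}" for q
      using that True diff_closed free_mod_closed[OF v] by simp
    have "coef (\<Oplus>\<^bsub>R\<^esub>q\<in>{..<rnk F (Suc i)}. ?t q) (deg a i p)
        = (\<Oplus>q\<in>{..<rnk F (Suc i)}. coef (?t q) (deg a i p))"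
      unfolding coef_def using finsum_R_apply[of "{..<rnk F (Suc i)}" ?t] t
      by (auto simp: add.finprod_one_eqI)
    also have "\<dots> = (\<Oplus>q\<in>{..<rnk F (Suc i)}. entry i p q \<otimes> component (Suc i) a v q)"
      using True free_mod_closed[OF v] coef_mult_diff[OF True]
      by (intro finsum_cong') (auto simp: component_def)
    finally show ?thesis using True by (simp add: component_def D_def bd_def)
  qed (simp add: component_def D_def)
qed

lemma free_mod_eqI:
  assumes v: "v \<in> free_mod K n F i" and w: "w \<in> free_mod K n F i"
    and eq: "\<And>a. component i a v = component i a w"
  shows "v = w"
proof
  fix p
  show "v p = w p"
  proof (cases "p < rnk F i")
    case True
    show ?thesis
    proof
      fix m
      show "v p m = w p m"
      proof (cases "m \<in> monomials n")
        case m: True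
        \<comment> \<open>The multidegree in which the monomial \<open>m\<close> of the
          \<open>p\<close>-th coordinate lives.\<close>
        define a where "a = (\<lambda>j. mdeg m j + shift F i p j)"
        have "deg a i p = mdeg m" by (simp add: deg_def a_def)
        then have "coef (v p) (mdeg m) = coef (w p) (mdeg m)"
          using fun_cong[OF eq[of a], of p] True by (simp add: component_def)
        then show ?thesis using m by (simp add: coef_def natdegs_def)
      next
        case False
        then show ?thesis
          using R_monomials[OF free_mod_closed[OF v True], of m]
            R_monomials[OF free_mod_closed[OF w True], of m] by metis
      qed
    qed
  next
    case False
    then have "p \<notin> {..<rnk F i}" by simp
    then show ?thesis
      using PiE_arb[of v "{..<rnk F i}"] PiE_arb[of w "{..<rnk F i}"] v w
      unfolding free_mod_def by metis
  qed
qed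

lemma lift_closed:
  assumes "w \<in> chains (natdegs n) i a"
  shows "lift i a w \<in> free_mod K n F i"
proof -
  have "(\<lambda>m. if mdeg m = deg a i p then w p else \<zero>) \<in> carrier R" for p
  proof (rule R_I)
    fix m
    show "(if mdeg m = deg a i p then w p else \<zero>) \<in> carrier K" using chains_closed[OF assms] by simp
    assume "(if mdeg m = deg a i p then w p else \<zero>) \<noteq> \<zero>"
    then have *: "mdeg m = deg a i p" "w p \<noteq> \<zero>" by (auto split: if_splits)
    then have "mdeg m \<in> natdegs n" using chains_zero[OF assms, of p] by metis
    then show "m \<in> monomials n" by (auto simp: natdegs_def)
  next
    have "{m. (if mdeg m = deg a i p then w p else \<zero>) \<noteq> \<zero>} \<subseteq> {mset_of_deg (deg a i p)}"
    proof
      fix m assume "m \<in> {m. (if mdeg m = deg a i p then w p else \<zero>) \<noteq> \<zero>}"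
      then have "mdeg m = deg a i p" by (simp split: if_splits)
      then show "m \<in> {mset_of_deg (deg a i p)}" using mset_of_deg_mdeg[of m] by simp
    qed
    then show "finite {m. (if mdeg m = deg a i p then w p else \<zero>) \<noteq> \<zero>}"
      by (rule finite_subset) simp
  qed
  then show ?thesis by (auto simp: lift_def free_mod_def)
qed

lemma component_lift:
  assumes "w \<in> chains (natdegs n) i a"
  shows "component i b (lift i a w) = (if b = a then w else (\<lambda>_. \<zero>))"
proof
  fix p
  have "deg b i p = deg a i p \<longleftrightarrow> b = a" by (auto simp: deg_def fun_eq_iff)
  then show "component i b (lift i a w) p = (if b = a then w else (\<lambda>_. \<zero>)) p"
    using chains_zero[OF assms, of p] chains_zero_rnk[OF assms, of p]
    by (auto simp: component_def lift_def coef_def)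
qed

lemma zero_chains: "(\<lambda>_. \<zero>) \<in> chains E i a"
  by (rule chainsI) auto

lemma zero_vec_eq: "zero_vec K n F i = lift i a (\<lambda>_. \<zero>)"
  by (auto simp: zero_vec_def lift_def R_zero)

lemma D_zero: "D i (\<lambda>_. \<zero>) = (\<lambda>_. \<zero>)"
proof
  fix p show "D i (\<lambda>_. \<zero>) p = \<zero>"
    by (cases "p < rnk F i") (auto simp: D_def intro!: add.finprod_one_eqI)
qed

lemma D_chains:
  assumes "w \<in> chains (natdegs n) (Suc i) a"
  shows "D i w \<in> chains (natdegs n) i a"
proof -
  have "component i a (bd K n F i (lift (Suc i) a w)) = D i w"
    using component_bd[OF lift_closed[OF assms]] component_lift[OF assms] by simp
  then show ?thesis using component_chains[OF bd_closed[OF lift_closed[OF assms]]] by metis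
qed

lemma bd_lift:
  assumes w: "w \<in> chains (natdegs n) (Suc i) a"
  shows "bd K n F i (lift (Suc i) a w) = lift i a (D i w)"
proof (rule free_mod_eqI[OF bd_closed[OF lift_closed[OF w]] lift_closed[OF D_chains[OF w]]])
  show "component i b (bd K n F i (lift (Suc i) a w)) = component i b (lift i a (D i w))" for b
    unfolding component_bd[OF lift_closed[OF w]] component_lift[OF w]
      component_lift[OF D_chains[OF w]] by (simp add: D_zero)
qed

lemma lift_inject:
  assumes "v \<in> chains (natdegs n) i a" "w \<in> chains (natdegs n) i a"
  shows "lift i a v = lift i a w \<longleftrightarrow> v = w"
  using component_lift[OF assms(1), of a] component_lift[OF assms(2), of a] by metis

lemma exact_Suc: "{v \<in> free_mod K n F (Suc i). bd K n F i v = zero_vec K n F i} =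
    bd K n F (Suc i) ` free_mod K n F (Suc (Suc i))"
  and exact_0: "{v \<in> free_mod K n F 0. augmentation K F v = \<zero>} = bd K n F 0 ` free_mod K n F 1"
  and augmentation_surj: "augmentation K F ` free_mod K n F 0 = carrier K"
  and aug_closed: "p < rnk F 0 \<Longrightarrow> aug F p \<in> carrier K"
  and aug_shift: "p < rnk F 0 \<Longrightarrow> aug F p \<noteq> \<zero> \<Longrightarrow> shift F 0 p = (\<lambda>j. 0)"
proof -
  note r = resolution[unfolded graded_free_resolution_def]
  show "{v \<in> free_mod K n F (Suc i). bd K n F i v = zero_vec K n F i} =
    bd K n F (Suc i) ` free_mod K n F (Suc (Suc i))" using r by (elim conjE) (rule spec)
  show "{v \<in> free_mod K n F 0. augmentation K F v = \<zero>} = bd K n F 0 ` free_mod K n F 1"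
    using r by (elim conjE)
  show "augmentation K F ` free_mod K n F 0 = carrier K" using r by (elim conjE)
  have "\<forall>p<rnk F 0. aug F p \<in> carrier K \<and> (aug F p \<noteq> \<zero> \<longrightarrow> shift F 0 p = (\<lambda>j. 0))"
    using r by (elim conjE)
  then show "p < rnk F 0 \<Longrightarrow> aug F p \<in> carrier K"
    "p < rnk F 0 \<Longrightarrow> aug F p \<noteq> \<zero> \<Longrightarrow> shift F 0 p = (\<lambda>j. 0)" by simp_all
qed

text \<open>The resolution is given only through exactness; that the differential squares to zero is
  the inclusion of the image in the kernel.\<close>

lemma D_D:
  assumes w: "w \<in> chains (natdegs n) (Suc (Suc l)) a"
  shows "D l (D (Suc l) w) p = \<zero>"
proof -
  have "bd K n F (Suc l) (lift (Suc (Suc l)) a w) \<in> bd K n F (Suc l) ` free_mod K n F (Suc (Suc l))"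
    using lift_closed[OF w] by blast
  then have "lift (Suc l) a (D (Suc l) w) \<in> {v \<in> free_mod K n F (Suc l). bd K n F l v = zero_vec K n F l}"
    unfolding exact_Suc bd_lift[OF w] .
  then have "lift l a (D l (D (Suc l) w)) = lift l a (\<lambda>_. \<zero>)"
    using bd_lift[OF D_chains[OF w]] zero_vec_eq by simp
  then have "D l (D (Suc l) w) = (\<lambda>_. \<zero>)"
    using lift_inject[OF D_chains[OF D_chains[OF w]] zero_chains] by simp
  then show ?thesis by simp
qed

lemma augmentation_lift:
  assumes "w \<in> chains (natdegs n) 0 a" "a \<noteq> (\<lambda>_. 0)"
  shows "augmentation K F (lift 0 a w) = \<zero>"
  unfolding augmentation_def
proof (rule add.finprod_one_eqI)
  fix p assume "p \<in> {..<rnk F 0}"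
  then have p: "p < rnk F 0" by simp
  show "lift 0 a w p {#} \<otimes> aug F p = \<zero>"
  proof (cases "aug F p = \<zero>")
    case False
    then have "deg a 0 p = a" using aug_shift[OF p] by (simp add: deg_def)
    then have "lift 0 a w p {#} = \<zero>" using assms(2) p by (auto simp: lift_def mdeg_def)
    then show ?thesis using aug_closed[OF p] by simp
  qed (use p chains_closed[OF assms(1)] in \<open>auto simp: lift_def\<close>)
qed

lemma bdry_natdegs:
  assumes "w \<in> chains (natdegs n) (Suc i) a"
  shows "bdry (natdegs n) i a w = D i w"
  using chains_zero[OF D_chains[OF assms]] by (auto simp: bdry_def restr_def fun_eq_iff)

text \<open>Here the module is S itself, so the complex is the resolution of K, whose only homology
  is K in homological degree 0 and multidegree 0.\<close>

lemma acyclic_natdegs: "acyclic (natdegs n) i a \<longleftrightarrow> \<not> (i = 0 \<and> a = (\<lambda>_. 0))"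
proof -
  have bdry_imp: "w \<in> bdry (natdegs n) i a ` chains (natdegs n) (Suc i) a"
    if w: "w \<in> chains (natdegs n) i a" and v: "v \<in> free_mod K n F (Suc i)"
      "lift i a w = bd K n F i v" for w v i
  proof -
    have "w = D i (component (Suc i) a v)"
      using component_bd[OF v(1), of a] component_lift[OF w, of a] v(2) by simp
    then show ?thesis
      using component_chains[OF v(1)] bdry_natdegs by (metis image_eqI)
  qed
  show ?thesis
  proof (cases i)
    case (Suc l)
    have "acyclic (natdegs n) i a"
      unfolding acyclic_def
    proof (intro ballI impI)
      fix w assume w: "w \<in> chains (natdegs n) i a"
        and "\<forall>l. i = Suc l \<longrightarrow> bdry (natdegs n) l a w = (\<lambda>_. \<zero>)"
      then have "D l w = (\<lambda>_. \<zero>)" using bdry_natdegs Suc by metis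
      then have "lift i a w \<in> {v \<in> free_mod K n F (Suc l). bd K n F l v = zero_vec K n F l}"
        using lift_closed[OF w] bd_lift[of w l a] w zero_vec_eq Suc by simp
      then obtain v where "v \<in> free_mod K n F (Suc i)" "lift i a w = bd K n F i v"
        unfolding exact_Suc Suc by blast
      then show "w \<in> bdry (natdegs n) i a ` chains (natdegs n) (Suc i) a"
        using bdry_imp w by blast
    qed
    then show ?thesis using Suc by simp
  next
    case 0
    have "acyclic (natdegs n) 0 a" if a: "a \<noteq> (\<lambda>_. 0)"
      unfolding acyclic_def
    proof (intro ballI impI)
      fix w assume w: "w \<in> chains (natdegs n) 0 a"
      have "lift 0 a w \<in> {v \<in> free_mod K n F 0. augmentation K F v = \<zero>}"
        using lift_closed[OF w] augmentation_lift[OF w a] by simp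
      then obtain v where "v \<in> free_mod K n F (Suc 0)" "lift 0 a w = bd K n F 0 v"
        unfolding exact_0 by auto
      then show "w \<in> bdry (natdegs n) 0 a ` chains (natdegs n) (Suc 0) a"
        using bdry_imp w by blast
    qed
    moreover have "\<not> acyclic (natdegs n) 0 a" if a: "a = (\<lambda>_. 0)"
    proof
      assume ac: "acyclic (natdegs n) 0 a"
      have "\<one> \<in> augmentation K F ` free_mod K n F 0" unfolding augmentation_surj by simp
      then obtain v where v': "\<one> = augmentation K F v" and v: "v \<in> free_mod K n F 0" by (rule imageE)
      note v = v v'[symmetric]
      \<comment> \<open>The augmentation sees only multidegree 0, so this component of
        \<open>v\<close> still maps to one, whereas boundaries map to zero.\<close>
      define w where "w = component 0 a v"
      have w: "w \<in> chains (natdegs n) 0 a" unfolding w_def using component_chains[OF v(1)] .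
      have "augmentation K F (lift 0 a w) = augmentation K F v"
        unfolding augmentation_def
      proof (rule finsum_cong')
        show "(\<lambda>p. v p {#} \<otimes> aug F p) \<in> {..<rnk F 0} \<rightarrow> carrier K"
          using free_mod_closed[OF v(1)] aug_closed R_closed by (auto intro!: m_closed)
        fix p assume "p \<in> {..<rnk F 0}"
        then have p: "p < rnk F 0" by simp
        show "lift 0 a w p {#} \<otimes> aug F p = v p {#} \<otimes> aug F p"
        proof (cases "aug F p = \<zero>")
          case False
          then have "deg a 0 p = (\<lambda>_. 0)" using aug_shift[OF p] a by (simp add: deg_def)
          moreover have "(\<lambda>_. 0) = mdeg {#}" by (simp add: mdeg_def)
          moreover have "mdeg {#} \<in> natdegs n" by (simp add: natdegs_def monomials_def)
          ultimately show ?thesis using p by (simp add: lift_def w_def component_def coef_def)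
        next
          case True
          have "v p {#} \<in> carrier K" "lift 0 a w p {#} \<in> carrier K"
            using R_closed free_mod_closed[OF v(1) p] free_mod_closed[OF lift_closed[OF w] p] by auto
          then show ?thesis using True by simp
        qed
      qed simp
      then have aug1: "augmentation K F (lift 0 a w) = \<one>" using v(2) by simp
      obtain y where y: "y \<in> chains (natdegs n) (Suc 0) a" "w = bdry (natdegs n) 0 a y"
        using ac w unfolding acyclic_def by blast
      then have "lift 0 a w = bd K n F 0 (lift (Suc 0) a y)"
        using bd_lift[OF y(1)] bdry_natdegs[OF y(1)] by simp
      moreover have "lift (Suc 0) a y \<in> free_mod K n F 1" using lift_closed[OF y(1)] by simp
      ultimately have "lift 0 a w \<in> {v \<in> free_mod K n F 0. augmentation K F v = \<zero>}"
        unfolding exact_0 by blast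
      then show False using aug1 by simp
    qed
    ultimately show ?thesis using 0 by blast
  qed
qed

end

text \<open>Encodes a short exact sequence of modules with exponent sets \<open>E'\<close>,
  \<open>E\<close> and \<open>E''\<close>. The assumption \<open>closed\<close> says that
  \<open>E'\<close> spans a submodule of the module spanned by \<open>E\<close>, and
  \<open>E''\<close> spans the quotient.\<close>

locale subquotient = resolution K n F for K (structure) and n F +
  fixes E E' E'' :: "(nat \<Rightarrow> int) set"
  assumes convex: "deg_convex n E"
    and union: "E = E' \<union> E''" and disjoint: "E' \<inter> E'' = {}"
    and closed: "\<And>x y. x \<in> E' \<Longrightarrow> y \<in> E \<Longrightarrow> (\<lambda>j. y j - x j) \<in> natdegs n \<Longrightarrow> y \<in> E'"
begin

lemma E_sub: "E' \<subseteq> E" "E'' \<subseteq> E" "E \<subseteq> natdegs n"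
  using union convex by (auto simp: deg_convex_def)

text \<open>Only the terms discarded between the two differentials need attention. An intermediate
  degree that contributes lies between two degrees of \<open>E\<close>, hence in \<open>E\<close> by
  convexity, so nothing relevant was discarded.\<close>

lemma bdry_bdry:
  assumes w: "w \<in> chains E (Suc (Suc l)) a"
  shows "bdry E l a (bdry E (Suc l) a w) = (\<lambda>_. \<zero>)"
proof
  fix p
  have wc: "\<And>p. w p \<in> carrier K" using w by (rule chains_closed)
  show "bdry E l a (bdry E (Suc l) a w) p = \<zero>"
  proof (cases "deg a l p \<in> E")
    case True
    have "D l (bdry E (Suc l) a w) p = D l (D (Suc l) w) p"
    proof (rule D_cong)
      fix q assume q: "q < rnk F (Suc l)"
      show "entry l p q \<otimes> bdry E (Suc l) a w q = entry l p q \<otimes> D (Suc l) w q"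
      proof (cases "entry l p q = \<zero> \<or> D (Suc l) w q = \<zero>")
        case False
        then obtain r where r: "deg a (Suc (Suc l)) r \<in> E"
          "(\<lambda>j. deg a (Suc l) q j - deg a (Suc (Suc l)) r j) \<in> natdegs n"
          using D_nonzero[OF w, of q] by metis
        have "deg a (Suc l) q \<in> E"
          using convex r True entry_nonzero_deg[of l p q a] False unfolding deg_convex_def by blast
        then show ?thesis by (simp add: bdry_def restr_def)
      qed (use wc in \<open>auto simp: bdry_def restr_def\<close>)
    qed (use wc in auto)
    also have "\<dots> = \<zero>" using D_D w chains_mono[OF E_sub(3)] by blast
    finally show ?thesis by (simp add: bdry_def restr_def)
  qed (simp add: bdry_def restr_def)
qed

lemma bdry_sub:
  assumes w: "w \<in> chains E' (Suc i) a"
  shows "bdry E' i a w = bdry E i a w"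
proof
  fix p
  have "deg a i p \<in> E'" if "deg a i p \<in> E" "D i w p \<noteq> \<zero>"
    using D_nonzero[OF w that(2)] closed that(1) by metis
  then show "bdry E' i a w p = bdry E i a w p"
    using E_sub by (cases "D i w p = \<zero>") (auto simp: bdry_def restr_def)
qed

text \<open>Projection to the quotient commutes with the differentials because no nonzero entry
  leads from a degree in \<open>E'\<close> to one in \<open>E''\<close>.\<close>

lemma restr_bdry:
  assumes w: "w \<in> chains E (Suc i) a"
  shows "restr E'' i a (bdry E i a w) = bdry E'' i a (restr E'' (Suc i) a w)"
proof
  fix p
  have wc: "\<And>p. w p \<in> carrier K" using w by (rule chains_closed)
  show "restr E'' i a (bdry E i a w) p = bdry E'' i a (restr E'' (Suc i) a w) p"
  proof (cases "deg a i p \<in> E''")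
    case True
    have "D i (restr E'' (Suc i) a w) p = D i w p"
    proof (rule D_cong)
      fix q
      show "entry i p q \<otimes> restr E'' (Suc i) a w q = entry i p q \<otimes> w q"
      proof (cases "entry i p q = \<zero> \<or> w q = \<zero>")
        case False
        then have "deg a (Suc i) q \<in> E" using chains_zero[OF w] by blast
        moreover have "deg a (Suc i) q \<notin> E'"
          using closed[of "deg a (Suc i) q" "deg a i p"] True disjoint E_sub
            entry_nonzero_deg[of i p q a] False by blast
        ultimately show ?thesis using union by (simp add: restr_def)
      qed (use wc in \<open>auto simp: restr_def\<close>)
    qed (use wc in auto)
    then show ?thesis using True E_sub by (auto simp: bdry_def restr_def)
  qed (simp add: bdry_def restr_def)
qed

lemma restr_id: "w \<in> chains E'' i a \<Longrightarrow> restr E'' i a w = w"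
  unfolding restr_def using chains_zero by (auto simp: fun_eq_iff)

lemma restr_zero_iff:
  assumes "w \<in> chains E i a"
  shows "restr E'' i a w = (\<lambda>_. \<zero>) \<longleftrightarrow> w \<in> chains E' i a"
proof
  assume r: "restr E'' i a w = (\<lambda>_. \<zero>)"
  have "w p = \<zero>" if "deg a i p \<notin> E'" for p
    using fun_cong[OF r, of p] chains_zero[OF assms, of p] that union
    by (cases "deg a i p \<in> E") (auto simp: restr_def split: if_splits)
  then show "w \<in> chains E' i a" using assms chains_closed[OF assms] by (intro chainsI) (auto simp: chains_zero_rnk)
qed (use disjoint chains_zero in \<open>fastforce simp: restr_def\<close>)

lemma restr_minus: "restr Y i a (\<lambda>p. w p \<ominus> y p) = (\<lambda>p. restr Y i a w p \<ominus> restr Y i a y p)"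
  by (auto simp: restr_def fun_eq_iff minus_eq)

lemma restr_bdry'': "w \<in> chains E'' (Suc i) a \<Longrightarrow> restr E'' i a (bdry E i a w) = bdry E'' i a w"
  using restr_bdry[of w i a] restr_id[of w] chains_mono[OF E_sub(2)] by (metis subsetD)

lemma minus_self_eq: "w \<in> chains E i a \<Longrightarrow> (\<lambda>p. w p \<ominus> w p) = (\<lambda>_. \<zero>)"
  by (auto simp: fun_eq_iff minus_eq r_neg chains_closed)

text \<open>Exactness of the long homology sequence at the middle module, as a vanishing
  statement.\<close>

lemma acyclic_middle:
  assumes 1: "acyclic E' i a" and 2: "acyclic E'' i a"
  shows "acyclic E i a"
  unfolding acyclic_def
proof (intro ballI impI)
  fix w assume w: "w \<in> chains E i a" and cyc: "\<forall>l. i = Suc l \<longrightarrow> bdry E l a w = (\<lambda>_. \<zero>)"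
  have "\<forall>l. i = Suc l \<longrightarrow> bdry E'' l a (restr E'' i a w) = (\<lambda>_. \<zero>)"
    using restr_bdry w cyc by (metis (mono_tags, lifting) restr_def)
  then obtain y where y: "y \<in> chains E'' (Suc i) a" "restr E'' i a w = bdry E'' i a y"
    using 2 restr_closed[OF w E_sub(2)] unfolding acyclic_def by blast
  have yX: "y \<in> chains E (Suc i) a" using y(1) chains_mono[OF E_sub(2)] by blast
  define v where "v = (\<lambda>p. w p \<ominus> bdry E i a y p)"
  have dy: "bdry E i a y \<in> chains E i a" using bdry_closed[OF yX] .
  have vX: "v \<in> chains E i a" unfolding v_def using chains_minus[OF w dy] .
  have "restr E'' i a v = (\<lambda>_. \<zero>)"
    unfolding v_def restr_minus y(2) restr_bdry''[OF y(1)]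
    using minus_self_eq chains_mono[OF E_sub(2)] bdry_closed[OF y(1), of E''] by blast
  then have vX': "v \<in> chains E' i a" using restr_zero_iff[OF vX] by simp
  have "\<forall>l. i = Suc l \<longrightarrow> bdry E' l a v = (\<lambda>_. \<zero>)"
  proof (intro allI impI)
    fix l assume l: "i = Suc l"
    have "bdry E' l a v = (\<lambda>p. bdry E l a w p \<ominus> bdry E l a (bdry E i a y) p)"
      using bdry_sub vX' l bdry_minus[OF w dy] unfolding v_def by metis
    then show "bdry E' l a v = (\<lambda>_. \<zero>)"
      using cyc l bdry_bdry[of y l a] yX by (simp add: minus_eq)
  qed
  then obtain z where z: "z \<in> chains E' (Suc i) a" "v = bdry E' i a z"
    using 1 vX' unfolding acyclic_def by blast
  have zX: "z \<in> chains E (Suc i) a" using z(1) chains_mono[OF E_sub(1)] by blast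
  \<comment> \<open>The preimage of \<open>w\<close> is the sum of \<open>z\<close> and
    \<open>y\<close>. It is written as a difference because linearity of \<open>bdry\<close> is
    available for differences.\<close>
  define ny where "ny = (\<lambda>p. \<ominus> y p)"
  have ny: "ny \<in> chains E (Suc i) a"
    unfolding ny_def by (rule chainsI) (use yX in \<open>simp_all add: chains_zero chains_zero_rnk chains_closed\<close>)
  have z0: "(\<lambda>_. \<zero>) \<in> chains E (Suc i) a" by (simp add: chains_def)
  have ny_eq: "ny = (\<lambda>p. (\<lambda>_. \<zero>) p \<ominus> y p)" using yX by (auto simp: ny_def fun_eq_iff minus_eq chains_closed)
  have "w = bdry E i a (\<lambda>p. z p \<ominus> ny p)"
  proof
    fix p
    have c: "w p \<in> carrier K" "bdry E i a y p \<in> carrier K" "bdry E i a z p \<in> carrier K"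
      using w dy bdry_closed[OF zX, of E] chains_closed by blast+
    have "bdry E i a (\<lambda>_. \<zero>) p = \<zero>"
      unfolding bdry_def restr_def D_def by (auto intro!: add.finprod_one_eqI)
    then have "bdry E i a ny p = \<ominus> bdry E i a y p"
      unfolding ny_eq bdry_minus[OF z0 yX] using c by (simp add: minus_eq)
    moreover have "bdry E i a z p = w p \<ominus> bdry E i a y p"
      using z bdry_sub unfolding v_def by (metis (no_types))
    ultimately show "w p = bdry E i a (\<lambda>p. z p \<ominus> ny p) p"
      unfolding bdry_minus[OF zX ny] using c by (simp add: minus_eq a_assoc l_neg)
  qed
  then show "w \<in> bdry E i a ` chains E (Suc i) a" using chains_minus[OF zX ny] by blast
qed

text \<open>Exactness at the quotient. The differential of a lifted cycle is a cycle in the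
  submodule, one homological degree lower; for \<open>i = 0\<close> there is nothing to
  correct.\<close>

lemma acyclic_quotient:
  assumes 1: "acyclic E i a" and 2: "\<And>l. i = Suc l \<Longrightarrow> acyclic E' l a"
  shows "acyclic E'' i a"
  unfolding acyclic_def
proof (intro ballI impI)
  fix w assume w: "w \<in> chains E'' i a" and cyc: "\<forall>l. i = Suc l \<longrightarrow> bdry E'' l a w = (\<lambda>_. \<zero>)"
  have wX: "w \<in> chains E i a" using w chains_mono[OF E_sub(2)] by blast
  have "\<exists>z\<in>chains E' i a. \<forall>l. i = Suc l \<longrightarrow> bdry E l a (\<lambda>p. w p \<ominus> z p) = (\<lambda>_. \<zero>)"
  proof (cases i)
    case 0
    have "(\<lambda>_. \<zero>) \<in> chains E' i a" by (simp add: chains_def)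
    then show ?thesis using 0 by blast
  next
    case (Suc l)
    define v where "v = bdry E l a w"
    have v: "v \<in> chains E l a" unfolding v_def using bdry_closed wX Suc by blast
    have "restr E'' l a v = (\<lambda>_. \<zero>)"
      unfolding v_def using restr_bdry'' w cyc Suc by simp
    then have v': "v \<in> chains E' l a" using restr_zero_iff[OF v] by simp
    have "bdry E' k a v = (\<lambda>_. \<zero>)" if "l = Suc k" for k
      using bdry_sub[of v k a] v' that bdry_bdry[of w k a] wX Suc unfolding v_def by simp
    then obtain z where z: "z \<in> chains E' i a" "v = bdry E' l a z"
      using 2[OF Suc] v' Suc unfolding acyclic_def by blast
    have zX: "z \<in> chains E i a" using z(1) chains_mono[OF E_sub(1)] by blast
    have "v = bdry E l a z" using bdry_sub[of z l a] z Suc by simp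
    then have "bdry E l a (\<lambda>p. w p \<ominus> z p) = (\<lambda>p. v p \<ominus> v p)"
      using bdry_minus[OF wX zX] v_def by simp
    then have "bdry E l a (\<lambda>p. w p \<ominus> z p) = (\<lambda>_. \<zero>)" using minus_self_eq[OF v] by simp
    then show ?thesis using z(1) Suc by blast
  qed
  then obtain z where z: "z \<in> chains E' i a"
    "\<forall>l. i = Suc l \<longrightarrow> bdry E l a (\<lambda>p. w p \<ominus> z p) = (\<lambda>_. \<zero>)" by blast
  have zX: "z \<in> chains E i a" using z(1) chains_mono[OF E_sub(1)] by blast
  obtain y where y: "y \<in> chains E (Suc i) a" "(\<lambda>p. w p \<ominus> z p) = bdry E i a y"
    using 1 z(2) chains_minus[OF wX zX] unfolding acyclic_def by blast
  have "restr E'' i a z = (\<lambda>_. \<zero>)" using restr_zero_iff[OF zX] z(1) by simp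
  then have "restr E'' i a (\<lambda>p. w p \<ominus> z p) = w"
    unfolding restr_minus restr_id[OF w] using w by (auto simp: minus_eq fun_eq_iff chains_closed)
  then have "w = bdry E'' i a (restr E'' (Suc i) a y)"
    using restr_bdry[OF y(1)] y(2) by simp
  then show "w \<in> bdry E'' i a ` chains E'' (Suc i) a"
    using restr_closed[OF y(1) E_sub(2)] by blast
qed

text \<open>Exactness at the submodule. A chain that bounds \<open>w\<close> in the middle is a
  cycle in the quotient, and subtracting a boundary moves it into the submodule.\<close>

lemma acyclic_sub:
  assumes 1: "acyclic E i a" and 2: "acyclic E'' (Suc i) a"
  shows "acyclic E' i a"
  unfolding acyclic_def
proof (intro ballI impI)
  fix w assume w: "w \<in> chains E' i a" and cyc: "\<forall>l. i = Suc l \<longrightarrow> bdry E' l a w = (\<lambda>_. \<zero>)"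
  have wX: "w \<in> chains E i a" using w chains_mono[OF E_sub(1)] by blast
  have "\<forall>l. i = Suc l \<longrightarrow> bdry E l a w = (\<lambda>_. \<zero>)" using cyc bdry_sub w by metis
  then obtain y where y: "y \<in> chains E (Suc i) a" "w = bdry E i a y"
    using 1 wX unfolding acyclic_def by blast
  have "bdry E'' i a (restr E'' (Suc i) a y) = (\<lambda>_. \<zero>)"
    using restr_bdry[OF y(1)] y(2) restr_zero_iff[OF wX] w by simp
  then obtain z where z: "z \<in> chains E'' (Suc (Suc i)) a" "restr E'' (Suc i) a y = bdry E'' (Suc i) a z"
    using 2 restr_closed[OF y(1) E_sub(2)] unfolding acyclic_def by blast
  have zX: "z \<in> chains E (Suc (Suc i)) a" using z(1) chains_mono[OF E_sub(2)] by blast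
  define v where "v = (\<lambda>p. y p \<ominus> bdry E (Suc i) a z p)"
  have dz: "bdry E (Suc i) a z \<in> chains E (Suc i) a" using bdry_closed[OF zX] .
  have vX: "v \<in> chains E (Suc i) a" unfolding v_def using chains_minus[OF y(1) dz] .
  have "restr E'' (Suc i) a v = (\<lambda>_. \<zero>)"
    unfolding v_def restr_minus z(2) restr_bdry''[OF z(1)]
    using minus_self_eq chains_mono[OF E_sub(2)] bdry_closed[OF z(1), of E''] by blast
  then have v': "v \<in> chains E' (Suc i) a" using restr_zero_iff[OF vX] by simp
  have "bdry E' i a v = (\<lambda>p. bdry E i a y p \<ominus> bdry E i a (bdry E (Suc i) a z) p)"
    unfolding bdry_sub[OF v'] unfolding v_def by (rule bdry_minus[OF y(1) dz])
  then have "bdry E' i a v = w"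
    using bdry_bdry[OF zX] y(2) chains_closed[OF wX] by (simp add: minus_eq)
  then show "w \<in> bdry E' i a ` chains E' (Suc i) a" using v' by blast
qed

end

section \<open>Ideals, coordinate quotients and linear quotients as exponent sets\<close>

definition upset :: "nat \<Rightarrow> (nat \<Rightarrow> int) set \<Rightarrow> (nat \<Rightarrow> int) set" where
  "upset n C = {b \<in> natdegs n. \<exists>u\<in>C. \<forall>j. u j \<le> b j}"

lemma deg_convex_upset: "deg_convex n (upset n C)"
  unfolding deg_convex_def
proof (intro conjI ballI allI impI)
  fix x y z
  assume x: "x \<in> upset n C" and xz: "(\<lambda>j. z j - x j) \<in> natdegs n"
  obtain u where u: "u \<in> C" "\<And>j. u j \<le> x j" and xn: "x \<in> natdegs n" using x unfolding upset_def by blast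
  have le: "x j \<le> z j" for j using xz by (simp add: natdegs_iff)
  have "z \<in> natdegs n" using natdegs_add[OF xn xz] by simp
  moreover have "\<forall>j. u j \<le> z j" using u(2) le order_trans by blast
  ultimately show "z \<in> upset n C" using u(1) unfolding upset_def by blast
qed (auto simp: upset_def)

lemma deg_convex_coord: "deg_convex n {b \<in> natdegs n. \<forall>j\<in>T. b j = 0}"
  unfolding deg_convex_def
proof (intro conjI ballI allI impI)
  fix x y z
  assume x: "x \<in> {b \<in> natdegs n. \<forall>j\<in>T. b j = 0}" and y: "y \<in> {b \<in> natdegs n. \<forall>j\<in>T. b j = 0}"
    and xz: "(\<lambda>j. z j - x j) \<in> natdegs n" and zy: "(\<lambda>j. y j - z j) \<in> natdegs n"
  have "x j \<le> z j" "z j \<le> y j" for j using xz zy by (simp_all add: natdegs_iff)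
  then have "z j = 0" if "j \<in> T" for j using x y that by (metis (mono_tags, lifting) mem_Collect_eq order_antisym)
  moreover have "z \<in> natdegs n" using natdegs_add[of x n, OF _ xz] x by simp
  ultimately show "z \<in> {b \<in> natdegs n. \<forall>j\<in>T. b j = 0}" by simp
qed auto

context resolution
begin

text \<open>\<open>E\<close> is the translate of \<open>Y\<close> by \<open>u\<close>: the modules
  agree up to a shift of the grading, and so does their homology.\<close>

lemma acyclic_shift:
  assumes E: "\<And>d. d \<in> E \<longleftrightarrow> (\<lambda>j. d j - u j) \<in> Y"
  shows "acyclic E i a \<longleftrightarrow> acyclic Y i (\<lambda>j. a j - u j)"
proof -
  have "deg a i p \<in> E \<longleftrightarrow> deg (\<lambda>j. a j - u j) i p \<in> Y" for i p
    unfolding E by (simp add: deg_def algebra_simps)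
  then have "chains E i a = chains Y i (\<lambda>j. a j - u j)" "bdry E i a = bdry Y i (\<lambda>j. a j - u j)" for i
    unfolding chains_def bdry_def restr_def fun_eq_iff by simp_all
  then show ?thesis unfolding acyclic_def by simp
qed

lemma acyclic_empty: "acyclic {} i a"
proof -
  have "w = bdry {} i a (\<lambda>_. \<zero>)" if "w \<in> chains {} i a" for w
    using chains_zero[OF that] by (auto simp: bdry_def restr_def fun_eq_iff)
  then show ?thesis unfolding acyclic_def using zero_chains by blast
qed

text \<open>The Koszul answer: the i-th Tor of K and M = S/(x_j : j in T) is the i-th exterior power
  of the space with basis T. A new variable x_j gives 0 -> M(-e_j) -> M -> M/x_j M -> 0. Homology
  has coordinate 1 at \<open>j\<close> in the first term and 0 in the second, so nothing
  cancels.\<close>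

lemma acyclic_coord:
  assumes "finite T" "T \<subseteq> {1..n}"
  shows "acyclic {b \<in> natdegs n. \<forall>j\<in>T. b j = 0} i a \<longleftrightarrow>
    \<not> (\<exists>W\<subseteq>T. card W = i \<and> a = (\<lambda>k. of_bool (k \<in> W)))"
  using assms
proof (induction T arbitrary: i a)
  case empty
  then show ?case using acyclic_natdegs by auto
next
  case (insert j T)
  let ?X = "{b \<in> natdegs n. \<forall>j\<in>T. b j = 0}"
  let ?X1 = "{b \<in> natdegs n. (\<forall>j\<in>T. b j = 0) \<and> b j \<noteq> 0}"
  let ?X2 = "{b \<in> natdegs n. \<forall>j\<in>insert j T. b j = 0}"
  let ?a = "\<lambda>k. a k - of_bool (k = j)"
  have IH: "acyclic ?X i b \<longleftrightarrow> \<not> (\<exists>W\<subseteq>T. card W = i \<and> b = (\<lambda>k. of_bool (k \<in> W)))" for i b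
    using insert.IH insert.prems by simp
  have jn: "j \<in> {1..n}" using insert.prems by simp
  interpret subquotient K n F ?X ?X1 ?X2
  proof
    fix x y assume *: "x \<in> ?X1" "y \<in> ?X" "(\<lambda>j. y j - x j) \<in> natdegs n"
    then have "x j \<le> y j" "0 < x j" by (auto simp: natdegs_iff order_less_le)
    then show "y \<in> ?X1" using * by auto
  next
    show "deg_convex n ?X" by (rule deg_convex_coord)
    show "?X = ?X1 \<union> ?X2" by blast
    show "?X1 \<inter> ?X2 = {}" by blast
  qed
  have "d \<in> ?X1 \<longleftrightarrow> (\<lambda>k. d k - of_bool (k = j)) \<in> ?X" for d
  proof -
    have "0 \<le> d k \<Longrightarrow> k = j \<Longrightarrow> d k \<noteq> 0 \<longleftrightarrow> of_bool (k = j) \<le> d k" for k by auto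
    then show ?thesis using insert.hyps(2) jn
      by (auto simp: natdegs_iff of_bool_def split: if_splits)
  qed
  then have sub: "acyclic ?X1 i a \<longleftrightarrow> acyclic ?X i ?a" for i by (rule acyclic_shift)
  show ?case
  proof
    assume ac: "acyclic ?X2 i a"
    show "\<not> (\<exists>W\<subseteq>insert j T. card W = i \<and> a = (\<lambda>k. of_bool (k \<in> W)))"
    proof
      assume "\<exists>W\<subseteq>insert j T. card W = i \<and> a = (\<lambda>k. of_bool (k \<in> W))"
      then obtain W where W: "W \<subseteq> insert j T" "card W = i" "a = (\<lambda>k. of_bool (k \<in> W))" by blast
      show False
      proof (cases "j \<in> W")
        case True
        have fin: "finite W" using W(1) insert.hyps(1) finite_subset by blast
        have i: "i = Suc (card (W - {j}))" using W(2) card_Suc_Diff1[OF fin True] by metis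
        have "?a = (\<lambda>k. of_bool (k \<in> W - {j}))" using True by (auto simp: W(3) fun_eq_iff)
        moreover have "W - {j} \<subseteq> T" using W(1) by blast
        ultimately have "\<not> acyclic ?X1 (card (W - {j})) a" unfolding sub IH by blast
        moreover have "a \<noteq> (\<lambda>k. of_bool (k \<in> V))" if "V \<subseteq> T" for V
          using that insert.hyps(2) True W(3) by (auto simp: fun_eq_iff)
        then have "acyclic ?X (card (W - {j})) a" unfolding IH by blast
        ultimately show False using acyclic_sub ac unfolding i by blast
      next
        case False
        then have "\<not> acyclic ?X i a" unfolding IH using W by blast
        moreover have "?a \<noteq> (\<lambda>k. of_bool (k \<in> V))" for V
        proof
          assume "?a = (\<lambda>k. of_bool (k \<in> V))"
          from fun_cong[OF this, of j] show False using False by (simp add: W(3) of_bool_def split: if_splits)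
        qed
        then have "acyclic ?X1 i a" unfolding sub IH by blast
        ultimately show False using acyclic_middle ac by blast
      qed
    qed
  next
    assume no: "\<not> (\<exists>W\<subseteq>insert j T. card W = i \<and> a = (\<lambda>k. of_bool (k \<in> W)))"
    show "acyclic ?X2 i a"
    proof (rule acyclic_quotient)
      show "acyclic ?X i a" unfolding IH using no by blast
      fix l assume i: "i = Suc l"
      show "acyclic ?X1 l a"
        unfolding sub IH
      proof
        assume "\<exists>W\<subseteq>T. card W = l \<and> ?a = (\<lambda>k. of_bool (k \<in> W))"
        then obtain W where W: "W \<subseteq> T" "card W = l" "?a = (\<lambda>k. of_bool (k \<in> W))" by blast
        have jW: "j \<notin> W" using W(1) insert.hyps(2) by blast
        have "a k = of_bool (k \<in> insert j W)" for k
          using fun_cong[OF W(3), of k] jW by (cases "k = j") auto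
        moreover have "card (insert j W) = i"
          using W jW insert.hyps(1) i finite_subset by (subst card_insert_disjoint) auto
        moreover have "insert j W \<subseteq> insert j T" using W(1) by blast
        ultimately show False using no by blast
      qed
    qed
  qed
qed

text \<open>The elements of an M-convex set in lexicographically decreasing order have linear quotients.\<close>

lemma acyclic_lex_closed:
  assumes B: "nat_mconvex {1..n} B" "B \<subseteq> natdegs n"
    and C: "C \<subseteq> B" "\<And>u v. u \<in> C \<Longrightarrow> v \<in> B \<Longrightarrow> lex_less u v \<Longrightarrow> v \<in> C"
  shows "acyclic (upset n C) i a \<longleftrightarrow>
    \<not> (\<exists>u\<in>C. \<exists>W\<subseteq>lex_set B u. card W = i \<and> a = (\<lambda>k. u k + of_bool (k \<in> W)))"
  using C
proof (induction "card C" arbitrary: C i a)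
  interpret B: nat_mconvex "{1..n}" B by fact
  case 0
  then have "C = {}" using B.finite finite_subset by (metis card_0_eq)
  then show ?case using acyclic_empty by (simp add: upset_def)
next
  interpret B: nat_mconvex "{1..n}" B by fact
  case (Suc m)
  have finC: "finite C" using Suc.prems(1) B.finite finite_subset by blast
  have "C \<noteq> {}" using Suc.hyps(2) by auto
  \<comment> \<open>Removing the least element keeps \<open>C\<close> closed under passing to larger
    elements of \<open>B\<close>, so the induction hypothesis applies.\<close>
  then obtain u where u: "u \<in> C" "\<And>v. v \<in> C \<Longrightarrow> v \<noteq> u \<Longrightarrow> lex_less u v"
    using ex_lex_min[OF finC] by blast
  define C' where "C' = C - {u}"
  have C: "C = insert u C'" "u \<notin> C'" using u(1) by (auto simp: C'_def)
  have uB: "u \<in> B" using u(1) Suc.prems(1) by blast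
  have C'_closed: "v \<in> C'" if "w \<in> C'" "v \<in> B" "lex_less w v" for v w
    using that Suc.prems(2) u lex_less_trans lex_less_irrefl unfolding C'_def by (metis Diff_iff singletonD singletonI)
  have m: "m = card C'" using Suc.hyps(2) finC u(1) unfolding C'_def by simp
  have IH: "acyclic (upset n C') i a \<longleftrightarrow>
    \<not> (\<exists>u\<in>C'. \<exists>W\<subseteq>lex_set B u. card W = i \<and> a = (\<lambda>k. u k + of_bool (k \<in> W)))" for i a
    using Suc.hyps(1)[OF m, of i a] C'_closed Suc.prems(1) C by blast
  let ?Q = "upset n C - upset n C'"
  let ?X = "{b \<in> natdegs n. \<forall>j\<in>lex_set B u. b j = 0}"
  \<comment> \<open>The last quotient of the filtration is S/(x_j : j in
    \<open>lex_set B u\<close>), shifted by \<open>u\<close>. A degree with a surplus at such a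
    \<open>j\<close> is dominated by an exchanged, larger generator.\<close>
  have Q: "b \<in> ?Q \<longleftrightarrow> (\<lambda>j. b j - u j) \<in> ?X" for b
  proof
    assume b: "b \<in> ?Q"
    then have bn: "b \<in> natdegs n" and ub: "\<forall>j. u j \<le> b j" unfolding upset_def C(1) by auto
    have un: "u \<in> natdegs n" using uB B(2) by blast
    have "b j = u j" if j: "j \<in> lex_set B u" for j
    proof (rule ccontr)
      assume "b j \<noteq> u j"
      then have less: "u j < b j" using ub by (metis order_less_le)
      obtain l where l: "j < l" "exch u l j \<in> B" using j unfolding lex_set_def by blast
      have "lex_less u (exch u l j)" using lex_less_exch[OF l(1)] .
      then have "exch u l j \<in> C'"
        using Suc.prems(2)[OF u(1) l(2)] lex_less_irrefl unfolding C'_def by (metis Diff_iff singletonD)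
      moreover have "exch u l j k \<le> b k" for k
        using less spec[OF ub, of k] by (auto simp: exch_def of_bool_def)
      ultimately show False using b bn unfolding upset_def by blast
    qed
    moreover have "(\<lambda>j. b j - u j) \<in> natdegs n" using bn un ub by (simp add: natdegs_iff)
    ultimately show "(\<lambda>j. b j - u j) \<in> ?X" by simp
  next
    assume b: "(\<lambda>j. b j - u j) \<in> ?X"
    have un: "u \<in> natdegs n" using uB B(2) by blast
    have ub: "\<forall>j. u j \<le> b j" using b by (simp add: natdegs_iff)
    have "(\<lambda>j. b j - u j) \<in> natdegs n" using b by simp
    from natdegs_add[OF this un] have bn: "b \<in> natdegs n" by simp
    have "b \<notin> upset n C'"
    proof
      assume "b \<in> upset n C'"
      then obtain v where v: "v \<in> C'" "\<forall>j. v j \<le> b j" unfolding upset_def by blast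
      then have vB: "v \<in> B" and "lex_less u v" using u(2) Suc.prems(1) unfolding C'_def by auto
      then obtain j where j: "u j < v j" "\<forall>k<j. u k = v k" unfolding lex_less_def by blast
      obtain l where l: "v l < u l" "exch u l j \<in> B" using B.dual_exchange[OF uB vB j(1)] by blast
      \<comment> \<open>\<open>u\<close> and \<open>v\<close> agree before \<open>j\<close>, and
        \<open>v\<close> is larger at \<open>j\<close>.\<close>
      have "j < l" using l(1) j by (metis linorder_neqE_nat order_less_irrefl order_less_asym)
      then have "j \<in> lex_set B u" using l(2) unfolding lex_set_def by blast
      then have "b j = u j" using b by simp
      then show False using j(1) spec[OF v(2), of j] by simp
    qed
    then show "b \<in> ?Q" using bn ub unfolding upset_def C(1) by auto
  qed
  have quot: "acyclic ?Q i a \<longleftrightarrow>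
    \<not> (\<exists>W\<subseteq>lex_set B u. card W = i \<and> a = (\<lambda>k. u k + of_bool (k \<in> W)))" for i a
  proof -
    have "acyclic ?Q i a \<longleftrightarrow> \<not> (\<exists>W\<subseteq>lex_set B u. card W = i \<and> (\<lambda>j. a j - u j) = (\<lambda>k. of_bool (k \<in> W)))"
      using acyclic_shift[OF Q, of i a] acyclic_coord[of "lex_set B u" i] B.lex_set_subset[OF uB]
        finite_subset[of "lex_set B u" "{1..n}"] by simp
    moreover have "(\<lambda>j. a j - u j) = (\<lambda>k. of_bool (k \<in> W)) \<longleftrightarrow> a = (\<lambda>k. u k + of_bool (k \<in> W))" for W
      by (auto simp: fun_eq_iff algebra_simps)
    ultimately show ?thesis by simp
  qed
  have sub: "upset n C' \<subseteq> upset n C" unfolding C(1) upset_def by blast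
  interpret subquotient K n F "upset n C" "upset n C'" ?Q
  proof
    fix x y assume x: "x \<in> upset n C'" and y: "y \<in> upset n C" and xy: "(\<lambda>j. y j - x j) \<in> natdegs n"
    obtain v where "v \<in> C'" "\<forall>j. v j \<le> x j" using x unfolding upset_def by blast
    moreover have "\<forall>j. x j \<le> y j" using xy by (simp add: natdegs_iff)
    ultimately have "v \<in> C' \<and> (\<forall>j. v j \<le> y j)" by (meson order_trans)
    then show "y \<in> upset n C'" using y unfolding upset_def by blast
  qed (use sub deg_convex_upset in auto)
  \<comment> \<open>The homology of the submodule and of the quotient sits in total degree rank plus
    \<open>i\<close>. Adjacent homological degrees thus never share a multidegree, and no class is
    lost in the long exact sequence.\<close>
  have degree: "sum a {1..n} = rank_fun B {1..n} + int i"
    if "v \<in> B" "W \<subseteq> lex_set B v" "card W = i" "a = (\<lambda>k. v k + of_bool (k \<in> W))" for v W i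
  proof -
    have "{1..n} \<inter> W = W" using B.lex_set_subset[OF that(1)] that(2) by blast
    then show ?thesis
      using sum_add_indicator[of "{1..n}" v W] B.rank_ground[OF that(1)] that(3,4) by simp
  qed
  have sub_degree: "sum a {1..n} = rank_fun B {1..n} + int i" if "\<not> acyclic (upset n C') i a" for i
    using that degree Suc.prems(1) C(1) unfolding IH by blast
  have quot_degree: "sum a {1..n} = rank_fun B {1..n} + int i" if "\<not> acyclic ?Q i a" for i
    using that degree uB unfolding quot by blast
  have "acyclic (upset n C) i a \<longleftrightarrow> acyclic (upset n C') i a \<and> acyclic ?Q i a"
  proof
    assume ac: "acyclic (upset n C) i a"
    show "acyclic (upset n C') i a \<and> acyclic ?Q i a"
    proof (intro conjI; rule ccontr)
      assume no: "\<not> acyclic (upset n C') i a"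
      then have "acyclic ?Q (Suc i) a" using sub_degree[OF no] quot_degree[of "Suc i"] by force
      then show False using acyclic_sub ac no by blast
    next
      assume no: "\<not> acyclic ?Q i a"
      have "acyclic (upset n C') l a" if "i = Suc l" for l
        using quot_degree[OF no] sub_degree[of l] that by force
      then show False using acyclic_quotient ac no by blast
    qed
  qed (use acyclic_middle in blast)
  then show ?case unfolding IH quot unfolding C(1) by (simp only: bex_simps de_Morgan_disj conj_commute)
qed

lemma acyclic_upset:
  assumes "nat_mconvex {1..n} B" "B \<subseteq> natdegs n"
  shows "acyclic (upset n B) i a \<longleftrightarrow> a \<notin> hom_shift B i"
  using acyclic_lex_closed[OF assms order_refl] unfolding hom_shift_def by blast

end

section \<open>Comparison with the tensor complexes that define Tor\<close>

context resolution
begin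

lemma mdeg_image_upset:
  assumes "A \<subseteq> monomials n"
  shows "m \<in> monomials n \<Longrightarrow> mdeg m \<in> upset n (mdeg ` A) \<longleftrightarrow> (\<exists>a\<in>A. a \<subseteq># m)"
  unfolding upset_def by (auto simp: natdegs_def subseteq_mset_iff_mdeg)

text \<open>A homogeneous coordinate is a single term, so a vector of multidegree \<open>a\<close>
  amounts to one scalar per basis element, nonzero only where the remaining degree is divisible by a
  generator.\<close>

lemma tensor_piece_span:
  assumes A: "A \<subseteq> monomials n"
  shows "tensor_piece K F (span A) i a = lift i a ` chains (upset n (mdeg ` A)) i a"
proof
  let ?E = "upset n (mdeg ` A)"
  have En: "?E \<subseteq> natdegs n" by (auto simp: upset_def)
  show "tensor_piece K F (span A) i a \<subseteq> lift i a ` chains ?E i a"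
  proof
    fix v assume v: "v \<in> tensor_piece K F (span A) i a"
    have vs: "v p \<in> span A" and vh: "homogeneous K (deg a i p) (v p)" if "p < rnk F i" for p
      using v that by (auto simp: tensor_piece_def deg_def)
    have vR: "v p \<in> carrier R" if "p < rnk F i" for p using vs[OF that] mem_span[OF A] by blast
    have fm: "v \<in> free_mod K n F i"
      using v vR unfolding tensor_piece_def free_mod_def by (auto simp: PiE_iff)
    have ch: "component i a v \<in> chains ?E i a"
    proof (rule chainsI)
      fix p
      show "component i a v p \<in> carrier K" using component_chains[OF fm] by (rule chains_closed)
      show "component i a v p = \<zero>" if "\<not> p < rnk F i" using that by (simp add: component_def)
      assume p: "p < rnk F i" and d: "deg a i p \<notin> ?E"
      show "component i a v p = \<zero>"
      proof (rule ccontr)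
        assume "component i a v p \<noteq> \<zero>"
        then have dn: "deg a i p \<in> natdegs n" and nz: "v p (mset_of_deg (deg a i p)) \<noteq> \<zero>"
          using p by (auto simp: component_def coef_def split: if_splits)
        have "\<exists>b\<in>A. b \<subseteq># mset_of_deg (deg a i p)"
          using vs[OF p] nz mem_span[OF A] by blast
        then show False
          using d mdeg_image_upset[OF A mset_of_deg_monomials[OF dn]] mdeg_mset_of_deg[OF dn] by simp
      qed
    qed
    have "v = lift i a (component i a v)"
    proof
      fix p
      show "v p = lift i a (component i a v) p"
      proof (cases "p < rnk F i")
        case True
        have "v p m = (if mdeg m = deg a i p then component i a v p else \<zero>)" for m
        proof (cases "v p m = \<zero>")
          case False
          then have md: "mdeg m = deg a i p" "m \<in> monomials n"
            using vh[OF True] R_monomials[OF vR[OF True]] unfolding homogeneous_def by auto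
          have "mset_of_deg (deg a i p) = m" unfolding md(1)[symmetric] by simp
          moreover have "deg a i p \<in> natdegs n" unfolding md(1)[symmetric] natdegs_def using md(2) by blast
          ultimately show ?thesis using md True by (simp add: component_def coef_def)
        next
          case zero: True
          have "component i a v p = \<zero>" if "mdeg m = deg a i p"
          proof -
            have "mset_of_deg (deg a i p) = m" using that mset_of_deg_mdeg by metis
            then show ?thesis using zero by (simp add: component_def coef_def)
          qed
          then show ?thesis using zero by simp
        qed
        then show ?thesis using True by (auto simp: lift_def)
      next
        case False
        then have "p \<notin> {..<rnk F i}" by simp
        then show ?thesis
          using PiE_arb[of v "{..<rnk F i}"] fm unfolding free_mod_def by (auto simp: lift_def)
      qed
    qed
    then show "v \<in> lift i a ` chains ?E i a" using ch by blast
  qed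
  show "lift i a ` chains ?E i a \<subseteq> tensor_piece K F (span A) i a"
  proof
    fix v assume "v \<in> lift i a ` chains ?E i a"
    then obtain w where w: "w \<in> chains ?E i a" "v = lift i a w" by blast
    have fm: "v \<in> free_mod K n F i" unfolding w(2) using lift_closed w(1) chains_mono[OF En] by blast
    have "v p \<in> span A \<and> homogeneous K (deg a i p) (v p)" if p: "p < rnk F i" for p
    proof -
      have nz: "mdeg m = deg a i p \<and> w p \<noteq> \<zero>" if "v p m \<noteq> \<zero>" for m
        using that p by (auto simp: w(2) lift_def split: if_splits)
      have vR: "v p \<in> carrier R" using free_mod_closed[OF fm p] .
      have "\<exists>b\<in>A. b \<subseteq># m" if m: "v p m \<noteq> \<zero>" for m
        using nz[OF m] chains_zero[OF w(1), of p] mdeg_image_upset[OF A R_monomials[OF vR m]] by metis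
      then show ?thesis using nz vR mem_span[OF A] unfolding homogeneous_def by blast
    qed
    then show "v \<in> tensor_piece K F (span A) i a"
      using fm unfolding tensor_piece_def free_mod_def by (auto simp: deg_def PiE_iff)
  qed
qed

text \<open>An ideal is closed under multiplication, so truncating the differential to its exponents
  discards nothing.\<close>

lemma bdry_upset:
  assumes "w \<in> chains (upset n C) (Suc i) a"
  shows "bdry (upset n C) i a w = D i w"
proof
  fix p
  have "deg a i p \<in> upset n C" if nz: "D i w p \<noteq> \<zero>"
  proof -
    obtain q where q: "deg a (Suc i) q \<in> upset n C" "(\<lambda>j. deg a i p j - deg a (Suc i) q j) \<in> natdegs n"
      using D_nonzero[OF assms nz] by metis
    then obtain u where u: "u \<in> C" "\<forall>j. u j \<le> deg a (Suc i) q j" "deg a (Suc i) q \<in> natdegs n"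
      unfolding upset_def by blast
    have "deg a i p \<in> natdegs n" using natdegs_add[OF u(3) q(2)] by simp
    moreover have "u j \<le> deg a i p j" for j
      using spec[OF u(2), of j] q(2) by (simp add: natdegs_iff) (metis order_trans)
    ultimately show ?thesis using u(1) unfolding upset_def by blast
  qed
  then show "bdry (upset n C) i a w p = D i w p"
    by (cases "D i w p = \<zero>") (auto simp: bdry_def restr_def)
qed

text \<open>\<open>lift\<close> is injective and commutes with the differentials, so cycles and
  boundaries can be compared on scalars. As boundaries are cycles, inequality of the two sets is
  exactly failure of \<open>acyclic\<close>.\<close>

lemma homology_span:
  assumes A: "A \<subseteq> monomials n"
  shows "tensor_cycles K n F (span A) i a \<noteq> tensor_boundaries K n F (span A) i a \<longleftrightarrow>
    \<not> acyclic (upset n (mdeg ` A)) i a"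
proof -
  let ?E = "upset n (mdeg ` A)"
  have En: "?E \<subseteq> natdegs n" by (auto simp: upset_def)
  have nat: "w \<in> chains (natdegs n) i a" if "w \<in> chains ?E i a" for w i
    using that chains_mono[OF En] by blast
  let ?Z = "{w \<in> chains ?E i a. \<forall>l. i = Suc l \<longrightarrow> bdry ?E l a w = (\<lambda>_. \<zero>)}"
  let ?B = "bdry ?E i a ` chains ?E (Suc i) a"
  have cyc: "bd K n F l (lift (Suc l) a w) = zero_vec K n F l \<longleftrightarrow> bdry ?E l a w = (\<lambda>_. \<zero>)"
    if w: "w \<in> chains ?E (Suc l) a" for w l
    unfolding bd_lift[OF nat[OF w]] zero_vec_eq[of l a]
      lift_inject[OF D_chains[OF nat[OF w]] zero_chains] bdry_upset[OF w] ..
  have Z: "tensor_cycles K n F (span A) i a = lift i a ` ?Z"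
  proof (cases i)
    case 0
    then show ?thesis by (simp add: tensor_cycles_def tensor_piece_span[OF A])
  next
    case (Suc l)
    then show ?thesis using cyc[of _ l] by (auto simp: tensor_cycles_def tensor_piece_span[OF A])
  qed
  have "bd K n F i (lift (Suc i) a w) = lift i a (bdry ?E i a w)" if w: "w \<in> chains ?E (Suc i) a" for w
    unfolding bd_lift[OF nat[OF w]] bdry_upset[OF w] ..
  then have B: "tensor_boundaries K n F (span A) i a = lift i a ` ?B"
    unfolding tensor_boundaries_def tensor_piece_span[OF A] image_image by (rule image_cong[OF refl])
  have "?B \<subseteq> ?Z"
  proof
    fix v assume "v \<in> ?B"
    then obtain w where w: "w \<in> chains ?E (Suc i) a" "v = bdry ?E i a w" by blast
    have v: "v \<in> chains ?E i a" unfolding w(2) using bdry_closed[OF w(1)] .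
    have "bdry ?E l a v = (\<lambda>_. \<zero>)" if l: "i = Suc l" for l
    proof -
      have "bdry ?E l a v = D l (D (Suc l) w)"
        using bdry_upset[of v _ l a] v w bdry_upset[of w _ "Suc l" a] l by simp
      then show ?thesis using D_D[of w l a] nat w(1) l by (auto simp: fun_eq_iff)
    qed
    then show "v \<in> ?Z" using v by blast
  qed
  moreover have "inj_on (lift i a) ?Z" using lift_inject nat by (auto intro!: inj_onI)
  ultimately have "lift i a ` ?Z = lift i a ` ?B \<longleftrightarrow> ?Z = ?B"
    by (intro inj_on_image_eq_iff[of _ ?Z]) auto
  also have "\<dots> \<longleftrightarrow> acyclic ?E i a" using \<open>?B \<subseteq> ?Z\<close> unfolding acyclic_def by blast
  finally show ?thesis unfolding Z B by blast
qed

text \<open>The combinatorial criterion does not mention the resolution. It holds for every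
  \<open>G\<close>, so the existential quantifier in \<open>Tor_nonzero\<close> is witnessed by the
  fixed \<open>F\<close>.\<close>

lemma Tor_nonzero_span:
  assumes A: "A \<subseteq> monomials n" and M: "nat_mconvex {1..n} (mdeg ` A)"
  shows "Tor_nonzero K n i (span A) a \<longleftrightarrow> a \<in> hom_shift (mdeg ` A) i"
proof -
  have sub: "mdeg ` A \<subseteq> natdegs n" using A by (auto simp: natdegs_def)
  have "tensor_cycles K n G (span A) i a \<noteq> tensor_boundaries K n G (span A) i a \<longleftrightarrow> a \<in> hom_shift (mdeg ` A) i"
    if "graded_free_resolution K n G" for G
  proof -
    interpret G: resolution K n G by unfold_locales (rule that)
    show ?thesis using G.homology_span[OF A] G.acyclic_upset[OF M sub] by simp
  qed
  then show ?thesis unfolding Tor_nonzero_def using resolution by blast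
qed

end

section \<open>Polymatroidal ideals\<close>

lemma mdeg_exch: "i \<in># u \<Longrightarrow> mdeg (add_mset j (u - {#i#})) = exch (mdeg u) i j"
  by (auto simp: mdeg_def exch_def fun_eq_iff)

lemma sum_mdeg: "u \<in> monomials n \<Longrightarrow> sum (mdeg u) {1..n} = int (size u)"
proof -
  assume "u \<in> monomials n"
  then have "sum (count u) {1..n} = sum (count u) (set_mset u)"
    by (intro sum.mono_neutral_right) (auto simp: monomials_def not_in_iff)
  then show ?thesis by (simp add: mdeg_def size_multiset_overloaded_eq flip: of_nat_sum)
qed

lemma mdeg_mset_sum:
  "mdeg ` mset_sum A B = {\<lambda>k. x k + y k |x y. x \<in> mdeg ` A \<and> y \<in> mdeg ` B}"
proof (intro equalityI subsetI)
  fix z assume "z \<in> mdeg ` mset_sum A B"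
  then obtain a b where "a \<in> A" "b \<in> B" "z = mdeg (a + b)" unfolding mset_sum_def by blast
  then show "z \<in> {\<lambda>k. x k + y k |x y. x \<in> mdeg ` A \<and> y \<in> mdeg ` B}"
    unfolding mdeg_add by blast
next
  fix z assume "z \<in> {\<lambda>k. x k + y k |x y. x \<in> mdeg ` A \<and> y \<in> mdeg ` B}"
  then obtain a b where "a \<in> A" "b \<in> B" "z = mdeg (a + b)" unfolding mdeg_add by blast
  then show "z \<in> mdeg ` mset_sum A B" unfolding mset_sum_def by blast
qed

lemma finite_mset_of_size:
  assumes "finite V"
  shows "finite {u. set_mset u \<subseteq> V \<and> size u = k}"
proof (induction k)
  case (Suc k)
  have "{u. set_mset u \<subseteq> V \<and> size u = Suc k} \<subseteq> (\<lambda>(x, u). add_mset x u) ` (V \<times> {u. set_mset u \<subseteq> V \<and> size u = k})"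
  proof
    fix u assume u: "u \<in> {u. set_mset u \<subseteq> V \<and> size u = Suc k}"
    then obtain x v where "u = add_mset x v" by (metis (mono_tags, lifting) mem_Collect_eq size_eq_Suc_imp_eq_union add_mset_add_single)
    then show "u \<in> (\<lambda>(x, u). add_mset x u) ` (V \<times> {u. set_mset u \<subseteq> V \<and> size u = k})"
      using u by (intro image_eqI[of _ _ "(x, v)"]) auto
  qed
  then show ?case by (rule finite_subset) (use Suc assms in simp)
qed (simp add: conj_commute cong: conj_cong)

locale polymatroid = mpoly K n for K (structure) and n +
  fixes I :: "(nat multiset \<Rightarrow> 'a) set"
  assumes polymatroidal: "polymatroidal K n I"
begin

definition "B = mingens K n I"

lemma B_monomials: "B \<subseteq> monomials n" and span_B: "span B = I"
  using mingens_span polymatroidal unfolding polymatroidal_def B_def by blast+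

lemma B_nonempty: "B \<noteq> {}"
proof
  assume B: "B = {}"
  have "I \<subseteq> {\<zero>\<^bsub>R\<^esub>}"
  proof
    fix f assume "f \<in> I"
    then have "f \<in> span {}" using span_B B by simp
    then show "f \<in> {\<zero>\<^bsub>R\<^esub>}" by (auto simp: mem_span R_zero)
  qed
  moreover have "\<zero>\<^bsub>R\<^esub> \<in> span B"
    unfolding mem_span[OF B_monomials] using R.zero_closed unfolding R_zero by simp
  then have "\<zero>\<^bsub>R\<^esub> \<in> I" using span_B by simp
  ultimately show False using polymatroidal unfolding polymatroidal_def by blast
qed

lemma B_size: "u \<in> B \<Longrightarrow> v \<in> B \<Longrightarrow> size u = size v"
  using polymatroidal unfolding polymatroidal_def B_def by blast

lemma mconvex_B: "mconvex {1..n} (mdeg ` B)"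
proof
  fix x y i assume "x \<in> mdeg ` B" "y \<in> mdeg ` B" "y i < x i"
  then obtain u v where uv: "u \<in> B" "v \<in> B" "x = mdeg u" "y = mdeg v" by blast
  have less: "count v i < count u i" using uv \<open>y i < x i\<close> by (simp add: mdeg_def)
  then have "i \<in># u" by (metis count_greater_zero_iff gr_zeroI not_less_zero)
  moreover have "i \<in> {1..n}" using \<open>i \<in># u\<close> uv(1) B_monomials unfolding monomials_def by blast
  ultimately obtain j where "count u j < count v j" "add_mset j (u - {#i#}) \<in> B"
    using polymatroidal uv less unfolding polymatroidal_def B_def by blast
  then show "\<exists>j. x j < y j \<and> exch x i j \<in> mdeg ` B"
  proof (intro exI[of _ j] conjI)
    show "exch x i j \<in> mdeg ` B"
      using mdeg_exch[OF \<open>i \<in># u\<close>, of j] \<open>add_mset j (u - {#i#}) \<in> B\<close> uv(3) by (metis image_eqI)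
  qed (use uv \<open>count u j < count v j\<close> in \<open>simp add: mdeg_def\<close>)
next
  fix x y assume "x \<in> mdeg ` B" "y \<in> mdeg ` B"
  then obtain u v where uv: "u \<in> B" "v \<in> B" "x = mdeg u" "y = mdeg v" by blast
  then have "sum x {1..n} = int (size u)" "sum y {1..n} = int (size v)"
    using sum_mdeg B_monomials by blast+
  then show "sum x {1..n} = sum y {1..n}" using B_size[OF uv(1,2)] by simp
next
  fix x j assume "x \<in> mdeg ` B" "j \<notin> {1..n}"
  then show "x j = 0" using B_monomials by (auto simp: mdeg_def monomials_iff subset_eq)
qed simp

abbreviation "P \<equiv> mset_pow B"

lemma P_monomials: "P k \<subseteq> monomials n"
  by (rule mset_pow_monomials[OF B_monomials])

lemma ideal_pow_I: "ideal_pow R I k = span (P k)"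
  using ideal_pow_span[OF B_monomials] span_B by simp

lemma mconvex_P: "mconvex {1..n} (mdeg ` P k)"
proof (induction k)
  case 0
  show ?case by unfold_locales (auto simp: mdeg_def)
next
  case (Suc k)
  then show ?case using mconvex_minkowski[OF _ mconvex_B] by (simp add: mdeg_mset_sum)
qed

lemma P_size: "u \<in> P k \<Longrightarrow> v \<in> P k \<Longrightarrow> size u = size v"
proof (induction k arbitrary: u v)
  case (Suc k)
  obtain a b where "u = a + b" "a \<in> P k" "b \<in> B" using Suc.prems(1) unfolding mset_pow.simps mset_sum_def by blast
  moreover obtain c d where "v = c + d" "c \<in> P k" "d \<in> B" using Suc.prems(2) unfolding mset_pow.simps mset_sum_def by blast
  ultimately show ?case using Suc.IH[of a c] B_size[of b d] by simp
qed simp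

lemma finite_P: "finite (P k)"
proof (cases "P k = {}")
  case False
  then obtain u where u: "u \<in> P k" by blast
  have "P k \<subseteq> {v. set_mset v \<subseteq> {1..n} \<and> size v = size u}"
  proof
    fix v assume v: "v \<in> P k"
    then have "set_mset v \<subseteq> {1..n}" using P_monomials unfolding monomials_def by blast
    then show "v \<in> {v. set_mset v \<subseteq> {1..n} \<and> size v = size u}" using P_size[OF v u] by simp
  qed
  then show ?thesis by (rule finite_subset) (simp add: finite_mset_of_size)
qed simp

lemma P_nonempty: "P k \<noteq> {}"
  by (induction k) (use B_nonempty in \<open>auto simp: mset_sum_def\<close>)

lemma nat_mconvex_P: "nat_mconvex {1..n} (mdeg ` P k)"
  using mconvex_P finite_P P_nonempty
  by (simp add: nat_mconvex_def finite_mconvex_def finite_mconvex_axioms_def)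

text \<open>Empty if \<open>K\<close> had no graded free resolution, whose existence is therefore not needed.\<close>

definition shift_gens :: "nat \<Rightarrow> nat \<Rightarrow> nat multiset set" where
  "shift_gens i k = {u \<in> monomials n. Tor_nonzero K n i (ideal_pow R I k) (mdeg u)}"

lemma shift_gens_monomials: "shift_gens i k \<subseteq> monomials n"
  by (simp add: shift_gens_def)

lemma HS_eq: "HS K n i (ideal_pow R I k) = span (shift_gens i k)"
  by (simp add: HS_def shift_gens_def)

text \<open>With a resolution at hand the generators are \<open>hom_shift\<close> of the generators
  of the power, all of whose elements are exponents of monomials; without one there are no
  generators.\<close>

lemma mconvex_shift_gens: "mconvex {1..n} (mdeg ` shift_gens i k)"
proof (cases "\<exists>F. graded_free_resolution K n F")
  case True
  then obtain F where F: "graded_free_resolution K n F" by blast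
  interpret resolution K n F by unfold_locales (rule F)
  interpret Q: nat_mconvex "{1..n}" "mdeg ` P k" by (rule nat_mconvex_P)
  have "hom_shift (mdeg ` P k) i \<subseteq> natdegs n"
  proof
    fix a assume "a \<in> hom_shift (mdeg ` P k) i"
    then obtain x W where a: "a = (\<lambda>k. x k + of_bool (k \<in> W))" and x: "x \<in> mdeg ` P k"
      and W: "W \<subseteq> lex_set (mdeg ` P k) x" unfolding hom_shift_def by blast
    have "W \<subseteq> {1..n}" using W Q.lex_set_subset[OF x] by blast
    then have "(\<lambda>k. of_bool (k \<in> W)) \<in> natdegs n" by (auto simp: natdegs_iff)
    moreover have "x \<in> natdegs n" using x P_monomials by (auto simp: natdegs_def)
    ultimately show "a \<in> natdegs n" unfolding a using natdegs_add by blast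
  qed
  then have "mdeg ` shift_gens i k = hom_shift (mdeg ` P k) i"
    unfolding shift_gens_def ideal_pow_I Tor_nonzero_span[OF P_monomials nat_mconvex_P] natdegs_def by blast
  then show ?thesis using Q.mconvex_hom_shift by simp
next
  case False
  then have "shift_gens i k = {}" by (auto simp: shift_gens_def Tor_nonzero_def)
  then show ?thesis by unfold_locales auto
qed

text \<open>The cancellation \<open>(I J : I) = J\<close> for \<open>J = HS\<^sub>i(I\<^sup>k)\<close>.\<close>

lemma shift_gens_cancel:
  assumes c: "\<And>b. b \<in> B \<Longrightarrow> \<exists>g\<in>mset_sum B (shift_gens i k). g \<subseteq># c + b"
  shows "\<exists>a\<in>shift_gens i k. a \<subseteq># c"
proof -
  interpret M: mconvex "{1..n}" "mdeg ` shift_gens i k" by (rule mconvex_shift_gens)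
  have "\<exists>x\<in>mdeg ` shift_gens i k. sum x S \<le> sum (mdeg c) S" if "S \<subseteq> {1..n}" for S
  proof -
    obtain b0 where "b0 \<in> B" using B_nonempty by blast
    \<comment> \<open>For a given \<open>S\<close> the hypothesis is used at a generator
      \<open>b\<close> with the least sum over \<open>S\<close>. The factor \<open>b'\<close> of the
      divisor \<open>g\<close> has at least that sum, so the excess cannot be hidden in
      \<open>b'\<close> and the sum of \<open>a\<close> over \<open>S\<close> is at most that of
      \<open>c\<close>.\<close>
    then obtain b where b: "b \<in> B" and mini: "\<And>b'. b' \<in> B \<Longrightarrow> sum (count b) S \<le> sum (count b') S"
      using ex_has_least_nat[of "\<lambda>b. b \<in> B" b0 "\<lambda>b. sum (count b) S"] by blast
    obtain g where "g \<in> mset_sum B (shift_gens i k)" "g \<subseteq># c + b" using c[OF b] by blast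
    then obtain b' a where g: "b' \<in> B" "a \<in> shift_gens i k" "b' + a \<subseteq># c + b"
      unfolding mset_sum_def by blast
    have "count b' j + count a j \<le> count c j + count b j" for j
      using g(3) unfolding subseteq_mset_def by simp
    then have "sum (count b') S + sum (count a) S \<le> sum (count c) S + sum (count b) S"
      unfolding sum.distrib[symmetric] by (rule sum_mono)
    then have "sum (count a) S \<le> sum (count c) S" using mini[OF g(1)] by linarith
    then have "sum (mdeg a) S \<le> sum (mdeg c) S" by (simp add: mdeg_def flip: of_nat_sum)
    then show ?thesis using g(2) by blast
  qed
  from M.dominates[OF this] obtain a where a: "a \<in> shift_gens i k" "\<forall>j\<in>{1..n}. mdeg a j \<le> mdeg c j"
    by blast
  have "mdeg a j \<le> mdeg c j" for j
  proof (cases "j \<in> {1..n}")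
    case False
    then have "mdeg a j = 0" using M.support a(1) by blast
    then show ?thesis by (simp add: mdeg_def)
  qed (use a(2) in blast)
  then show ?thesis using a(1) unfolding subseteq_mset_iff_mdeg by blast
qed

end

section \<open>The module over the Rees algebra\<close>

lemma (in ideal) finsum_mem:
  assumes "finite A" "\<And>x. x \<in> A \<Longrightarrow> f x \<in> I"
  shows "finsum R f A \<in> I"
  using assms
proof (induction A)
  case (insert x A)
  then have "finsum R f (insert x A) = f x \<oplus> finsum R f A"
    using Icarr by (intro finsum_insert) auto
  then show ?case using insert a_closed by simp
qed (simp add: zero_closed)

text \<open>Otherwise each \<open>Q b\<close> contributes an element outside the prime, and their
  product lies in all \<open>Q b\<close> but not in the prime. Intersecting with the carrier gives
  the premise its proper meaning for empty \<open>A\<close>.\<close>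

lemma (in primeideal) ex_subset_of_Inter_subset:
  assumes "finite A" and Q: "\<And>b. b \<in> A \<Longrightarrow> ideal (Q b) R"
    and sub: "carrier R \<inter> (\<Inter>b\<in>A. Q b) \<subseteq> I"
  shows "\<exists>b\<in>A. Q b \<subseteq> I"
proof (rule ccontr)
  assume no: "\<not> ?thesis"
  have "\<exists>r\<in>carrier R - I. \<forall>b\<in>C. r \<in> Q b" if "C \<subseteq> A" for C
    using finite_subset[OF that \<open>finite A\<close>] that
  proof (induction C)
    case empty
    have "\<one> \<notin> I" using I_notcarr one_imp_carrier by blast
    then show ?case by blast
  next
    case (insert b C)
    then obtain r where r: "r \<in> carrier R - I" "\<forall>b\<in>C. r \<in> Q b" by blast
    obtain s where s: "s \<in> Q b" "s \<notin> I" using no insert.prems by blast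
    have sc: "s \<in> carrier R" using ideal.Icarr[OF Q s(1)] insert.prems by blast
    have "r \<otimes> s \<in> carrier R - I" using r(1) s(2) sc I_prime by blast
    moreover have "r \<otimes> s \<in> Q c" if "c \<in> insert b C" for c
    proof (cases "c = b")
      case True
      then show ?thesis using ideal.I_l_closed[OF Q s(1)] r(1) insert.prems by blast
    next
      case False
      then have "c \<in> C" "c \<in> A" using that insert.prems by auto
      then show ?thesis using ideal.I_r_closed[OF Q[OF \<open>c \<in> A\<close>]] r(2) sc by blast
    qed
    ultimately show ?case by blast
  qed
  then show False using sub by blast
qed

context polymatroid
begin

abbreviation "UPR \<equiv> UP R"

definition monom_in_degree :: "nat multiset \<Rightarrow> nat \<Rightarrow> nat \<Rightarrow> nat multiset \<Rightarrow> 'a" where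
  "monom_in_degree u k = (\<lambda>l. if l = k then monom_poly K u else \<zero>\<^bsub>R\<^esub>)"

lemma monom_in_degree_up: "u \<in> monomials n \<Longrightarrow> monom_in_degree u k \<in> up R"
proof
  fix l assume "u \<in> monomials n"
  then show "monom_in_degree u k l \<in> carrier R" by (simp add: monom_in_degree_def monom_poly_closed)
next
  show "\<exists>m. bound \<zero>\<^bsub>R\<^esub> m (monom_in_degree u k)"
    by (intro exI[of _ k]) (auto simp: monom_in_degree_def)
qed

lemma UPR_mult: "f \<in> up R \<Longrightarrow> g \<in> up R \<Longrightarrow>
    (f \<otimes>\<^bsub>UPR\<^esub> g) m = (\<Oplus>\<^bsub>R\<^esub>j\<in>{..m}. f j \<otimes>\<^bsub>R\<^esub> g (m - j))"
  by (simp add: UP_def)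

lemma carrier_rees: "carrier (rees_algebra R I) = {f \<in> up R. \<forall>k. f k \<in> span (P k)}"
  by (simp add: rees_algebra_def ideal_pow_I) (simp add: UP_def)

lemma carrier_HS_rees: "carrier (HS_rees K n i I) =
    {f \<in> up R. f 0 = \<zero>\<^bsub>R\<^esub> \<and> (\<forall>k\<ge>1. f k \<in> span (shift_gens i k))}"
  by (simp add: HS_rees_def HS_eq) (simp add: UP_def)

lemma HS_rees_simps:
  "\<zero>\<^bsub>HS_rees K n i I\<^esub> = (\<lambda>_. \<zero>\<^bsub>R\<^esub>)"
  "f \<in> up R \<Longrightarrow> g \<in> up R \<Longrightarrow> f \<oplus>\<^bsub>HS_rees K n i I\<^esub> g = (\<lambda>k. f k \<oplus>\<^bsub>R\<^esub> g k)"
  "r \<odot>\<^bsub>HS_rees K n i I\<^esub> f = r \<otimes>\<^bsub>UPR\<^esub> f"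
  by (simp_all add: HS_rees_def UP_def)

lemma zero_in_span: "A \<subseteq> monomials n \<Longrightarrow> \<zero>\<^bsub>R\<^esub> \<in> span A"
  using ideal_span[THEN ideal.axioms(1)] additive_subgroup.zero_closed by blast

lemma monom_in_degree_HS_rees:
  assumes "g \<in> shift_gens i k" "k \<ge> 1"
  shows "monom_in_degree g k \<in> carrier (HS_rees K n i I)"
proof -
  have g: "g \<in> monomials n" using assms(1) shift_gens_monomials by blast
  have "monom_poly K g \<in> span (shift_gens i k)"
    unfolding monom_poly_in_span[OF shift_gens_monomials g] using assms(1) by blast
  then show ?thesis
    unfolding carrier_HS_rees
    using monom_in_degree_up[OF g] assms(2) zero_in_span[OF shift_gens_monomials]
    by (simp add: monom_in_degree_def)
qed

context
  fixes i :: nat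
  assumes gen: "generated_in_degrees_le (rees_algebra R I) (HS_rees K n i I) \<zero>\<^bsub>R\<^esub> i"
begin

abbreviation "M \<equiv> HS_rees K n i I"
abbreviation "G \<equiv> shift_gens i"

text \<open>Assertion (A) as an induction principle: a property that cuts out a submodule and holds
  for homogeneous elements of degree at most \<open>i\<close> holds throughout.\<close>

lemma carrier_subset_submodule:
  assumes "submodule N (rees_algebra R I) M"
    "{f \<in> carrier M. \<exists>k\<le>i. \<forall>l. l \<noteq> k \<longrightarrow> f l = \<zero>\<^bsub>R\<^esub>} \<subseteq> N"
  shows "carrier M \<subseteq> N"
proof -
  have "generated_submodule (rees_algebra R I) M {f \<in> carrier M. \<exists>k\<le>i. \<forall>l. l \<noteq> k \<longrightarrow> f l = \<zero>\<^bsub>R\<^esub>} \<subseteq> N"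
    unfolding generated_submodule_def using assms by blast
  then show ?thesis using gen unfolding generated_in_degrees_le_def by simp
qed

text \<open>Being an intersection of submodules and not the whole type, the carrier is itself a submodule.
  In particular \<open>I HS\<^sub>i(I\<^sup>k) \<subseteq> HS\<^sub>i(I\<^bsup>k+1\<^esup>)\<close>.\<close>

lemma carrier_submodule: "submodule (carrier M) (rees_algebra R I) M"
proof -
  let ?gens = "{f \<in> carrier M. \<exists>k\<le>i. \<forall>l. l \<noteq> k \<longrightarrow> f l = \<zero>\<^bsub>R\<^esub>}"
  have "\<exists>N. submodule N (rees_algebra R I) M \<and> ?gens \<subseteq> N"
  proof (rule ccontr)
    assume no: "\<nexists>N. submodule N (rees_algebra R I) M \<and> ?gens \<subseteq> N"
    have "carrier M = \<Inter>{N. submodule N (rees_algebra R I) M \<and> ?gens \<subseteq> N}"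
      using gen unfolding generated_in_degrees_le_def generated_submodule_def .
    moreover have "{N. submodule N (rees_algebra R I) M \<and> ?gens \<subseteq> N} = {}" using no by blast
    ultimately have "carrier M = UNIV" by simp
    then have "(\<lambda>_. \<one>\<^bsub>R\<^esub>) \<in> carrier M" by simp
    then have "\<one>\<^bsub>R\<^esub> = \<zero>\<^bsub>R\<^esub>" unfolding carrier_HS_rees by simp
    then have "mterm \<one> {#} {#} = \<zero>" unfolding R_one R_zero by metis
    then show False by (simp add: mterm_def)
  qed
  then obtain N where N: "submodule N (rees_algebra R I) M" "?gens \<subseteq> N" by blast
  have "N \<subseteq> carrier M" using subgroup.subset[OF submodule.axioms(1)[OF N(1)]] by simp
  then have "N = carrier M" using carrier_subset_submodule[OF N] by blast
  then show ?thesis using N(1) by simp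
qed

text \<open>The Rees algebra element u t^a times the module element v t^b stays in the module; its
  coefficient at t^(a+b) gives the divisor. The component of degree 0 is zero by construction, hence
  \<open>b \<ge> 1\<close>.\<close>

lemma shift_gens_mult:
  assumes u: "u \<in> P a" and v: "v \<in> G b" and "b \<ge> 1"
  shows "\<exists>g\<in>G (a + b). g \<subseteq># u + v"
proof -
  have un: "u \<in> monomials n" and vn: "v \<in> monomials n"
    using u v P_monomials shift_gens_monomials by blast+
  have "monom_poly K u \<in> span (P a)"
    unfolding monom_poly_in_span[OF P_monomials un] using u by blast
  then have "monom_in_degree u a \<in> carrier (rees_algebra R I)"
    unfolding carrier_rees
    using monom_in_degree_up[OF un] zero_in_span[OF P_monomials] by (simp add: monom_in_degree_def)
  then have "monom_in_degree u a \<otimes>\<^bsub>UPR\<^esub> monom_in_degree v b \<in> carrier M"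
    using submodule.smult_closed[OF carrier_submodule] monom_in_degree_HS_rees[OF v \<open>b \<ge> 1\<close>]
    unfolding HS_rees_simps by blast
  then have "(monom_in_degree u a \<otimes>\<^bsub>UPR\<^esub> monom_in_degree v b) (a + b) \<in> span (G (a + b))"
    unfolding carrier_HS_rees using \<open>b \<ge> 1\<close> by simp
  moreover have "(monom_in_degree u a \<otimes>\<^bsub>UPR\<^esub> monom_in_degree v b) (a + b)
      = monom_poly K u \<otimes>\<^bsub>R\<^esub> monom_poly K v"
  proof -
    let ?t = "\<lambda>j. monom_in_degree u a j \<otimes>\<^bsub>R\<^esub> monom_in_degree v b (a + b - j)"
    have "(\<Oplus>\<^bsub>R\<^esub>j\<in>{..a + b}. ?t j) = ?t a"
      using monom_poly_closed[OF un] monom_poly_closed[OF vn]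
      by (intro R.finsum_single) (auto simp: monom_in_degree_def)
    then show ?thesis
      using UPR_mult[OF monom_in_degree_up[OF un] monom_in_degree_up[OF vn]]
      by (simp add: monom_in_degree_def)
  qed
  ultimately have "monom_poly K (u + v) \<in> span (G (a + b))" using monom_poly_add[OF un vn] by simp
  then show ?thesis using monom_poly_in_span[OF shift_gens_monomials] un vn by simp
qed

text \<open>\<open>m_inv\<close> is a definite description over the carrier of \<open>M\<close>, so
  componentwise negation has to be shown to lie in this carrier and to be the unique inverse
  there.\<close>

lemma inv_HS_rees:
  assumes f: "f \<in> carrier M"
  shows "m_inv (add_monoid M) f = (\<lambda>k. \<ominus>\<^bsub>R\<^esub> f k)"
proof -
  have fu: "f \<in> up R" using f unfolding carrier_HS_rees by blast
  then have fc: "f k \<in> carrier R" for k by (rule mem_upD)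
  let ?g = "\<lambda>k. \<ominus>\<^bsub>R\<^esub> f k"
  have gu: "?g \<in> up R" using R.up_a_inv_closed[OF fu] .
  have "?g k \<in> span (G k)" if "k \<ge> 1" for k
  proof -
    have "f k \<in> span (G k)" using f that unfolding carrier_HS_rees by blast
    then show ?thesis
      by (rule additive_subgroup.a_inv_closed[OF ideal.axioms(1)[OF ideal_span[OF shift_gens_monomials]]])
  qed
  moreover have "f 0 = \<zero>\<^bsub>R\<^esub>" using f unfolding carrier_HS_rees by blast
  ultimately have g: "?g \<in> carrier M" using gu unfolding carrier_HS_rees by simp
  show ?thesis
    unfolding m_inv_def
  proof (rule the_equality)
    show "?g \<in> carrier (add_monoid M) \<and> f \<otimes>\<^bsub>add_monoid M\<^esub> ?g = \<one>\<^bsub>add_monoid M\<^esub> \<and>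
      ?g \<otimes>\<^bsub>add_monoid M\<^esub> f = \<one>\<^bsub>add_monoid M\<^esub>"
      using g fc by (simp add: HS_rees_simps fu gu R.r_neg R.l_neg)
    fix y assume y: "y \<in> carrier (add_monoid M) \<and> f \<otimes>\<^bsub>add_monoid M\<^esub> y = \<one>\<^bsub>add_monoid M\<^esub> \<and>
      y \<otimes>\<^bsub>add_monoid M\<^esub> f = \<one>\<^bsub>add_monoid M\<^esub>"
    then have yu: "y \<in> up R" using carrier_HS_rees by simp
    then have yc: "y k \<in> carrier R" for k by (rule mem_upD)
    have "(\<lambda>k. y k \<oplus>\<^bsub>R\<^esub> f k) = (\<lambda>_. \<zero>\<^bsub>R\<^esub>)"
      using y by (simp add: HS_rees_simps fu yu)
    then have "y k \<oplus>\<^bsub>R\<^esub> f k = \<zero>\<^bsub>R\<^esub>" for k by (rule fun_cong)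
    then have "\<ominus>\<^bsub>R\<^esub> f k = y k" for k by (rule R.minus_equality[OF _ fc yc])
    then show "y = ?g" by (intro ext) simp
  qed
qed

text \<open>The elements whose component in degree \<open>Suc k\<close> lies in I HS_i(I^k) form a
  submodule \<open>N\<close>. It contains the homogeneous elements of degree at most
  \<open>i\<close>, whose component there is zero because \<open>i \<le> k\<close>. By (A) it is
  everything.\<close>

lemma shift_gens_Suc:
  assumes k: "k \<ge> i" and i: "i > 0"
  shows "span (G (Suc k)) = span (mset_sum B (G k))"
proof
  let ?J = "span (mset_sum B (G k))"
  have BG: "mset_sum B (G k) \<subseteq> monomials n"
    using mset_sum_monomials[OF B_monomials shift_gens_monomials] .
  interpret J: ideal ?J R by (rule ideal_span[OF BG])
  have prod: "span (mset_sum (P (Suc j)) (G b)) \<subseteq> ?J" if b: "b \<ge> 1" "j + b = k" for j b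
    unfolding span_subset_iff[OF mset_sum_monomials[OF P_monomials shift_gens_monomials] BG]
  proof
    fix w assume "w \<in> mset_sum (P (Suc j)) (G b)"
    then obtain u c v where w: "w = u + c + v" "u \<in> P j" "c \<in> B" "v \<in> G b"
      unfolding mset_pow.simps mset_sum_def by blast
    then obtain g where g: "g \<in> G k" "g \<subseteq># u + v" using shift_gens_mult b by blast
    then have "c + g \<subseteq># w" unfolding w(1) by (simp add: ac_simps)
    then show "\<exists>b\<in>mset_sum B (G k). b \<subseteq># w" using w(3) g(1) unfolding mset_sum_def by blast
  qed
  define N where "N = {f \<in> carrier M. f (Suc k) \<in> ?J}"
  have car: "carrier M \<subseteq> up R" unfolding carrier_HS_rees by blast
  have subgrp: "subgroup (carrier M) (add_monoid M)" by (rule submodule.axioms(1)[OF carrier_submodule])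
  have "submodule N (rees_algebra R I) M"
  proof (intro submodule.intro subgroup.intro submodule_axioms.intro)
    show "N \<subseteq> carrier (add_monoid M)" unfolding N_def by auto
  next
    fix f g assume f: "f \<in> N" and g: "g \<in> N"
    then have "f \<oplus>\<^bsub>M\<^esub> g \<in> carrier M" using subgroup.m_closed[OF subgrp, of f g] unfolding N_def by simp
    moreover have "(f \<oplus>\<^bsub>M\<^esub> g) (Suc k) = f (Suc k) \<oplus>\<^bsub>R\<^esub> g (Suc k)"
      using f g car unfolding N_def by (subst HS_rees_simps(2)) auto
    ultimately show "f \<otimes>\<^bsub>add_monoid M\<^esub> g \<in> N" using f g J.a_closed unfolding N_def by simp
  next
    have "\<zero>\<^bsub>M\<^esub> \<in> carrier M" using subgroup.one_closed[OF subgrp] by simp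
    then show "\<one>\<^bsub>add_monoid M\<^esub> \<in> N" unfolding N_def by (simp add: HS_rees_simps)
  next
    fix f assume f: "f \<in> N"
    then have "inv\<^bsub>add_monoid M\<^esub> f \<in> carrier M"
      using subgroup.m_inv_closed[OF subgrp, of f] unfolding N_def by simp
    then show "inv\<^bsub>add_monoid M\<^esub> f \<in> N"
      using f inv_HS_rees[of f] J.a_inv_closed unfolding N_def by simp
  next
    fix r f assume r: "r \<in> carrier (rees_algebra R I)" and f: "f \<in> N"
    have fM: "f \<in> carrier M" using f unfolding N_def by blast
    have rM: "r \<odot>\<^bsub>M\<^esub> f \<in> carrier M" using submodule.smult_closed[OF carrier_submodule r fM] .
    have ru: "r \<in> up R" "\<And>j. r j \<in> span (P j)" using r unfolding carrier_rees by auto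
    have fu: "f \<in> up R" "f 0 = \<zero>\<^bsub>R\<^esub>" "\<And>j. j \<ge> 1 \<Longrightarrow> f j \<in> span (G j)"
      using fM unfolding carrier_HS_rees by auto
    have "r j \<otimes>\<^bsub>R\<^esub> f (Suc k - j) \<in> ?J" if j: "j \<in> {..Suc k}" for j
    proof -
      have rj: "r j \<in> carrier R" using ru(1) by (rule mem_upD)
      \<comment> \<open>The factor of degree 0 is harmless since \<open>f\<close> is in
        \<open>N\<close>, and the one of degree \<open>Suc k\<close> meets the zero component of
        \<open>f\<close>. In between, one factor I is split off from I^j, and the remaining power
        carries the component of \<open>f\<close> into HS_i(I^k).\<close>
      consider "j = 0" | "j = Suc k" | l where "j = Suc l" "k - l \<ge> 1" "l + (k - l) = k"
      proof (cases j)
        case (Suc l)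
        then have "l \<le> k" using j by simp
        then have "j = Suc k \<or> k - l \<ge> 1 \<and> l + (k - l) = k" using Suc by auto
        then show thesis using Suc that by blast
      qed (use that in blast)
      then show ?thesis
      proof cases
        case 1
        then show ?thesis using f J.I_l_closed rj unfolding N_def by simp
      next
        case 2
        then show ?thesis using fu(2) rj by simp
      next
        case 3
        have "r j \<otimes>\<^bsub>R\<^esub> f (k - l) \<in> span (mset_sum (P (Suc l)) (G (k - l)))"
          using span_mult[OF P_monomials shift_gens_monomials ru(2) fu(3)] 3 by metis
        then show ?thesis using prod[OF 3(2,3)] 3(1) by auto
      qed
    qed
    then have "(r \<otimes>\<^bsub>UPR\<^esub> f) (Suc k) \<in> ?J"
      unfolding UPR_mult[OF ru(1) fu(1)] by (intro J.finsum_mem) auto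
    then show "r \<odot>\<^bsub>M\<^esub> f \<in> N" using rM unfolding N_def by (simp add: HS_rees_simps)
  qed
  moreover have "{f \<in> carrier M. \<exists>d\<le>i. \<forall>l. l \<noteq> d \<longrightarrow> f l = \<zero>\<^bsub>R\<^esub>} \<subseteq> N"
  proof
    fix f assume "f \<in> {f \<in> carrier M. \<exists>d\<le>i. \<forall>l. l \<noteq> d \<longrightarrow> f l = \<zero>\<^bsub>R\<^esub>}"
    then obtain d where f: "f \<in> carrier M" "d \<le> i" "\<And>l. l \<noteq> d \<Longrightarrow> f l = \<zero>\<^bsub>R\<^esub>" by blast
    then have "f (Suc k) = \<zero>\<^bsub>R\<^esub>" using k by force
    then show "f \<in> N" using f(1) J.zero_closed unfolding N_def by simp
  qed
  ultimately have sub: "carrier M \<subseteq> N" by (rule carrier_subset_submodule)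
  show "span (G (Suc k)) \<subseteq> ?J"
    unfolding span_subset_iff[OF shift_gens_monomials BG]
  proof
    fix g assume g: "g \<in> G (Suc k)"
    then have "monom_in_degree g (Suc k) \<in> N" using sub monom_in_degree_HS_rees by force
    then have "monom_poly K g \<in> ?J" unfolding N_def monom_in_degree_def by simp
    then show "\<exists>b\<in>mset_sum B (G k). b \<subseteq># g"
      using monom_poly_in_span[OF BG] g shift_gens_monomials by blast
  qed
  show "?J \<subseteq> span (G (Suc k))"
    unfolding span_subset_iff[OF BG shift_gens_monomials]
  proof
    fix w assume "w \<in> mset_sum B (G k)"
    then obtain b v where w: "w = b + v" "b \<in> B" "v \<in> G k" unfolding mset_sum_def by blast
    have "b \<in> P 1" using w(2) by (auto simp: mset_sum_def)
    then show "\<exists>g\<in>G (Suc k). g \<subseteq># w"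
      using shift_gens_mult[of b 1 v k] w k i by simp
  qed
qed

lemma Ass_HS_subset:
  assumes k: "k \<ge> i" and i: "i > 0"
  shows "Ass R (span (G k)) \<subseteq> Ass R (span (G (Suc k)))"
proof
  fix p assume "p \<in> Ass R (span (G k))"
  then obtain y where p: "primeideal p R" and y: "y \<in> carrier R"
    and p_eq: "p = {r \<in> carrier R. r \<otimes>\<^bsub>R\<^esub> y \<in> span (G k)}"
    unfolding R.Ass_iff[OF ideal_span[OF shift_gens_monomials]] by blast
  interpret p: primeideal p R by fact
  let ?J = "span (mset_sum B (G k))"
  have BG: "mset_sum B (G k) \<subseteq> monomials n"
    using mset_sum_monomials[OF B_monomials shift_gens_monomials] .
  interpret J: ideal ?J R by (rule ideal_span[OF BG])
  \<comment> \<open>\<open>Q b\<close> is the colon ideal of I HS_i(I^k) by the product of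
    \<open>b\<close> and \<open>y\<close>, hence a candidate for the same prime one power
    higher.\<close>
  define Q where "Q b = {r \<in> carrier R. r \<otimes>\<^bsub>R\<^esub> (monom_poly K b \<otimes>\<^bsub>R\<^esub> y) \<in> ?J}" for b
  have bc: "monom_poly K b \<in> carrier R" if "b \<in> B" for b
    using that B_monomials monom_poly_closed by blast
  have swap: "r \<otimes>\<^bsub>R\<^esub> (monom_poly K b \<otimes>\<^bsub>R\<^esub> y) = monom_poly K b \<otimes>\<^bsub>R\<^esub> (r \<otimes>\<^bsub>R\<^esub> y)"
    if "b \<in> B" "r \<in> carrier R" for b r
    using bc[OF that(1)] that(2) y by (simp add: R.m_lcomm)
  have "ideal (Q b) R" if b: "b \<in> B" for b
  proof (rule idealI)
    have z: "monom_poly K b \<otimes>\<^bsub>R\<^esub> y \<in> carrier R" using bc[OF b] y by simp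
    show "subgroup (Q b) (add_monoid R)"
      by (rule R.add.subgroupI)
        (use z J.a_closed J.zero_closed J.a_inv_closed R.l_null[OF z] R.zero_closed in
          \<open>auto simp: Q_def R.l_distr R.l_minus\<close>)
    fix a x assume a: "a \<in> Q b" and x: "x \<in> carrier R"
    then have "x \<otimes>\<^bsub>R\<^esub> a \<otimes>\<^bsub>R\<^esub> (monom_poly K b \<otimes>\<^bsub>R\<^esub> y) \<in> ?J"
      using z J.I_l_closed unfolding Q_def by (simp add: R.m_assoc)
    then show "x \<otimes>\<^bsub>R\<^esub> a \<in> Q b" using a x unfolding Q_def by simp
    then show "a \<otimes>\<^bsub>R\<^esub> x \<in> Q b" using a x R.m_comm[of a x] unfolding Q_def by simp
  qed (rule R.ring_axioms)
  moreover have "carrier R \<inter> (\<Inter>b\<in>B. Q b) \<subseteq> p"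
  proof
    fix r assume "r \<in> carrier R \<inter> (\<Inter>b\<in>B. Q b)"
    then have r: "r \<in> carrier R" and rQ: "\<And>b. b \<in> B \<Longrightarrow> r \<in> Q b" by auto
    define z where "z = r \<otimes>\<^bsub>R\<^esub> y"
    have z: "z \<in> carrier R" unfolding z_def using r y by simp
    \<comment> \<open>Cancellation is applied to each monomial \<open>m\<close> of \<open>z\<close>:
      multiplying \<open>z\<close> by the monomial \<open>b\<close> moves its coefficient to
      \<open>m + b\<close> without mixing it with others.\<close>
    have "\<exists>a\<in>G k. a \<subseteq># m" if m: "z m \<noteq> \<zero>" for m
    proof (rule shift_gens_cancel)
      fix b assume b: "b \<in> B"
      have "monom_poly K b \<otimes>\<^bsub>R\<^esub> z \<in> ?J" using rQ[OF b] swap[OF b r] unfolding Q_def z_def by simp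
      moreover have "(monom_poly K b \<otimes>\<^bsub>R\<^esub> z) (m + b) \<noteq> \<zero>"
        using m unfolding monom_poly_mult[OF z] by simp
      ultimately show "\<exists>g\<in>mset_sum B (G k). g \<subseteq># m + b" using mem_span[OF BG] by blast
    qed
    then have "z \<in> span (G k)" using z mem_span[OF shift_gens_monomials] by blast
    then show "r \<in> p" using r unfolding p_eq z_def by simp
  qed
  moreover have "finite B"
  proof -
    have "B \<subseteq> P 1" by (auto simp: mset_sum_def)
    then show ?thesis using finite_P finite_subset by blast
  qed
  ultimately obtain b where b: "b \<in> B" "Q b \<subseteq> p"
    using p.ex_subset_of_Inter_subset[of B Q] by blast
  have "p \<subseteq> Q b"
  proof
    fix r assume "r \<in> p"
    then have r: "r \<in> carrier R" "r \<otimes>\<^bsub>R\<^esub> y \<in> span (G k)" unfolding p_eq by auto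
    have "monom_poly K b \<in> span B"
      using b(1) B_monomials by (subst monom_poly_in_span) auto
    then have "monom_poly K b \<otimes>\<^bsub>R\<^esub> (r \<otimes>\<^bsub>R\<^esub> y) \<in> ?J"
      using span_mult[OF B_monomials shift_gens_monomials _ r(2)] by blast
    then show "r \<in> Q b" using r(1) swap[OF b(1) r(1)] unfolding Q_def by simp
  qed
  then have "p = Q b" using b(2) by blast
  moreover have "monom_poly K b \<otimes>\<^bsub>R\<^esub> y \<in> carrier R" using bc[OF b(1)] y by simp
  ultimately have "p \<in> Ass R ?J"
    unfolding R.Ass_iff[OF J.ideal_axioms] Q_def using p by blast
  then show "p \<in> Ass R (span (G (Suc k)))" using shift_gens_Suc[OF k i] by simp
qed

end

end

theorem theorem7p3:
  shows "(\<forall>K :: 'k ring. field K \<longrightarrow>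
            (\<forall>n\<ge>1. \<forall>I. polymatroidal K n I \<longrightarrow>
              (\<forall>i>0. generated_in_degrees_le (rees_algebra (mpoly_ring K n) I) (HS_rees K n i I)
                        \<zero>\<^bsub>mpoly_ring K n\<^esub> i)))
     \<longrightarrow> (\<forall>K :: 'k ring. field K \<longrightarrow>
            (\<forall>n\<ge>1. \<forall>I. polymatroidal K n I \<longrightarrow>
              (\<forall>i>0. \<forall>k\<ge>i.
                 Ass (mpoly_ring K n) (HS K n i (ideal_pow (mpoly_ring K n) I k))
               \<subseteq> Ass (mpoly_ring K n) (HS K n i (ideal_pow (mpoly_ring K n) I (Suc k))))))"
proof (intro impI allI)
  fix K :: "'k ring" and n :: nat and I and i k :: nat
  assume A: "\<forall>K :: 'k ring. field K \<longrightarrow> (\<forall>n\<ge>1. \<forall>I. polymatroidal K n I \<longrightarrow>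
      (\<forall>i>0. generated_in_degrees_le (rees_algebra (mpoly_ring K n) I) (HS_rees K n i I)
        \<zero>\<^bsub>mpoly_ring K n\<^esub> i))"
    and K: "field K" and n: "1 \<le> n" and I: "polymatroidal K n I" and i: "0 < i" "i \<le> k"
  interpret polymatroid K n I
    by (intro polymatroid.intro mpoly.intro polymatroid_axioms.intro K I)
  show "Ass R (HS K n i (ideal_pow R I k)) \<subseteq> Ass R (HS K n i (ideal_pow R I (Suc k)))"
    unfolding HS_eq using Ass_HS_subset A K n I i by blast
qed

end
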